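(* Let $B$ be a Koosis function with real simple zeros $\mathbf{b}=\{b_k:k\ge1\}$ (an infinite set) such that $\lim\mathbf{b}=\{1\}$. For $a>0$, consider the set $$\mathbf{a}=\left\{\frac{\alpha+2k\pi-i(a+\ln(|\gamma|))}{\alpha+2k\pi+i(a-\ln(|\gamma|))}:k\in\mathbb{Z}\right\},\qquad\alpha=\arg\left(\frac{\gamma}{|\gamma|}\right),$$ for every $|\gamma|<1$ such that $A_{\psi_a,\gamma}$ is a Blaschke product and $\alpha\ne k\pi$ for all $k\in\mathbb{Z}$. Then $\mathbf{a},\mathbf{b}$ are disjoint infinite subsets of $\mathbb{D}$ such that (i) $\mathbf{a}$ and $\mathbf{b}$ satisfy the Blaschke condition; (ii) $\lim\mathbf{a}=\lim\mathbf{b}=\{1\}$; (iii) $\dim\left(\mathcal{Z}_{\mathbf{a}}^\perp\cap\mathcal{Z}_{\mathbf{b}}\right)=\infty$ and $\dim\left(\mathcal{Z}_{\mathbf{a}}\cap\mathcal{Z}_{\mathbf{b}}^\perp\right)=0$. In particular, there is no geodesic in $\mathrm{Gr}(H^2)$ joining the subspaces $\mathcal{Z}_{\mathbf{a}}$ and $\mathcal{Z}_{\mathbf{b}}$.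
   Context: $H^2$, $H^\infty$ are the Hardy spaces of the unit disk $\mathbb{D}$, $C$ is the algebra of continuous functions on the unit circle $\mathbb{T}$, and $H^\infty+C=\{f+g:f\in H^\infty,g\in C\}\subset L^\infty(\mathbb{T})$. For $a>0$, $\psi_a(z)=\exp\left(a\frac{z+1}{z-1}\right)$ (a singular inner function). A Koosis function is a Blaschke product $B$ such that $\psi_a\bar B\in H^\infty+C$ for all $a>0$. For an inner function $\psi$ and $|\gamma|<1$, $A_{\psi,\gamma}(z)=\frac{\psi(z)-\gamma}{1-\bar\gamma\psi(z)}$. A set $\{a_k\}\subset\mathbb{D}$ satisfies the Blaschke condition if $\sum_k(1-|a_k|)<\infty$. $\mathcal{Z}_{\mathbf{a}}=\{f\in H^2:f(w)=0\text{ for all }w\in\mathbf{a}\}$, similarly for $\mathbf{b}$; orthogonal complements are in $H^2$. $\lim\mathbf{a}=\overline{\mathbf{a}}\setminus\mathbf{a}$ is the limit set. $\mathrm{Gr}(H^2)$ is the manifold of closed subspaces of $H^2$; a geodesic joining $\mathcal{S}$ and $\mathcal{T}$ is a curve $\delta(t)=e^{itX}\mathcal{S}$, $t\in[0,1]$, with $X=X^*$ bounded such that $X\mathcal{S}\subset\mathcal{S}^\perp$, $X\mathcal{S}^\perp\subset\mathcal{S}$ and $e^{iX}\mathcal{S}=\mathcal{T}$. *)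

theory Defs
  imports
    "HOL-Complex_Analysis.Complex_Analysis"
    "HOL-Library.Function_Algebras"
    "HOL-Library.Extended_Nat"
begin

abbreviation unit_disk :: "complex set" where
  "unit_disk \<equiv> ball 0 1"

definition scaleF :: "complex \<Rightarrow> (complex \<Rightarrow> complex) \<Rightarrow> complex \<Rightarrow> complex" where
  "scaleF c f = (\<lambda>z. c * f z)"

interpretation cfun: vector_space scaleF
  by unfold_locales (auto simp: scaleF_def fun_eq_iff algebra_simps)

text \<open>The dimension over the complex numbers; \<^const>\<open>vector_space.dim\<close> by itself would
  return 0 for an infinite-dimensional space.\<close>

definition cdim :: "(complex \<Rightarrow> complex) set \<Rightarrow> enat" where
  "cdim V = (if \<exists>S. finite S \<and> V \<subseteq> cfun.span S then enat (cfun.dim V) else \<infinity>)"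

text \<open>Elements of the Hardy space are holomorphic functions on the disk. They are extended by 0
  outside, so that equality in the Hardy space is equality of HOL functions.\<close>

definition H2 :: "(complex \<Rightarrow> complex) set" where
  "H2 = {f. f holomorphic_on unit_disk \<and> (\<forall>z. z \<notin> unit_disk \<longrightarrow> f z = 0) \<and>
            bdd_above ((\<lambda>r. integral {0..2*pi} (\<lambda>t. (cmod (f (of_real r * cis t)))\<^sup>2)) ` {0..<1})}"

text \<open>For elements of the Hardy space this limit exists and is the inner product of the boundary
  values in the space of square-integrable functions on the circle with normalized arc length.\<close>

definition h2_inner :: "(complex \<Rightarrow> complex) \<Rightarrow> (complex \<Rightarrow> complex) \<Rightarrow> complex" where
  "h2_inner f g = Lim (at_left (1::real))
     (\<lambda>r. integral {0..2*pi} (\<lambda>t. f (of_real r * cis t) * cnj (g (of_real r * cis t))) / of_real (2*pi))"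

definition h2_norm :: "(complex \<Rightarrow> complex) \<Rightarrow> real" where
  "h2_norm f = sqrt (Re (h2_inner f f))"

definition h2_orth :: "(complex \<Rightarrow> complex) set \<Rightarrow> (complex \<Rightarrow> complex) set" where
  "h2_orth S = {f \<in> H2. \<forall>g\<in>S. h2_inner f g = 0}"

definition vanishing_subspace :: "complex set \<Rightarrow> (complex \<Rightarrow> complex) set" where
  "vanishing_subspace W = {f \<in> H2. \<forall>w\<in>W. f w = 0}"

definition h2_lim :: "(nat \<Rightarrow> complex \<Rightarrow> complex) \<Rightarrow> (complex \<Rightarrow> complex) \<Rightarrow> bool" where
  "h2_lim s f \<longleftrightarrow> f \<in> H2 \<and> (\<lambda>n. h2_norm (s n - f)) \<longlonglongrightarrow> 0"

definition Gr_H2 :: "(complex \<Rightarrow> complex) set set" where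
  "Gr_H2 = {S. S \<subseteq> H2 \<and> cfun.subspace S \<and> (\<forall>s f. (\<forall>n. s n \<in> S) \<and> h2_lim s f \<longrightarrow> f \<in> S)}"

definition h2_bounded_operator ::
    "((complex \<Rightarrow> complex) \<Rightarrow> (complex \<Rightarrow> complex)) \<Rightarrow> bool" where
  "h2_bounded_operator X \<longleftrightarrow>
     (\<forall>f\<in>H2. X f \<in> H2) \<and>
     (\<forall>f\<in>H2. \<forall>g\<in>H2. X (f + g) = X f + X g) \<and>
     (\<forall>c. \<forall>f\<in>H2. X (scaleF c f) = scaleF c (X f)) \<and>
     (\<exists>M. \<forall>f\<in>H2. h2_norm (X f) \<le> M * h2_norm f)"

definition h2_selfadjoint ::
    "((complex \<Rightarrow> complex) \<Rightarrow> (complex \<Rightarrow> complex)) \<Rightarrow> bool" where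
  "h2_selfadjoint X \<longleftrightarrow> (\<forall>f\<in>H2. \<forall>g\<in>H2. h2_inner (X f) g = h2_inner f (X g))"

definition h2_exp ::
    "((complex \<Rightarrow> complex) \<Rightarrow> (complex \<Rightarrow> complex)) \<Rightarrow> (complex \<Rightarrow> complex) \<Rightarrow> (complex \<Rightarrow> complex)" where
  "h2_exp Y f = (THE g. h2_lim (\<lambda>N. \<Sum>n<N. scaleF (1 / fact n) ((Y ^^ n) f)) g)"

definition geodesic_joining ::
    "(real \<Rightarrow> (complex \<Rightarrow> complex) set) \<Rightarrow> (complex \<Rightarrow> complex) set \<Rightarrow> (complex \<Rightarrow> complex) set \<Rightarrow> bool" where
  "geodesic_joining \<delta> S T \<longleftrightarrow>
     (\<exists>X. h2_bounded_operator X \<and> h2_selfadjoint X \<and>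
          X ` S \<subseteq> h2_orth S \<and> X ` h2_orth S \<subseteq> S \<and>
          (\<forall>t\<in>{0..1}. \<delta> t = h2_exp (\<lambda>f. scaleF (\<i> * of_real t) (X f)) ` S) \<and>
          h2_exp (\<lambda>f. scaleF \<i> (X f)) ` S = T)"

definition Hinf :: "(complex \<Rightarrow> complex) set" where
  "Hinf = {f. f holomorphic_on unit_disk \<and> bounded (f ` unit_disk)}"

text \<open>\<open>u\<close> represents the boundary function of \<open>f\<close>. Radial limits determine \<open>u\<close> almost everywhere
  on the circle, and they exist for every bounded holomorphic \<open>f\<close> by Fatou's theorem.\<close>

definition has_boundary_function ::
    "(complex \<Rightarrow> complex) \<Rightarrow> (complex \<Rightarrow> complex) \<Rightarrow> bool" where
  "has_boundary_function f u \<longleftrightarrow>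
     (AE t\<in>{0..2*pi} in lborel. ((\<lambda>r::real. f (of_real r * cis t)) \<longlongrightarrow> u (cis t)) (at_left 1))"

definition Hinf_plus_C :: "(complex \<Rightarrow> complex) set" where
  "Hinf_plus_C = {\<phi>. \<exists>f\<in>Hinf. \<exists>u g. has_boundary_function f u \<and> continuous_on (sphere 0 1) g \<and>
     (AE t\<in>{0..2*pi} in lborel. \<phi> (cis t) = u (cis t) + g (cis t))}"

definition psi :: "real \<Rightarrow> complex \<Rightarrow> complex" where
  "psi a z = exp (of_real a * ((z + 1) / (z - 1)))"

definition frostman_shift :: "(complex \<Rightarrow> complex) \<Rightarrow> complex \<Rightarrow> complex \<Rightarrow> complex" where
  "frostman_shift \<psi> \<gamma> z = (\<psi> z - \<gamma>) / (1 - cnj \<gamma> * \<psi> z)"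

definition blaschke_factor :: "complex \<Rightarrow> complex \<Rightarrow> complex" where
  "blaschke_factor w z =
     (if w = 0 then z else (of_real (cmod w) / w) * ((w - z) / (1 - cnj w * z)))"

text \<open>The index set \<open>K\<close> may be finite or infinite, and \<open>w\<close> lists the zeros with multiplicity.\<close>

definition is_blaschke_product :: "(complex \<Rightarrow> complex) \<Rightarrow> bool" where
  "is_blaschke_product B \<longleftrightarrow>
     (\<exists>c w. \<exists>K::nat set. cmod c = 1 \<and> (\<forall>k\<in>K. w k \<in> unit_disk) \<and>
        (\<lambda>k. 1 - cmod (w k)) summable_on K \<and>
        (\<forall>z\<in>unit_disk. B z = c * (\<Prod>k. if k \<in> K then blaschke_factor (w k) z else 1)))"

definition is_koosis :: "(complex \<Rightarrow> complex) \<Rightarrow> bool" where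
  "is_koosis B \<longleftrightarrow> is_blaschke_product B \<and>
     (\<exists>u. has_boundary_function B u \<and> (\<forall>a>0. (\<lambda>\<zeta>. psi a \<zeta> * cnj (u \<zeta>)) \<in> Hinf_plus_C))"

definition blaschke_condition :: "complex set \<Rightarrow> bool" where
  "blaschke_condition S \<longleftrightarrow> (\<lambda>z. 1 - cmod z) summable_on S"

definition limit_set :: "complex set \<Rightarrow> complex set" where
  "limit_set S = closure S - S"

end

(*
  Write E = B H^2, where B is the Koosis function, and psi_c for the singular inner functions. The
  hypothesis says that the Hankel operators with symbol psi_c * conj B are compact for every c > 0,
  so the distance from psi_c z^m h to E is at most |h|/2 for all h in H^2 if m is large. Applying
  this to (psi_d - e^(-d))^m h, which vanishes to order m at the origin, and using
  |P_E psi_c h| <= |P_E psi_(c+d) h|, one finds that P_E is bounded below on psi_c H^2 for every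
  c > 0. Hence psi_c H^2 meets the complement of E only in 0, and P_(psi_c H^2) maps E onto
  psi_c H^2. Lifting to E the elements psi_c y_j, with y_j orthogonal functions in the complement
  of psi_c H^2, gives arbitrarily many independent elements of E orthogonal to psi_(2c) H^2. The
  multiplier 1 - conj(gamma) psi_a carries both facts over to the Frostman shift A of psi_a, and
  Z_a = A H^2 because A is a Blaschke product with simple zeros.
*)
theory Submission
  imports Defs
begin

text \<open>Compactness alone would bound P_E below on psi_c H^2 only up to a possible
  finite-dimensional kernel. Multiplication by z^m reaches the part where the Hankel operator is
  small, but the inequality |P_E psi_c h| \<le> |P_E psi_(c+d) h| has no analogue for z. The
  function psi_d - e^(-d) serves both purposes: it vanishes at 0, and it consists of psi_d and a
  constant, so m such factors cost at most 2^m from above; they cost (1 - e^(-d))^m from below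
  because psi_d acts isometrically. As m is fixed by the exponent c/2 before d is chosen, m d fits
  into the other half of c.

  The exponent doubles to 2c because a lift e_j of psi_c y_j satisfies <e_j, psi_c psi_c x> = <y_j,
  psi_c x> = 0. The passage to A is, up to a constant, the Crofoot transform, division by 1 -
  conj(gamma) psi_a: it commutes with multiplication by B, hence preserves E, and it carries the
  complement of psi_a H^2 to that of A H^2.

  A geodesic is excluded because it would turn a nonzero vector of the infinite-dimensional
  intersection into a nonzero vector of the trivial one.\<close>

subsection \<open>The Hardy space as a Hilbert space of Taylor coefficients\<close>

lemma summable_square_add:
  fixes a b :: "nat \<Rightarrow> complex"
  assumes "summable (\<lambda>n. (cmod (a n))\<^sup>2)" "summable (\<lambda>n. (cmod (b n))\<^sup>2)"
  shows "summable (\<lambda>n. (cmod (a n + b n))\<^sup>2)"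
proof (rule summable_comparison_test')
  show "summable (\<lambda>n. 2 * (cmod (a n))\<^sup>2 + 2 * (cmod (b n))\<^sup>2)"
    by (intro summable_add summable_mult assms)
  show "norm ((cmod (a n + b n))\<^sup>2) \<le> 2 * (cmod (a n))\<^sup>2 + 2 * (cmod (b n))\<^sup>2" if "n \<ge> 0" for n
  proof -
    have "(cmod (a n + b n))\<^sup>2 \<le> (cmod (a n) + cmod (b n))\<^sup>2"
      by (intro power_mono norm_triangle_ineq) auto
    also have "\<dots> \<le> 2 * (cmod (a n))\<^sup>2 + 2 * (cmod (b n))\<^sup>2"
      using sum_squares_bound[of "cmod (a n)" "cmod (b n)"] by (simp add: power2_sum)
    finally show ?thesis by simp
  qed
qed

lemma summable_norm_prod:
  fixes a b :: "nat \<Rightarrow> complex"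
  assumes "summable (\<lambda>n. (cmod (a n))\<^sup>2)" "summable (\<lambda>n. (cmod (b n))\<^sup>2)"
  shows "summable (\<lambda>n. cmod (a n) * cmod (b n))"
proof (rule summable_comparison_test')
  show "summable (\<lambda>n. (cmod (a n))\<^sup>2 + (cmod (b n))\<^sup>2)"
    by (intro summable_add assms)
  show "norm (cmod (a n) * cmod (b n)) \<le> (cmod (a n))\<^sup>2 + (cmod (b n))\<^sup>2" if "n \<ge> 0" for n
  proof -
    have "0 \<le> cmod (a n) * cmod (b n)" by simp
    moreover have "2 * (cmod (a n) * cmod (b n)) \<le> (cmod (a n))\<^sup>2 + (cmod (b n))\<^sup>2"
      using sum_squares_bound[of "cmod (a n)" "cmod (b n)"] by (simp add: mult.assoc)
    ultimately have "cmod (a n) * cmod (b n) \<le> (cmod (a n))\<^sup>2 + (cmod (b n))\<^sup>2" by linarith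
    then show ?thesis by simp
  qed
qed

text \<open>Square-summable Taylor coefficients stand in for H^2, so that the type classes for inner
  product and Banach spaces become available; \<open>ev\<close> leads back to functions on the
  disk.\<close>

typedef hardy = "{a :: nat \<Rightarrow> complex. summable (\<lambda>n. (cmod (a n))\<^sup>2)}"
  morphisms coef Hardy
  by (rule exI[of _ "\<lambda>_. 0"]) auto

setup_lifting type_definition_hardy

lemma summable_coef: "summable (\<lambda>n. (cmod (coef x n))\<^sup>2)"
  using coef[of x] by simp

lemma summable_coef_inner: "summable (\<lambda>n. coef x n \<bullet> coef y n)"
  by (rule summable_norm_cancel, rule summable_comparison_test'[OF summable_norm_prod[OF summable_coef summable_coef, of x y]])
     (simp add: Cauchy_Schwarz_ineq2)

instantiation hardy :: real_vector
begin
lift_definition zero_hardy :: hardy is "\<lambda>_. 0" by simp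
lift_definition plus_hardy :: "hardy \<Rightarrow> hardy \<Rightarrow> hardy" is "\<lambda>a b n. a n + b n"
  by (rule summable_square_add)
lift_definition uminus_hardy :: "hardy \<Rightarrow> hardy" is "\<lambda>a n. - a n" by simp
lift_definition minus_hardy :: "hardy \<Rightarrow> hardy \<Rightarrow> hardy" is "\<lambda>a b n. a n - b n"
  using summable_square_add[where b = "\<lambda>n. - b n" for b] by simp
lift_definition scaleR_hardy :: "real \<Rightarrow> hardy \<Rightarrow> hardy" is "\<lambda>c a n. of_real c * a n"
  by (simp add: norm_mult power_mult_distrib summable_mult)
instance
  by standard (transfer; force simp: algebra_simps)+
end

lemmas coef_simps [simp] = zero_hardy.rep_eq plus_hardy.rep_eq uminus_hardy.rep_eq
  minus_hardy.rep_eq scaleR_hardy.rep_eq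

lemma hardy_eqI: "(\<And>n. coef x n = coef y n) \<Longrightarrow> x = y"
  by (simp add: coef_inject[symmetric] fun_eq_iff)

instantiation hardy :: real_inner
begin
text \<open>The type class asks for a real inner product. This is the real part of the complex one,
  which is \<open>cinner\<close>.\<close>

definition inner_hardy :: "hardy \<Rightarrow> hardy \<Rightarrow> real" where
  "inner_hardy x y = (\<Sum>n. coef x n \<bullet> coef y n)"
definition norm_hardy :: "hardy \<Rightarrow> real" where "norm_hardy x = sqrt (inner x x)"
definition sgn_hardy :: "hardy \<Rightarrow> hardy" where "sgn_hardy x = x /\<^sub>R norm x"
definition dist_hardy :: "hardy \<Rightarrow> hardy \<Rightarrow> real" where "dist_hardy x y = norm (x - y)"
definition uniformity_hardy :: "(hardy \<times> hardy) filter" where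
  "uniformity_hardy = (INF e\<in>{0<..}. principal {(x, y). dist x y < e})"
definition open_hardy :: "hardy set \<Rightarrow> bool" where
  "open_hardy U = (\<forall>x\<in>U. eventually (\<lambda>(x', y). x' = x \<longrightarrow> y \<in> U) uniformity)"
instance
proof
  fix x y z :: hardy and r :: real
  show "inner x y = inner y x" by (simp add: inner_hardy_def inner_commute)
  show "inner (x + y) z = inner x z + inner y z"
    by (simp add: inner_hardy_def inner_add_left suminf_add summable_coef_inner)
  show "inner (r *\<^sub>R x) y = r * inner x y"
    by (simp add: inner_hardy_def inner_mult_left suminf_mult[symmetric] summable_coef_inner
        flip: scaleR_conv_of_real)
  show "0 \<le> inner x x" by (simp add: inner_hardy_def suminf_nonneg summable_coef_inner)
  show "inner x x = 0 \<longleftrightarrow> x = 0"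
  proof
    assume "inner x x = 0"
    then have "coef x n \<bullet> coef x n = 0" for n
      using suminf_eq_zero_iff[OF summable_coef_inner[of x x]] by (simp add: inner_hardy_def)
    then show "x = 0" by (intro hardy_eqI) simp
  qed (simp add: inner_hardy_def)
qed (simp_all add: norm_hardy_def sgn_hardy_def dist_hardy_def uniformity_hardy_def open_hardy_def)
end

lemma norm_hardy_sums: "(\<lambda>n. (cmod (coef x n))\<^sup>2) sums (norm x)\<^sup>2"
proof -
  have "(\<lambda>n. coef x n \<bullet> coef x n) sums (inner x x)"
    unfolding inner_hardy_def by (intro summable_sums summable_coef_inner)
  then show ?thesis
    by (simp add: power2_norm_eq_inner)
qed

lemma norm_coef_le: "cmod (coef x n) \<le> norm x"
proof (rule power2_le_imp_le)
  have "(\<Sum>i\<in>{n}. (cmod (coef x i))\<^sup>2) \<le> (norm x)\<^sup>2"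
    unfolding sums_unique[OF norm_hardy_sums] by (intro sum_le_suminf summable_coef) auto
  then show "(cmod (coef x n))\<^sup>2 \<le> (norm x)\<^sup>2" by simp
qed simp

lemma sum_coef_le: "(\<Sum>n<N. (cmod (coef x n))\<^sup>2) \<le> (norm x)\<^sup>2"
  unfolding sums_unique[OF norm_hardy_sums] by (intro sum_le_suminf summable_coef) auto

lemma norm_hardy_leI:
  assumes "\<And>N. (\<Sum>n<N. (cmod (coef x n))\<^sup>2) \<le> C\<^sup>2" "C \<ge> 0"
  shows "norm x \<le> C"
proof (rule power2_le_imp_le)
  show "(norm x)\<^sup>2 \<le> C\<^sup>2"
    unfolding sums_unique[OF norm_hardy_sums] using assms by (intro suminf_le_const summable_coef) auto
qed fact

text \<open>Coefficientwise limits exist, and the bounds on finite sums of squares are uniform in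
  their length, so they survive the limit and give convergence in norm.\<close>

instance hardy :: complete_space
proof
  fix X :: "nat \<Rightarrow> hardy"
  assume "Cauchy X"
  have "Cauchy (\<lambda>n. coef (X n) k)" for k
  proof (rule metric_CauchyI)
    fix e :: real assume "e > 0"
    then obtain M where M: "\<forall>m\<ge>M. \<forall>n\<ge>M. dist (X m) (X n) < e"
      using \<open>Cauchy X\<close> metric_CauchyD by blast
    have "dist (coef (X m) k) (coef (X n) k) < e" if "m \<ge> M" "n \<ge> M" for m n
      using norm_coef_le[of "X m - X n" k] M that by (fastforce simp: dist_norm)
    then show "\<exists>M. \<forall>m\<ge>M. \<forall>n\<ge>M. dist (coef (X m) k) (coef (X n) k) < e" by blast
  qed
  then have "\<forall>k. \<exists>l. (\<lambda>n. coef (X n) k) \<longlonglongrightarrow> l"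
    using Cauchy_convergent convergent_def by blast
  then obtain l where l: "\<And>k. (\<lambda>n. coef (X n) k) \<longlonglongrightarrow> l k" by metis
  have key: "\<exists>M. \<forall>n\<ge>M. \<forall>N. (\<Sum>k<N. (cmod (coef (X n) k - l k))\<^sup>2) \<le> e\<^sup>2" if e: "e > 0" for e
  proof -
    obtain M where M: "\<forall>m\<ge>M. \<forall>n\<ge>M. dist (X m) (X n) < e"
      using \<open>Cauchy X\<close> metric_CauchyD e by blast
    show ?thesis
    proof (intro exI allI impI)
      fix n N assume "n \<ge> M"
      show "(\<Sum>k<N. (cmod (coef (X n) k - l k))\<^sup>2) \<le> e\<^sup>2"
      proof (rule LIMSEQ_le_const2)
        show "(\<lambda>m. \<Sum>k<N. (cmod (coef (X n) k - coef (X m) k))\<^sup>2) \<longlonglongrightarrow> (\<Sum>k<N. (cmod (coef (X n) k - l k))\<^sup>2)"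
          by (intro tendsto_intros l)
        have "(\<Sum>k<N. (cmod (coef (X n) k - coef (X m) k))\<^sup>2) \<le> e\<^sup>2" if "m \<ge> M" for m
        proof -
          have "(\<Sum>k<N. (cmod (coef (X n) k - coef (X m) k))\<^sup>2) \<le> (norm (X n - X m))\<^sup>2"
            using sum_coef_le[of "X n - X m" N] by simp
          also have "\<dots> \<le> e\<^sup>2"
            using M that \<open>n \<ge> M\<close> by (intro power_mono) (auto simp: dist_norm less_imp_le)
          finally show ?thesis .
        qed
        then show "\<exists>M. \<forall>m\<ge>M. (\<Sum>k<N. (cmod (coef (X n) k - coef (X m) k))\<^sup>2) \<le> e\<^sup>2" by blast
      qed
    qed
  qed
  have "summable (\<lambda>k. (cmod (l k))\<^sup>2)"
  proof -
    obtain n where n: "\<And>N. (\<Sum>k<N. (cmod (coef (X n) k - l k))\<^sup>2) \<le> 1\<^sup>2"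
      using key[of 1] by auto
    have "summable (\<lambda>k. (cmod (l k - coef (X n) k))\<^sup>2)"
      using n by (intro summableI_nonneg_bounded[where x = 1]) (auto simp: norm_minus_commute)
    from summable_square_add[OF this summable_coef[of "X n"]] show ?thesis by simp
  qed
  then have c: "coef (Hardy l) = l" by (simp add: Hardy_inverse)
  have "X \<longlonglongrightarrow> Hardy l"
  proof (rule metric_LIMSEQ_I)
    fix e :: real assume "e > 0"
    then obtain M where M: "\<forall>n\<ge>M. \<forall>N. (\<Sum>k<N. (cmod (coef (X n) k - l k))\<^sup>2) \<le> (e/2)\<^sup>2"
      using key[of "e/2"] by auto
    have "norm (X n - Hardy l) \<le> e/2" if "n \<ge> M" for n
      using M that \<open>e > 0\<close> by (intro norm_hardy_leI) (auto simp: c)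
    then show "\<exists>no. \<forall>n\<ge>no. dist (X n) (Hardy l) < e"
      using \<open>e > 0\<close> by (intro exI[of _ M]) (auto simp: dist_norm intro: le_less_trans[where y = "e/2"])
  qed
  then show "convergent X" by (auto simp: convergent_def)
qed

instance hardy :: banach ..

subsection \<open>Parseval's identity on circles\<close>

lemma integral_cis_orthogonal:
  "((\<lambda>t. cis t ^ n * cnj (cis t ^ m)) has_integral (if n = m then 2 * pi else 0)) {0..2*pi}"
proof (cases "n = m")
  case True
  have "cis t ^ n * cnj (cis t ^ n) = 1" for t
    by (simp add: cis_cnj cis_mult flip: power_mult_distrib)
  moreover have "((\<lambda>t. 1 :: complex) has_integral of_real (2 * pi)) {0..2*pi}"
    using has_integral_const_real[of "1::complex" 0 "2*pi"] by (simp add: scaleR_conv_of_real)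
  ultimately show ?thesis using True by simp
next
  case False
  define k where "k = real n - real m"
  have k: "k \<noteq> 0" using False by (simp add: k_def)
  have eq: "cis t ^ n * cnj (cis t ^ m) = cis (k * t)" for t
    by (simp add: k_def Complex.DeMoivre cis_cnj cis_mult algebra_simps flip: complex_cnj_power)
  have der: "((\<lambda>t. cis (k * t) / (\<i> * of_real k)) has_vector_derivative cis (k * t)) (at t within S)" for t S
  proof -
    have "((\<lambda>w. exp (\<i> * (of_real k * w)) / (\<i> * of_real k)) has_field_derivative exp (\<i> * (of_real k * of_real t))) (at (of_real t))"
      by (rule derivative_eq_intros refl)+ (use k in \<open>simp_all add: complex_eq_iff\<close>)
    from has_vector_derivative_real_field[OF this] show ?thesis
      by (simp add: cis_conv_exp)
  qed
  have "((\<lambda>t. cis (k * t)) has_integral cis (k * (2*pi)) / (\<i> * of_real k) - cis (k * 0) / (\<i> * of_real k)) {0..2*pi}"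
    by (intro fundamental_theorem_of_calculus der) auto
  moreover have "cis (k * (2 * pi)) = 1"
  proof -
    have "k = of_int (int n - int m)" by (simp add: k_def)
    then show ?thesis using cis_multiple_2pi[of k] by (simp add: mult_ac)
  qed
  ultimately show ?thesis using False unfolding eq by simp
qed

text \<open>Absolute convergence at radius r makes both series converge uniformly on the circle. The
  product of the partial sums can then be integrated, and orthogonality of the powers of
  \<open>cis t\<close> leaves the diagonal.\<close>

lemma parseval_circle:
  fixes a b :: "nat \<Rightarrow> complex" and r :: real
  assumes r: "0 \<le> r"
    and a: "summable (\<lambda>n. cmod (a n) * r ^ n)" and b: "summable (\<lambda>n. cmod (b n) * r ^ n)"
    and f: "\<And>t. (\<lambda>n. a n * (of_real r * cis t) ^ n) sums f t"
    and g: "\<And>t. (\<lambda>n. b n * (of_real r * cis t) ^ n) sums g t"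
  shows "(\<lambda>n. a n * cnj (b n) * of_real (r ^ (2 * n))) sums (integral {0..2*pi} (\<lambda>t. f t * cnj (g t)) / of_real (2 * pi))"
    and "(\<lambda>t. f t * cnj (g t)) integrable_on {0..2*pi}"
proof -
  have ul: "uniform_limit {0..2*pi} (\<lambda>N t. \<Sum>n<N. c n * (of_real r * cis t) ^ n) h sequentially"
    "continuous_on {0..2*pi} h"
    if c: "summable (\<lambda>n. cmod (c n) * r ^ n)" and h: "\<And>t. (\<lambda>n. c n * (of_real r * cis t) ^ n) sums h t" for c h
  proof -
    have h': "h = (\<lambda>t. \<Sum>n. c n * (of_real r * cis t) ^ n)"
      using h by (simp add: sums_iff fun_eq_iff)
    show *: "uniform_limit {0..2*pi} (\<lambda>N t. \<Sum>n<N. c n * (of_real r * cis t) ^ n) h sequentially"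
      unfolding h' by (rule Weierstrass_m_test[OF _ c]) (use r in \<open>simp add: norm_mult norm_power\<close>)
    show "continuous_on {0..2*pi} h"
      by (rule uniform_limit_theorem[OF _ *]) (auto intro!: always_eventually continuous_intros)
  qed
  note ulf = ul[OF a f] and ulg = ul[OF b g]
  define F G where "F = (\<lambda>N t. \<Sum>n<N. a n * (of_real r * cis t) ^ n)"
    and "G = (\<lambda>N t. \<Sum>n<N. b n * (of_real r * cis t) ^ n)"
  have G: "uniform_limit {0..2*pi} (\<lambda>N t. cnj (G N t)) (\<lambda>t. cnj (g t)) sequentially"
    unfolding G_def by (rule bounded_linear.uniform_limit[OF bounded_linear_cnj ulg(1)])
  have cg: "continuous_on {0..2*pi} (\<lambda>t. cnj (g t))" by (intro continuous_intros ulg)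
  have "uniform_limit {0..2*pi} (\<lambda>N t. F N t * cnj (G N t)) (\<lambda>t. f t * cnj (g t)) sequentially"
    using ulf(1) G by (intro uniform_lim_mult compact_imp_bounded compact_continuous_image ulf(2) cg)
      (auto simp: F_def)
  then obtain I J where IJ: "\<And>N. ((\<lambda>t. F N t * cnj (G N t)) has_integral I N) {0..2*pi}"
      "((\<lambda>t. f t * cnj (g t)) has_integral J) {0..2*pi}" "I \<longlonglongrightarrow> J"
    by (rule uniform_limit_integral) (auto simp: F_def G_def intro!: continuous_intros)
  have I: "I N = 2 * pi * (\<Sum>n<N. a n * cnj (b n) * of_real (r ^ (2 * n)))" for N
  proof -
    have eq: "F N t * cnj (G N t) =
      (\<Sum>n<N. \<Sum>m<N. (a n * cnj (b m) * of_real (r ^ n * r ^ m)) * (cis t ^ n * cnj (cis t ^ m)))" for t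
      unfolding F_def G_def cnj_sum sum_product
      by (intro sum.cong refl) (simp only: power_mult_distrib complex_cnj_mult complex_cnj_power
          of_real_mult of_real_power complex_cnj_complex_of_real ac_simps)
    have "((\<lambda>t. F N t * cnj (G N t)) has_integral
      (\<Sum>n<N. \<Sum>m<N. (a n * cnj (b m) * of_real (r ^ n * r ^ m)) * (if n = m then 2 * pi else 0))) {0..2*pi}"
      unfolding eq by (intro has_integral_sum has_integral_mult_right integral_cis_orthogonal) auto
    moreover have "(\<Sum>n<N. \<Sum>m<N. (a n * cnj (b m) * of_real (r ^ n * r ^ m)) * (if n = m then 2 * pi else 0))
       = (\<Sum>n<N. \<Sum>m<N. if m = n then 2 * pi * (a n * cnj (b n) * of_real (r ^ (2 * n))) else 0)"
      by (intro sum.cong refl) (simp add: power_even_eq power2_eq_square)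
    ultimately have "((\<lambda>t. F N t * cnj (G N t)) has_integral
      2 * pi * (\<Sum>n<N. a n * cnj (b n) * of_real (r ^ (2 * n)))) {0..2*pi}"
      by (simp add: sum_distrib_left)
    then show ?thesis
      using IJ(1)[of N] has_integral_unique by blast
  qed
  have "(\<lambda>N. I N / of_real (2 * pi)) \<longlonglongrightarrow> J / of_real (2 * pi)"
    by (intro tendsto_intros IJ) auto
  then show "(\<lambda>n. a n * cnj (b n) * of_real (r ^ (2 * n))) sums (integral {0..2*pi} (\<lambda>t. f t * cnj (g t)) / of_real (2 * pi))"
    using IJ(2) by (simp add: I sums_def integral_unique)
  show "(\<lambda>t. f t * cnj (g t)) integrable_on {0..2*pi}"
    using IJ(2) by blast
qed

text \<open>The value 0 off the disk is the normalisation built into \<open>H2\<close>, so that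
  \<open>ev\<close> is a bijection onto \<open>H2\<close> with equality of HOL functions.\<close>

definition ev :: "hardy \<Rightarrow> complex \<Rightarrow> complex" where
  "ev x z = (if cmod z < 1 then \<Sum>n. coef x n * z ^ n else 0)"

lemma summable_coef_power: "0 \<le> r \<Longrightarrow> r < 1 \<Longrightarrow> summable (\<lambda>n. cmod (coef x n) * r ^ n)"
  by (rule summable_comparison_test'[OF summable_mult[OF summable_geometric[of r], of "norm x"]])
     (auto intro!: mult_right_mono norm_coef_le simp: abs_mult)

lemma ev_sums: "cmod z < 1 \<Longrightarrow> (\<lambda>n. coef x n * z ^ n) sums ev x z"
  unfolding ev_def
  by (auto intro!: summable_sums summable_norm_cancel[where f = "\<lambda>n. coef x n * z ^ n"]
      summable_coef_power simp: norm_mult norm_power)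

lemma ev_outside: "\<not> cmod z < 1 \<Longrightarrow> ev x z = 0"
  by (simp add: ev_def)

lemma ev_holomorphic: "ev x holomorphic_on ball 0 1"
  by (rule power_series_holomorphic[where a = "coef x"]) (use ev_sums in auto)

definition cinner :: "hardy \<Rightarrow> hardy \<Rightarrow> complex" where
  "cinner x y = (\<Sum>n. coef x n * cnj (coef y n))"

lemma summable_cinner: "summable (\<lambda>n. cmod (coef x n * cnj (coef y n)))"
  using summable_norm_prod[OF summable_coef summable_coef] by (simp add: norm_mult)

lemma cinner_sums: "(\<lambda>n. coef x n * cnj (coef y n)) sums cinner x y"
  unfolding cinner_def by (intro summable_sums summable_norm_cancel[OF summable_cinner])

lemma ev_circle:
  assumes "0 \<le> r" "r < 1"
  shows "(\<lambda>n. coef x n * cnj (coef y n) * of_real (r ^ (2 * n))) sums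
     (integral {0..2*pi} (\<lambda>t. ev x (of_real r * cis t) * cnj (ev y (of_real r * cis t))) / of_real (2 * pi))"
    and "(\<lambda>t. ev x (of_real r * cis t) * cnj (ev y (of_real r * cis t))) integrable_on {0..2*pi}"
  using parseval_circle[of r "coef x" "coef y" "\<lambda>t. ev x (of_real r * cis t)" "\<lambda>t. ev y (of_real r * cis t)"]
    assms summable_coef_power ev_sums by (auto simp: norm_mult)

text \<open>The coefficient products are absolutely summable, so the power series of the circle
  means converges uniformly up to r = 1 and is continuous there.\<close>

lemma ev_inner_tendsto:
  "((\<lambda>r. integral {0..2*pi} (\<lambda>t. ev x (of_real r * cis t) * cnj (ev y (of_real r * cis t))) / of_real (2 * pi))
     \<longlongrightarrow> cinner x y) (at_left (1::real))"
proof -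
  define h where "h = (\<lambda>r::real. \<Sum>n. coef x n * cnj (coef y n) * of_real (r ^ (2 * n)))"
  have "uniform_limit {0..1} (\<lambda>N r. \<Sum>n<N. coef x n * cnj (coef y n) * of_real (r ^ (2 * n))) h sequentially"
    unfolding h_def
  proof (rule Weierstrass_m_test[OF _ summable_cinner[of x y]])
    fix n and r :: real assume "r \<in> {0..1}"
    then show "cmod (coef x n * cnj (coef y n) * of_real (r ^ (2 * n))) \<le> cmod (coef x n * cnj (coef y n))"
      by (simp add: norm_mult norm_power power_le_one mult_left_le)
  qed
  then have "continuous_on {0..1} h"
    by (rule uniform_limit_theorem[rotated]) (auto intro!: always_eventually continuous_intros)
  then have "(h \<longlongrightarrow> h 1) (at_left 1)"
    by (simp add: continuous_on_Icc_at_leftD)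
  moreover have "h 1 = cinner x y" by (simp add: h_def cinner_def)
  moreover have "\<forall>\<^sub>F r in at_left (1::real). h r =
     integral {0..2*pi} (\<lambda>t. ev x (of_real r * cis t) * cnj (ev y (of_real r * cis t))) / of_real (2 * pi)"
  proof (rule eventually_mono[OF eventually_at_left_real[of 0 1]])
    fix r :: real assume "r \<in> {0<..<1}"
    then show "h r = integral {0..2*pi} (\<lambda>t. ev x (of_real r * cis t) * cnj (ev y (of_real r * cis t))) / of_real (2 * pi)"
      unfolding h_def by (intro sums_unique[symmetric] ev_circle(1)) auto
  qed simp
  ultimately show ?thesis
    using Lim_transform_eventually by fastforce
qed

lemma h2_inner_ev: "h2_inner (ev x) (ev y) = cinner x y"
  unfolding h2_inner_def using ev_inner_tendsto by (intro tendsto_Lim) auto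

lemma Re_cinner: "Re (cinner x y) = inner x y"
proof -
  have "(\<lambda>n. Re (coef x n * cnj (coef y n))) sums Re (cinner x y)"
    by (intro sums_Re cinner_sums)
  then have "(\<lambda>n. coef x n \<bullet> coef y n) sums Re (cinner x y)"
    by (simp add: inner_complex_def)
  then show ?thesis by (simp add: inner_hardy_def sums_iff)
qed

lemma cinner_self: "cinner x x = of_real ((norm x)\<^sup>2)"
proof -
  have "cinner x x = (\<Sum>n. of_real ((cmod (coef x n))\<^sup>2))"
    unfolding cinner_def complex_norm_square ..
  also have "\<dots> = of_real ((norm x)\<^sup>2)"
    using norm_hardy_sums[of x] sums_of_real sums_unique by metis
  finally show ?thesis .
qed

lemma h2_norm_ev: "h2_norm (ev x) = norm x"
  by (simp add: h2_norm_def h2_inner_ev cinner_self)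

text \<open>The two integrands are integrable together; if they are not, both integrals have the
  default value 0.\<close>

lemma integral_mult_cnj:
  "integral S (\<lambda>t. f t * cnj (f t)) = of_real (integral S (\<lambda>t. (cmod (f t))\<^sup>2))"
proof (cases "(\<lambda>t. (cmod (f t))\<^sup>2) integrable_on S")
  case True
  from integral_linear[OF this bounded_linear_of_real] show ?thesis
    unfolding complex_norm_square[symmetric] o_def .
next
  case False
  moreover have "\<not> (\<lambda>t. f t * cnj (f t)) integrable_on S"
  proof
    assume "(\<lambda>t. f t * cnj (f t)) integrable_on S"
    from integrable_linear[OF this bounded_linear_Re] have "(\<lambda>t. (cmod (f t))\<^sup>2) integrable_on S"
      unfolding complex_norm_square[symmetric] o_def Re_complex_of_real .
    with False show False by simp
  qed
  ultimately show ?thesis by (simp add: not_integrable_integral)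
qed

lemma ev_circle_norm:
  assumes "0 \<le> r" "r < 1"
  shows "(\<lambda>n. (cmod (coef x n))\<^sup>2 * r ^ (2 * n)) sums
     (integral {0..2*pi} (\<lambda>t. (cmod (ev x (of_real r * cis t)))\<^sup>2) / (2 * pi))" (is ?th1)
    and "(\<lambda>t. (cmod (ev x (of_real r * cis t)))\<^sup>2) integrable_on {0..2*pi}" (is ?th2)
proof -
  have eq: "integral {0..2*pi} (\<lambda>t. ev x (of_real r * cis t) * cnj (ev x (of_real r * cis t)))
     = of_real (integral {0..2*pi} (\<lambda>t. (cmod (ev x (of_real r * cis t)))\<^sup>2))"
    by (rule integral_mult_cnj)
  show ?th2
    using integrable_linear[OF ev_circle(2)[OF assms, of x x] bounded_linear_Re]
    by (simp add: o_def complex_norm_square[symmetric] del: of_real_power)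
  have "(\<lambda>n. of_real ((cmod (coef x n))\<^sup>2 * r ^ (2 * n)) :: complex) sums
     of_real (integral {0..2*pi} (\<lambda>t. (cmod (ev x (of_real r * cis t)))\<^sup>2) / (2 * pi))"
    using ev_circle(1)[OF assms, of x x] unfolding eq by (simp only: of_real_mult of_real_divide complex_norm_square)
  then show ?th1 by (simp only: sums_of_real_iff)
qed

lemma ev_circle_norm_le:
  assumes "0 \<le> r" "r < 1"
  shows "integral {0..2*pi} (\<lambda>t. (cmod (ev x (of_real r * cis t)))\<^sup>2) \<le> 2 * pi * (norm x)\<^sup>2"
proof -
  have "integral {0..2*pi} (\<lambda>t. (cmod (ev x (of_real r * cis t)))\<^sup>2) / (2 * pi) \<le> (norm x)\<^sup>2"
    by (rule sums_le[OF _ ev_circle_norm(1)[OF assms] norm_hardy_sums])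
      (use assms in \<open>auto intro!: mult_left_le power_le_one\<close>)
  then show ?thesis by (simp add: field_simps)
qed

lemma ev_circle_norm_tendsto:
  "((\<lambda>r. integral {0..2*pi} (\<lambda>t. (cmod (ev x (of_real r * cis t)))\<^sup>2)) \<longlongrightarrow> 2 * pi * (norm x)\<^sup>2) (at_left (1::real))"
proof -
  have eq: "integral {0..2*pi} (\<lambda>t. ev x (of_real r * cis t) * cnj (ev x (of_real r * cis t)))
     = of_real (integral {0..2*pi} (\<lambda>t. (cmod (ev x (of_real r * cis t)))\<^sup>2))" for r
    by (rule integral_mult_cnj)
  have "((\<lambda>r. 2 * pi * Re (integral {0..2*pi} (\<lambda>t. ev x (of_real r * cis t) * cnj (ev x (of_real r * cis t))) / of_real (2 * pi)))
    \<longlongrightarrow> 2 * pi * Re (cinner x x)) (at_left (1::real))"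
    by (intro tendsto_intros ev_inner_tendsto)
  then show ?thesis unfolding eq cinner_self by (simp flip: of_real_mult of_real_divide)
qed

text \<open>The norm of x - y is the limit of circle means taken strictly inside the disk, where the
  two functions agree.\<close>

lemma ev_eqI:
  assumes "\<And>z. cmod z < 1 \<Longrightarrow> ev x z = ev y z"
  shows "x = y"
proof -
  have "((\<lambda>r. 0) \<longlongrightarrow> 2 * pi * (norm (x - y))\<^sup>2) (at_left (1::real))"
  proof (rule Lim_transform_eventually[OF ev_circle_norm_tendsto[of "x - y"]])
    have "ev (x - y) z = 0" for z
    proof (cases "cmod z < 1")
      case True
      have "(\<lambda>n. coef x n * z ^ n - coef y n * z ^ n) sums (ev x z - ev y z)"
        by (intro sums_diff ev_sums True)
      with ev_sums[OF True, of "x - y"] assms[OF True] show ?thesis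
        by (simp add: algebra_simps sums_iff)
    qed (simp add: ev_outside)
    then show "\<forall>\<^sub>F r in at_left 1. integral {0..2*pi} (\<lambda>t. (cmod (ev (x - y) (complex_of_real r * cis t)))\<^sup>2) = 0"
      by simp
  qed
  then have "2 * pi * (norm (x - y))\<^sup>2 = 0"
    using tendsto_unique[OF _ _ tendsto_const] trivial_limit_at_left_real by blast
  then show ?thesis by simp
qed

text \<open>Parseval on each smaller circle bounds finite sums of weighted squared Taylor
  coefficients; letting r tend to 1 at fixed length removes the weights. The explicit constant C
  later yields operator norms of multipliers.\<close>

lemma holomorphic_in_hardy:
  assumes hol: "f holomorphic_on ball 0 1" and "C \<ge> 0"
    and le: "\<And>r. 0 \<le> r \<Longrightarrow> r < 1 \<Longrightarrow> integral {0..2*pi} (\<lambda>t. (cmod (f (of_real r * cis t)))\<^sup>2) \<le> 2 * pi * C\<^sup>2"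
  shows "\<exists>x. norm x \<le> C \<and> (\<forall>z. cmod z < 1 \<longrightarrow> ev x z = f z)"
proof -
  define a where "a n = (deriv ^^ n) f 0 / fact n" for n
  have sums: "(\<lambda>n. a n * z ^ n) sums f z" if "cmod z < 1" for z
    using holomorphic_power_series[OF hol, of z] that by (simp add: a_def)
  have bound: "(\<Sum>n<N. (cmod (a n))\<^sup>2 * r ^ (2 * n)) \<le> C\<^sup>2" if r: "0 \<le> r" "r < 1" for N r
  proof -
    have "summable (\<lambda>n. cmod (a n) * r ^ n)"
    proof -
      \<comment> \<open>A radius strictly between r and 1: convergence there gives absolute
        convergence at r.\<close>
      have "summable (\<lambda>n. a n * of_real ((r + 1) / 2) ^ n)"
        using sums[of "of_real ((r + 1) / 2)"] r by (auto simp: sums_iff simp del: of_real_add of_real_divide)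
      from powser_insidea[OF this, of "of_real r"] r show ?thesis
        by (simp add: norm_mult norm_power del: of_real_add of_real_divide)
    qed
    from parseval_circle(1)[OF r(1) this this, of "\<lambda>t. f (of_real r * cis t)" "\<lambda>t. f (of_real r * cis t)"]
    have "(\<lambda>n. a n * cnj (a n) * of_real (r ^ (2 * n))) sums
       (integral {0..2*pi} (\<lambda>t. f (of_real r * cis t) * cnj (f (of_real r * cis t))) / of_real (2 * pi))"
      using sums r by (simp add: norm_mult)
    moreover have "integral {0..2*pi} (\<lambda>t. f (of_real r * cis t) * cnj (f (of_real r * cis t)))
      = of_real (integral {0..2*pi} (\<lambda>t. (cmod (f (of_real r * cis t)))\<^sup>2))"
      by (rule integral_mult_cnj)
    ultimately have "(\<lambda>n. of_real ((cmod (a n))\<^sup>2 * r ^ (2 * n)) :: complex) sums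
      of_real (integral {0..2*pi} (\<lambda>t. (cmod (f (of_real r * cis t)))\<^sup>2) / (2 * pi))"
      by (simp only: of_real_mult of_real_divide complex_norm_square)
    then have s: "(\<lambda>n. (cmod (a n))\<^sup>2 * r ^ (2 * n)) sums
      (integral {0..2*pi} (\<lambda>t. (cmod (f (of_real r * cis t)))\<^sup>2) / (2 * pi))"
      by (simp only: sums_of_real_iff)
    have "(\<Sum>n<N. (cmod (a n))\<^sup>2 * r ^ (2 * n)) \<le> integral {0..2*pi} (\<lambda>t. (cmod (f (of_real r * cis t)))\<^sup>2) / (2 * pi)"
      unfolding sums_unique[OF s] using s r by (intro sum_le_suminf) (auto simp: sums_iff)
    also have "\<dots> \<le> C\<^sup>2" using le[OF r] by (simp add: field_simps)
    finally show ?thesis .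
  qed
  have bound1: "(\<Sum>n<N. (cmod (a n))\<^sup>2) \<le> C\<^sup>2" for N
  proof (rule tendsto_upperbound)
    show "((\<lambda>r. \<Sum>n<N. (cmod (a n))\<^sup>2 * r ^ (2 * n)) \<longlongrightarrow> (\<Sum>n<N. (cmod (a n))\<^sup>2)) (at_left 1)"
      by (rule tendsto_eq_intros refl | simp)+
    show "\<forall>\<^sub>F r in at_left 1. (\<Sum>n<N. (cmod (a n))\<^sup>2 * r ^ (2 * n)) \<le> C\<^sup>2"
      using eventually_at_left_real[of 0 1] by (auto elim!: eventually_mono intro: bound)
  qed simp
  have "summable (\<lambda>n. (cmod (a n))\<^sup>2)"
    using bound1 by (intro summableI_nonneg_bounded[where x = "C\<^sup>2"]) auto
  then have c: "coef (Hardy a) = a" by (simp add: Hardy_inverse)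
  have "ev (Hardy a) z = f z" if "cmod z < 1" for z
    using sums[OF that] ev_sums[OF that, of "Hardy a"] by (simp add: c sums_iff)
  moreover have "norm (Hardy a) \<le> C"
    by (rule norm_hardy_leI) (use bound1 assms(2) c in auto)
  ultimately show ?thesis by blast
qed

lemma ev_in_H2: "ev x \<in> H2"
proof -
  have "bdd_above ((\<lambda>r. integral {0..2*pi} (\<lambda>t. (cmod (ev x (of_real r * cis t)))\<^sup>2)) ` {0..<1})"
    using ev_circle_norm_le[of _ x] by (intro bdd_aboveI2[where M = "2 * pi * (norm x)\<^sup>2"]) auto
  then show ?thesis by (simp add: H2_def ev_holomorphic ev_outside)
qed

lemma H2_eq_range_ev: "H2 = range ev"
proof (intro equalityI subsetI)
  fix f assume f: "f \<in> H2"
  then obtain M where M: "\<And>r. r \<in> {0..<1} \<Longrightarrow> integral {0..2*pi} (\<lambda>t. (cmod (f (of_real r * cis t)))\<^sup>2) \<le> M"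
    unfolding H2_def bdd_above_def by blast
  \<comment> \<open>The constant only has to make 2 pi C^2 dominate M, hence C = sqrt |M| and the
    crude estimate 1 \<le> 2 pi.\<close>
  have "integral {0..2*pi} (\<lambda>t. (cmod (f (of_real r * cis t)))\<^sup>2) \<le> 2 * pi * (sqrt \<bar>M\<bar>)\<^sup>2" if "0 \<le> r" "r < 1" for r
  proof -
    have "M \<le> 1 * \<bar>M\<bar>" by simp
    also have "\<dots> \<le> (2 * pi) * \<bar>M\<bar>" using pi_ge_two by (intro mult_right_mono) auto
    finally show ?thesis using M[of r] that by simp
  qed
  then obtain x where x: "\<forall>z. cmod z < 1 \<longrightarrow> ev x z = f z"
    using holomorphic_in_hardy[of f "sqrt \<bar>M\<bar>"] f by (auto simp: H2_def)
  have "f = ev x"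
  proof
    fix z show "f z = ev x z"
      using x f by (cases "cmod z < 1") (auto simp: ev_outside H2_def)
  qed
  then show "f \<in> range ev" by simp
qed (auto simp: ev_in_H2)

subsection \<open>Multiplication operators and inner functions\<close>

lemma ev_zero [simp]: "ev 0 z = 0"
  by (simp add: ev_def)

lemma ev_add [simp]: "ev (x + y) z = ev x z + ev y z"
proof (cases "cmod z < 1")
  case True
  from sums_add[OF ev_sums[OF True, of x] ev_sums[OF True, of y]] ev_sums[OF True, of "x + y"]
  show ?thesis by (simp add: algebra_simps sums_iff)
qed (simp add: ev_outside)

lemma ev_diff [simp]: "ev (x - y) z = ev x z - ev y z"
  using ev_add[of "x - y" y z] by simp

lift_definition scC :: "complex \<Rightarrow> hardy \<Rightarrow> hardy" is "\<lambda>c a n. c * a n"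
  by (simp add: norm_mult power_mult_distrib summable_mult)

lemma coef_scC [simp]: "coef (scC c x) n = c * coef x n"
  by (simp add: scC.rep_eq)

lemma ev_scC [simp]: "ev (scC c x) z = c * ev x z"
proof (cases "cmod z < 1")
  case True
  from sums_mult[OF ev_sums[OF True, of x], of c] ev_sums[OF True, of "scC c x"]
  show ?thesis by (simp add: mult.assoc sums_iff)
qed (simp add: ev_outside)

lemma scaleR_eq_scC: "r *\<^sub>R x = scC (of_real r) x"
  by (rule hardy_eqI) simp

lemma ev_scaleR [simp]: "ev (r *\<^sub>R x) z = of_real r * ev x z"
  by (simp add: scaleR_eq_scC)

lemma scC_scC [simp]: "scC c (scC d x) = scC (c * d) x"
  by (rule hardy_eqI) simp

lemma scC_one [simp]: "scC 1 x = x"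
  by (rule hardy_eqI) simp

section \<open>The complex inner product and its relation to the real one\<close>

lemma cinner_commute: "cinner y x = cnj (cinner x y)"
  using sums_cnj[of "\<lambda>n. coef x n * cnj (coef y n)" "cinner x y"] cinner_sums[of x y] cinner_sums[of y x]
  by (simp add: sums_iff mult.commute)

lemma cinner_add_left: "cinner (x + y) z = cinner x z + cinner y z"
  using sums_add[OF cinner_sums[of x z] cinner_sums[of y z]] cinner_sums[of "x + y" z]
  by (simp add: algebra_simps sums_iff)

lemma cinner_scC_left: "cinner (scC c x) y = c * cinner x y"
  using sums_mult[OF cinner_sums[of x y], of c] cinner_sums[of "scC c x" y]
  by (simp add: mult.assoc sums_iff)

lemma cinner_zero_left [simp]: "cinner 0 x = 0"
  by (simp add: cinner_def)

lemma cinner_diff_left: "cinner (x - y) z = cinner x z - cinner y z"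
  using cinner_add_left[of "x - y" y z] by simp

lemma cinner_add_right: "cinner z (x + y) = cinner z x + cinner z y"
  by (metis cinner_commute cinner_add_left complex_cnj_add)

lemma cinner_diff_right: "cinner z (x - y) = cinner z x - cinner z y"
  by (metis cinner_commute cinner_diff_left complex_cnj_diff)

lemma cinner_scC_right: "cinner x (scC c y) = cnj c * cinner x y"
  by (metis cinner_commute cinner_scC_left complex_cnj_mult)

lemma cinner_zero_right [simp]: "cinner x 0 = 0"
  by (simp add: cinner_def)

text \<open>An i in the second slot turns the imaginary part into a real part. Continuity, isometry
  and orthogonality pass from \<open>inner\<close> to \<open>cinner\<close> through this
  formula.\<close>

lemma cinner_eq_inner: "cinner x y = Complex (inner x y) (inner x (scC \<i> y))"
  by (rule complex_eqI) (simp_all add: Re_cinner[symmetric] cinner_scC_right)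

lemma norm_scC: "norm (scC c x) = cmod c * norm x"
proof (rule power2_eq_imp_eq)
  have "complex_of_real ((norm (scC c x))\<^sup>2) = of_real ((cmod c * norm x)\<^sup>2)"
    unfolding power_mult_distrib of_real_mult complex_norm_square
    by (simp only: cinner_self[symmetric] cinner_scC_left cinner_scC_right ac_simps)
  then show "(norm (scC c x))\<^sup>2 = (cmod c * norm x)\<^sup>2" by (simp only: of_real_eq_iff)
qed auto

lemma cmod_cinner_le: "cmod (cinner x y) \<le> norm x * norm y"
proof (cases "cinner x y = 0")
  case False
  \<comment> \<open>A rotation that makes the inner product real and nonnegative, so that the real
    Cauchy-Schwarz inequality applies.\<close>
  define c where "c = cnj (cinner x y) / of_real (cmod (cinner x y))"
  have c: "cmod c = 1" using False by (simp add: c_def norm_divide)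
  have "cinner (scC c x) y = of_real (cmod (cinner x y))"
    using False complex_norm_square[of "cinner x y"]
    by (simp add: cinner_scC_left c_def field_simps power2_eq_square)
  then have "cmod (cinner x y) = inner (scC c x) y"
    by (metis Re_cinner Re_complex_of_real)
  also have "\<dots> \<le> norm (scC c x) * norm y" by (rule norm_cauchy_schwarz)
  finally show ?thesis using c by (simp add: norm_scC)
qed simp

lemma cinner_tendsto_left:
  assumes "(X \<longlongrightarrow> x) F" shows "((\<lambda>n. cinner (X n) y) \<longlongrightarrow> cinner x y) F"
  unfolding cinner_eq_inner using assms by (intro tendsto_intros)

text \<open>The Szego kernel 1 / (1 - conj(w) z), which reproduces the value at w. In particular
  \<open>kern 0\<close> is the constant function 1.\<close>

definition kern :: "complex \<Rightarrow> hardy" where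
  "kern w = Hardy (\<lambda>n. cnj w ^ n)"

lemma coef_kern: "cmod w < 1 \<Longrightarrow> coef (kern w) n = cnj w ^ n"
proof -
  assume w: "cmod w < 1"
  have "summable (\<lambda>n. ((cmod w)\<^sup>2) ^ n)"
    by (rule summable_geometric) (use w in \<open>simp add: abs_square_less_1\<close>)
  then show ?thesis by (simp add: kern_def Hardy_inverse norm_power power_mult[symmetric] mult.commute)
qed

lemma cinner_kern: "cmod w < 1 \<Longrightarrow> cinner x (kern w) = ev x w"
  using ev_sums[of w x] by (simp add: cinner_def coef_kern sums_iff)

lemma ev_kern: "cmod w < 1 \<Longrightarrow> cmod z < 1 \<Longrightarrow> ev (kern w) z = 1 / (1 - cnj w * z)"
proof -
  assume a: "cmod w < 1" "cmod z < 1"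
  have "cmod w * cmod z < 1"
    using a mult_strict_mono[of "cmod w" 1 "cmod z" 1] by simp
  then have "(\<lambda>n. (cnj w * z) ^ n) sums (1 / (1 - cnj w * z))"
    by (intro geometric_sums) (simp add: norm_mult)
  then show ?thesis
    using ev_sums[OF a(2), of "kern w"] a by (simp add: coef_kern power_mult_distrib sums_iff)
qed

lemma ev_kern_0 [simp]: "cmod z < 1 \<Longrightarrow> ev (kern 0) z = 1"
  by (simp add: ev_kern)

lemma norm_kern_0 [simp]: "norm (kern 0) = 1"
proof -
  have "of_real ((norm (kern 0))\<^sup>2) = (1 :: complex)"
    unfolding cinner_self[symmetric] by (simp add: cinner_kern)
  then have "(norm (kern 0))\<^sup>2 = 1" by (simp only: of_real_eq_1_iff)
  then show ?thesis by (simp add: power2_eq_1_iff)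
     (metis norm_ge_zero not_one_le_zero neg_0_le_iff_le)
qed

lemma ev_tendsto: "(X \<longlongrightarrow> x) F \<Longrightarrow> ((\<lambda>n. ev (X n) z) \<longlongrightarrow> ev x z) F"
proof (cases "cmod z < 1")
  case True
  then show "(X \<longlongrightarrow> x) F \<Longrightarrow> ?thesis"
    using cinner_tendsto_left[of X x F "kern z"] by (simp add: cinner_kern)
qed (simp add: ev_outside)

section \<open>Bounded holomorphic functions as multipliers\<close>

lemma Hinf_const: "(\<lambda>_. c) \<in> Hinf"
  by (auto simp: Hinf_def bounded_iff)

lemma Hinf_id: "(\<lambda>z. z) \<in> Hinf"
proof -
  have "(\<lambda>z. z) ` ball 0 1 = (ball 0 1 :: complex set)" by auto
  then show ?thesis by (auto simp: Hinf_def intro!: holomorphic_intros)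
qed

lemma Hinf_add: "f \<in> Hinf \<Longrightarrow> g \<in> Hinf \<Longrightarrow> (\<lambda>z. f z + g z) \<in> Hinf"
  by (auto simp: Hinf_def intro!: holomorphic_intros bounded_plus_comp)

lemma Hinf_diff: "f \<in> Hinf \<Longrightarrow> g \<in> Hinf \<Longrightarrow> (\<lambda>z. f z - g z) \<in> Hinf"
  by (auto simp: Hinf_def intro!: holomorphic_intros bounded_minus_comp)

lemma HinfD: "f \<in> Hinf \<Longrightarrow> f holomorphic_on ball 0 1"
  "f \<in> Hinf \<Longrightarrow> \<exists>C\<ge>0. \<forall>z. cmod z < 1 \<longrightarrow> cmod (f z) \<le> C"
  unfolding Hinf_def by (auto simp: bounded_pos intro: less_imp_le)

lemma HinfI: "f holomorphic_on ball 0 1 \<Longrightarrow> (\<And>z. cmod z < 1 \<Longrightarrow> cmod (f z) \<le> C) \<Longrightarrow> f \<in> Hinf"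
  by (fastforce simp: Hinf_def bounded_iff)

lemma Hinf_mult:
  assumes "f \<in> Hinf" "g \<in> Hinf"
  shows "(\<lambda>z. f z * g z) \<in> Hinf"
proof -
  obtain C D where C: "C \<ge> 0" "\<And>z. cmod z < 1 \<Longrightarrow> cmod (f z) \<le> C"
    and D: "D \<ge> 0" "\<And>z. cmod z < 1 \<Longrightarrow> cmod (g z) \<le> D"
    using assms[THEN HinfD(2)] by blast
  have "cmod (f z * g z) \<le> C * D" if "cmod z < 1" for z
    unfolding norm_mult using C D that by (intro mult_mono) auto
  then show ?thesis
    using assms[THEN HinfD(1)] by (intro HinfI[where C = "C * D"] holomorphic_on_mult) auto
qed

lemma Hinf_power: "f \<in> Hinf \<Longrightarrow> (\<lambda>z. f z ^ n) \<in> Hinf"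
  by (induction n) (auto intro: Hinf_mult Hinf_const)

lemma circle_continuous:
  assumes "f holomorphic_on ball 0 1" "0 \<le> r" "r < 1"
  shows "continuous_on S (\<lambda>t. f (of_real r * cis t))"
  by (rule continuous_on_compose2[OF holomorphic_on_imp_continuous_on[OF assms(1)]])
     (use assms in \<open>auto intro!: continuous_intros simp: norm_mult\<close>)

lemma mul_exists:
  assumes "f holomorphic_on ball 0 1" "C \<ge> 0" "\<And>z. cmod z < 1 \<Longrightarrow> cmod (f z) \<le> C"
  shows "\<exists>y. norm y \<le> C * norm x \<and> (\<forall>z. cmod z < 1 \<longrightarrow> ev y z = f z * ev x z)"
proof (rule holomorphic_in_hardy)
  show "(\<lambda>z. f z * ev x z) holomorphic_on ball 0 1"
    by (intro holomorphic_intros assms ev_holomorphic)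
  fix r :: real assume r: "0 \<le> r" "r < 1"
  have "integral {0..2*pi} (\<lambda>t. (cmod (f (of_real r * cis t) * ev x (of_real r * cis t)))\<^sup>2)
    \<le> integral {0..2*pi} (\<lambda>t. C\<^sup>2 * (cmod (ev x (of_real r * cis t)))\<^sup>2)"
    by (intro integral_le integrable_continuous_real continuous_intros circle_continuous r assms(1) ev_holomorphic)
      (use r in \<open>auto simp: norm_mult power_mult_distrib intro!: mult_right_mono power_mono assms\<close>)
  also have "\<dots> = C\<^sup>2 * integral {0..2*pi} (\<lambda>t. (cmod (ev x (of_real r * cis t)))\<^sup>2)" by simp
  also have "\<dots> \<le> C\<^sup>2 * (2 * pi * (norm x)\<^sup>2)"
    by (intro mult_left_mono ev_circle_norm_le r) auto
  finally show "integral {0..2*pi} (\<lambda>t. (cmod (f (of_real r * cis t) * ev x (of_real r * cis t)))\<^sup>2)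
    \<le> 2 * pi * (C * norm x)\<^sup>2" by (simp add: power_mult_distrib mult_ac)
qed (use assms in auto)

text \<open>The choice is unique by \<open>ev_eqI\<close>, and for \<open>f\<close> in
  \<open>Hinf\<close> a suitable element exists by \<open>mul_exists\<close>. Values of
  \<open>f\<close> off the disk do not influence it.\<close>

definition mul :: "(complex \<Rightarrow> complex) \<Rightarrow> hardy \<Rightarrow> hardy" where
  "mul f x = (SOME y. \<forall>z. cmod z < 1 \<longrightarrow> ev y z = f z * ev x z)"

lemma ev_mul:
  assumes "f \<in> Hinf" shows "ev (mul f x) z = f z * ev x z"
proof (cases "cmod z < 1")
  case True
  obtain C where "C \<ge> 0" "\<And>z. cmod z < 1 \<Longrightarrow> cmod (f z) \<le> C" using HinfD(2)[OF assms] by auto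
  from mul_exists[OF HinfD(1)[OF assms] this, of x]
  have "\<exists>y. \<forall>z. cmod z < 1 \<longrightarrow> ev y z = f z * ev x z" by blast
  from someI_ex[OF this] show ?thesis using True by (simp add: mul_def)
qed (simp add: ev_outside)

lemma mul_eqI:
  assumes "f \<in> Hinf" "\<And>z. cmod z < 1 \<Longrightarrow> f z * ev x z = ev y z"
  shows "mul f x = y"
  by (rule ev_eqI) (simp add: ev_mul assms)

lemma norm_mul_le:
  assumes "f \<in> Hinf" "C \<ge> 0" "\<And>z. cmod z < 1 \<Longrightarrow> cmod (f z) \<le> C"
  shows "norm (mul f x) \<le> C * norm x"
proof -
  from mul_exists[OF HinfD(1)[OF assms(1)] assms(2,3), of x]
  obtain y where y: "norm y \<le> C * norm x" "\<forall>z. cmod z < 1 \<longrightarrow> ev y z = f z * ev x z" by blast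
  with mul_eqI[OF assms(1), of x y] show ?thesis by auto
qed

lemma mul_add: "f \<in> Hinf \<Longrightarrow> mul f (x + y) = mul f x + mul f y"
  by (rule mul_eqI) (simp_all add: ev_mul algebra_simps)

lemma mul_diff: "f \<in> Hinf \<Longrightarrow> mul f (x - y) = mul f x - mul f y"
  by (rule mul_eqI) (simp_all add: ev_mul algebra_simps)

lemma mul_scC: "f \<in> Hinf \<Longrightarrow> mul f (scC c x) = scC c (mul f x)"
  by (rule mul_eqI) (simp_all add: ev_mul algebra_simps)

lemma mul_scaleR: "f \<in> Hinf \<Longrightarrow> mul f (r *\<^sub>R x) = r *\<^sub>R mul f x"
  by (simp add: scaleR_eq_scC mul_scC)

lemma mul_mul: "f \<in> Hinf \<Longrightarrow> g \<in> Hinf \<Longrightarrow> mul f (mul g x) = mul (\<lambda>z. f z * g z) x"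
  by (rule mul_eqI) (simp_all add: ev_mul Hinf_mult algebra_simps)

lemma mul_commute: "f \<in> Hinf \<Longrightarrow> g \<in> Hinf \<Longrightarrow> mul f (mul g x) = mul g (mul f x)"
  by (simp add: mul_mul mult.commute)

lemma bounded_linear_mul: "f \<in> Hinf \<Longrightarrow> bounded_linear (mul f)"
proof -
  assume f: "f \<in> Hinf"
  obtain C where "C \<ge> 0" "\<And>z. cmod z < 1 \<Longrightarrow> cmod (f z) \<le> C" using HinfD(2)[OF f] by auto
  then show ?thesis
    using f by (intro bounded_linear_intro[of _ C]) (auto simp: mul_add mul_scaleR mult.commute intro: norm_mul_le)
qed

section \<open>Density of the polynomials\<close>

definition poly_hardy :: "complex poly \<Rightarrow> hardy" where
  "poly_hardy p = Hardy (coeff p)"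

lemma coef_poly_hardy: "coef (poly_hardy p) = coeff p"
proof -
  have "summable (\<lambda>n. (cmod (coeff p n))\<^sup>2)"
    by (rule summable_finite[of "{..degree p}"]) (auto simp: coeff_eq_0)
  then show ?thesis by (simp add: poly_hardy_def Hardy_inverse)
qed

lemma ev_poly_hardy: "cmod z < 1 \<Longrightarrow> ev (poly_hardy p) z = poly p z"
proof -
  assume z: "cmod z < 1"
  have "(\<lambda>n. coeff p n * z ^ n) sums (\<Sum>n\<le>degree p. coeff p n * z ^ n)"
    by (rule sums_finite) (auto simp: coeff_eq_0)
  with ev_sums[OF z, of "poly_hardy p"] show ?thesis
    by (simp add: coef_poly_hardy poly_altdef sums_iff)
qed

lemma Hinf_poly: "poly p \<in> Hinf"
proof -
  have "compact (poly p ` cball 0 1)" by (intro compact_continuous_image continuous_intros) auto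
  then have "bounded (poly p ` ball 0 1)"
    by (meson bounded_subset compact_imp_bounded ball_subset_cball image_mono)
  then show ?thesis by (auto simp: Hinf_def intro!: holomorphic_intros)
qed

lemma poly_hardy_dense: "\<exists>p. (\<lambda>n. poly_hardy (p n)) \<longlonglongrightarrow> x"
proof
  define p where "p N = (\<Sum>n<N. monom (coef x n) n)" for N
  define s where "s N = (\<Sum>n<N. (cmod (coef x n))\<^sup>2)" for N
  have coef: "coef (poly_hardy (p N)) n = (if n < N then coef x n else 0)" for n N
    by (simp add: coef_poly_hardy p_def coeff_sum)
  have "(norm (x - poly_hardy (p N)))\<^sup>2 = (norm x)\<^sup>2 - s N" for N
  proof -
    have "(\<lambda>n. (cmod (coef x n))\<^sup>2 - (if n \<in> {..<N} then (cmod (coef x n))\<^sup>2 else 0)) sums ((norm x)\<^sup>2 - s N)"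
      unfolding s_def by (intro sums_diff norm_hardy_sums sums_If_finite_set) simp
    moreover have "(\<lambda>n. (cmod (coef x n))\<^sup>2 - (if n \<in> {..<N} then (cmod (coef x n))\<^sup>2 else 0)) =
       (\<lambda>n. (cmod (coef (x - poly_hardy (p N)) n))\<^sup>2)" by (auto simp: coef)
    ultimately show ?thesis using norm_hardy_sums[of "x - poly_hardy (p N)"] by (simp add: sums_iff)
  qed
  moreover have "(\<lambda>N. (norm x)\<^sup>2 - s N) \<longlonglongrightarrow> (norm x)\<^sup>2 - (norm x)\<^sup>2"
    using norm_hardy_sums[of x] unfolding s_def sums_def by (intro tendsto_intros)
  ultimately have "(\<lambda>N. (norm (x - poly_hardy (p N)))\<^sup>2) \<longlonglongrightarrow> 0" by simp
  then have "(\<lambda>N. sqrt ((norm (x - poly_hardy (p N)))\<^sup>2)) \<longlonglongrightarrow> sqrt 0" by (intro tendsto_intros)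
  then have "(\<lambda>N. norm (poly_hardy (p N) - x)) \<longlonglongrightarrow> 0" by (simp add: norm_minus_commute)
  then show "(\<lambda>N. poly_hardy (p N)) \<longlonglongrightarrow> x"
    by (rule LIM_zero_cancel[OF tendsto_norm_zero_cancel])
qed

text \<open>Inner functions without reference to boundary values: for a function bounded by 1,
  having H^2 norm 1 amounts to unimodular radial limits. The norm condition is what limits of circle
  means and of partial products deliver directly.\<close>

definition inner_fun :: "(complex \<Rightarrow> complex) \<Rightarrow> bool" where
  "inner_fun f \<longleftrightarrow> f \<in> Hinf \<and> (\<forall>z. cmod z < 1 \<longrightarrow> cmod (f z) \<le> 1) \<and> norm (mul f (kern 0)) = 1"

lemma inner_fun_Hinf: "inner_fun f \<Longrightarrow> f \<in> Hinf"
  by (simp add: inner_fun_def)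

text \<open>If a polynomial p is bounded by M, the loss (1 - |f|^2) |p|^2 is at most M^2 (1 -
  |f|^2), whose circle means tend to 0 because f has norm 1. Density of the polynomials gives the
  general case.\<close>

lemma norm_mul_inner:
  assumes "inner_fun f" shows "norm (mul f x) = norm x"
proof -
  have f: "f \<in> Hinf" "\<And>z. cmod z < 1 \<Longrightarrow> cmod (f z) \<le> 1" "norm (mul f (kern 0)) = 1"
    using assms by (auto simp: inner_fun_def)
  have poly: "norm (mul f (poly_hardy p)) = norm (poly_hardy p)" for p
  proof -
    obtain M where M: "M \<ge> 0" "\<And>z. cmod z < 1 \<Longrightarrow> cmod (poly p z) \<le> M"
      using HinfD(2)[OF Hinf_poly[of p]] by auto
    let ?e = "\<lambda>x r. integral {0..2*pi} (\<lambda>t. (cmod (ev x (of_real r * cis t)))\<^sup>2)"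
    let ?P = "poly_hardy p"
    have "((\<lambda>r. M\<^sup>2 * (2 * pi - ?e (mul f (kern 0)) r)) \<longlongrightarrow> M\<^sup>2 * (2 * pi - 2 * pi * (norm (mul f (kern 0)))\<^sup>2)) (at_left 1)"
      by (intro tendsto_intros ev_circle_norm_tendsto)
    then have lim0: "((\<lambda>r. M\<^sup>2 * (2 * pi - ?e (mul f (kern 0)) r)) \<longlongrightarrow> 0) (at_left 1)"
      using f(3) by simp
    have ev: "\<forall>\<^sub>F r in at_left 1. r \<in> {0<..<(1::real)}"
      by (rule eventually_at_left_real) simp
    have lim0': "((\<lambda>r. ?e ?P r - ?e (mul f ?P) r) \<longlongrightarrow> 0) (at_left 1)"
    proof (rule tendsto_sandwich[OF _ _ tendsto_const lim0])
      have *: "0 \<le> ?e ?P r - ?e (mul f ?P) r \<and> ?e ?P r - ?e (mul f ?P) r \<le> M\<^sup>2 * (2 * pi - ?e (mul f (kern 0)) r)"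
        if r: "r \<in> {0<..<1}" for r :: real
      proof -
        have int: "(\<lambda>t. (cmod (ev x (of_real r * cis t)))\<^sup>2) integrable_on {0..2*pi}" for x
          using r by (intro ev_circle_norm) auto
        have 1: "?e ?P r - ?e (mul f ?P) r = integral {0..2*pi}
           (\<lambda>t. (1 - (cmod (f (of_real r * cis t)))\<^sup>2) * (cmod (poly p (of_real r * cis t)))\<^sup>2)"
          unfolding integral_diff[OF int int, symmetric]
          by (rule integral_cong) (use r f(1) in \<open>simp add: ev_mul ev_poly_hardy norm_mult algebra_simps power_mult_distrib\<close>)
        have 2: "M\<^sup>2 * (2 * pi - ?e (mul f (kern 0)) r) = integral {0..2*pi} (\<lambda>t. M\<^sup>2 * (1 - (cmod (f (of_real r * cis t)))\<^sup>2))"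
        proof -
          have "(2 * pi - ?e (mul f (kern 0)) r) = integral {0..2*pi} (\<lambda>t. 1) - ?e (mul f (kern 0)) r" by simp
          also have "\<dots> = integral {0..2*pi} (\<lambda>t. 1 - (cmod (f (of_real r * cis t)))\<^sup>2)"
            unfolding integral_diff[OF integrable_const_ivl int, symmetric]
            by (rule integral_cong) (use r f(1) in \<open>simp add: ev_mul norm_mult\<close>)
          finally show ?thesis by simp
        qed
        have c: "continuous_on {0..2*pi} (\<lambda>t. f (of_real r * cis t))"
          using r by (intro circle_continuous HinfD f) auto
        have le1: "(cmod (f (of_real r * cis t)))\<^sup>2 \<le> 1" for t
          using r by (intro power_le_one f(2)) (auto simp: norm_mult)
        have le2: "(cmod (poly p (of_real r * cis t)))\<^sup>2 \<le> M\<^sup>2" for t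
          using r by (intro power_mono M) (auto simp: norm_mult)
        have "(1 - (cmod (f (of_real r * cis t)))\<^sup>2) * (cmod (poly p (of_real r * cis t)))\<^sup>2
           \<le> M\<^sup>2 * (1 - (cmod (f (of_real r * cis t)))\<^sup>2)" for t
          using mult_left_mono[OF le2[of t], of "1 - (cmod (f (of_real r * cis t)))\<^sup>2"] le1[of t]
          by (simp add: mult.commute)
        moreover have "0 \<le> (1 - (cmod (f (of_real r * cis t)))\<^sup>2) * (cmod (poly p (of_real r * cis t)))\<^sup>2" for t
          using le1[of t] by simp
        ultimately show ?thesis
          unfolding 1 2 using c by (intro conjI integral_nonneg integral_le integrable_continuous_real continuous_intros) auto
      qed
      show "\<forall>\<^sub>F r in at_left 1. 0 \<le> ?e ?P r - ?e (mul f ?P) r"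
        using ev by (rule eventually_mono) (use * in blast)
      show "\<forall>\<^sub>F r in at_left 1. ?e ?P r - ?e (mul f ?P) r \<le> M\<^sup>2 * (2 * pi - ?e (mul f (kern 0)) r)"
        using ev by (rule eventually_mono) (use * in blast)
    qed
    moreover have "((\<lambda>r. ?e ?P r - ?e (mul f ?P) r) \<longlongrightarrow> 2 * pi * (norm ?P)\<^sup>2 - 2 * pi * (norm (mul f ?P))\<^sup>2) (at_left 1)"
      by (intro tendsto_intros ev_circle_norm_tendsto)
    ultimately have "2 * pi * (norm ?P)\<^sup>2 - 2 * pi * (norm (mul f ?P))\<^sup>2 = 0"
      using tendsto_unique trivial_limit_at_left_real by blast
    then show ?thesis by simp
  qed
  obtain p where p: "(\<lambda>n. poly_hardy (p n)) \<longlonglongrightarrow> x" using poly_hardy_dense by blast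
  have "(\<lambda>n. norm (mul f (poly_hardy (p n)))) \<longlonglongrightarrow> norm (mul f x)"
    by (intro tendsto_norm bounded_linear.tendsto[OF bounded_linear_mul[OF f(1)]] p)
  moreover have "(\<lambda>n. norm (poly_hardy (p n))) \<longlonglongrightarrow> norm x"
    by (intro tendsto_norm p)
  ultimately show ?thesis unfolding poly using LIMSEQ_unique by blast
qed

lemma cinner_mul_inner:
  assumes "inner_fun f" shows "cinner (mul f x) (mul f y) = cinner x y"
proof -
  have "inner (mul f x) (mul f y) = inner x y" for x y
    unfolding dot_norm mul_add[OF inner_fun_Hinf[OF assms], symmetric] norm_mul_inner[OF assms] ..
  then show ?thesis
    unfolding cinner_eq_inner mul_scC[OF inner_fun_Hinf[OF assms], symmetric] by simp
qed

lemma inner_mul_inner: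
  assumes "inner_fun f" shows "inner (mul f x) (mul f y) = inner x y"
  using cinner_mul_inner[OF assms, of x y] by (metis Re_cinner)

lemma inner_fun_mult:
  assumes "inner_fun f" "inner_fun g" shows "inner_fun (\<lambda>z. f z * g z)"
proof -
  have H: "f \<in> Hinf" "g \<in> Hinf" using assms by (auto simp: inner_fun_def)
  have "norm (mul (\<lambda>z. f z * g z) (kern 0)) = norm (mul f (mul g (kern 0)))"
    by (simp add: mul_mul H)
  also have "\<dots> = 1" using norm_mul_inner[OF assms(1)] assms(2) by (simp add: inner_fun_def)
  finally show ?thesis
    using assms by (auto simp: inner_fun_def Hinf_mult norm_mult intro!: mult_le_one)
qed

lemma subspace_range_mul: "f \<in> Hinf \<Longrightarrow> subspace (range (mul f))"
  by (metis bounded_linear.linear bounded_linear_mul linear_subspace_image subspace_UNIV)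

lemma closed_range_mul: "inner_fun f \<Longrightarrow> closed (range (mul f))"
proof -
  assume f: "inner_fun f"
  have "complete (mul f ` UNIV)"
    by (rule complete_isometric_image[of 1])
       (auto simp: f norm_mul_inner bounded_linear_mul inner_fun_Hinf complete_UNIV)
  then show ?thesis by (rule complete_imp_closed)
qed

subsection \<open>Orthogonal projections\<close>

lemma orthogonal_projection_exists:
  fixes E :: "'a::{real_inner, complete_space} set"
  assumes E: "subspace E" "closed E"
  shows "\<exists>p\<in>E. \<forall>e\<in>E. inner (x - p) e = 0"
proof -
  define d where "d = infdist x E"
  have ne: "E \<noteq> {}" using E(1) subspace_0 by blast
  have d0: "d \<ge> 0" by (simp add: d_def infdist_nonneg)
  have dle: "d \<le> norm (x - e)" if "e \<in> E" for e
    using infdist_le[OF that, of x] by (simp add: d_def dist_norm)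
  have "\<exists>e\<in>E. norm (x - e) < d + 1 / real (Suc n)" for n
    using cInf_lessD[of "dist x ` E" "d + 1 / real (Suc n)"] ne
    by (auto simp: d_def infdist_def dist_norm)
  then obtain e where e: "\<And>n. e n \<in> E" "\<And>n. norm (x - e n) < d + 1 / real (Suc n)" by metis
  have lim: "(\<lambda>n. d + 1 / real (Suc n)) \<longlonglongrightarrow> d"
    using tendsto_add[OF tendsto_const LIMSEQ_inverse_real_of_nat, of d] by (simp add: inverse_eq_divide)
  \<comment> \<open>Parallelogram law: the midpoint of two members of E again lies in E, hence at
    distance at least d from x. This makes a minimising sequence Cauchy.\<close>
  have par: "(norm (e m - e n))\<^sup>2 \<le> 2 * ((norm (x - e m))\<^sup>2 - d\<^sup>2) + 2 * ((norm (x - e n))\<^sup>2 - d\<^sup>2)" for m n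
  proof -
    have "(1/2) *\<^sub>R (e m + e n) \<in> E" using E(1) e(1) by (simp add: subspace_add subspace_scale)
    from power_mono[OF dle[OF this] d0, of 2]
    have "4 * d\<^sup>2 \<le> 4 * (norm (x - (1/2) *\<^sub>R (e m + e n)))\<^sup>2" by simp
    also have "\<dots> = (norm (2 *\<^sub>R (x - (1/2) *\<^sub>R (e m + e n))))\<^sup>2"
      by (simp add: power_mult_distrib)
    also have "2 *\<^sub>R (x - (1/2) *\<^sub>R (e m + e n)) = (x - e m) + (x - e n)"
      by (simp add: algebra_simps scaleR_2)
    finally have 1: "4 * d\<^sup>2 \<le> (norm ((x - e m) + (x - e n)))\<^sup>2" .
    have 2: "e m - e n = (x - e n) - (x - e m)" by simp
    have 3: "(norm (u + v))\<^sup>2 + (norm (v - u))\<^sup>2 = 2 * (norm u)\<^sup>2 + 2 * (norm v)\<^sup>2" for u v :: 'a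
      by (simp add: power2_norm_eq_inner algebra_simps inner_commute)
    have 4: "4 * d2 \<le> P \<Longrightarrow> P + N = 2 * A + 2 * B \<Longrightarrow> N \<le> 2 * (A - d2) + 2 * (B - d2)" for P N A B d2 :: real
      by simp
    show ?thesis unfolding 2 by (rule 4[OF 1 3])
  qed
  have "Cauchy e"
  proof (rule metric_CauchyI)
    fix r :: real assume r: "r > 0"
    have "(\<lambda>n. (d + 1 / real (Suc n))\<^sup>2) \<longlonglongrightarrow> d\<^sup>2" by (intro tendsto_power lim)
    then have "\<forall>\<^sub>F n in sequentially. (d + 1 / real (Suc n))\<^sup>2 < d\<^sup>2 + r\<^sup>2 / 4"
      by (rule order_tendstoD) (use r in simp)
    then obtain M where M: "\<And>n. n \<ge> M \<Longrightarrow> (d + 1 / real (Suc n))\<^sup>2 < d\<^sup>2 + r\<^sup>2 / 4"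
      by (auto simp: eventually_sequentially)
    have *: "(norm (x - e n))\<^sup>2 - d\<^sup>2 < r\<^sup>2 / 4" if "n \<ge> M" for n
      using M[OF that] power_mono[OF less_imp_le[OF e(2)[of n]], of 2] by simp
    have "dist (e m) (e n) < r" if "m \<ge> M" "n \<ge> M" for m n
    proof -
      have "(norm (e m - e n))\<^sup>2 < r\<^sup>2"
        using par[of m n] mult_strict_left_mono[OF *[OF that(1)], of 2] mult_strict_left_mono[OF *[OF that(2)], of 2] by simp
      then show ?thesis using r by (simp add: dist_norm power2_less_imp_less)
    qed
    then show "\<exists>M. \<forall>m\<ge>M. \<forall>n\<ge>M. dist (e m) (e n) < r" by blast
  qed
  then obtain p where p: "e \<longlonglongrightarrow> p" using Cauchy_convergent convergent_def by blast
  have pE: "p \<in> E" using closed_sequentially[OF E(2) _ p] e(1) by blast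
  have "(\<lambda>n. norm (x - e n)) \<longlonglongrightarrow> norm (x - p)" by (intro tendsto_intros p)
  then have pd: "norm (x - p) \<le> d"
    by (rule LIMSEQ_le[OF _ lim]) (use e(2) less_imp_le in blast)
  have "inner (x - p) v = 0" if v: "v \<in> E" for v
  proof (cases "v = 0")
    case False
    \<comment> \<open>The step along v that would reduce the distance most; minimality of p forces
      the gain to be 0.\<close>
    define t where "t = inner (x - p) v / (norm v)\<^sup>2"
    have "p + t *\<^sub>R v \<in> E" using E(1) v pE by (simp add: subspace_add subspace_scale)
    from dle[OF this] pd have "norm (x - p) \<le> norm (x - p - t *\<^sub>R v)" by (simp add: algebra_simps)
    then have "(norm (x - p))\<^sup>2 \<le> (norm (x - p - t *\<^sub>R v))\<^sup>2" by (intro power_mono) auto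
    also have "\<dots> = (norm (x - p))\<^sup>2 - 2 * t * inner (x - p) v + t\<^sup>2 * (norm v)\<^sup>2"
      unfolding power2_norm_eq_inner by (simp add: inner_diff inner_commute algebra_simps power2_eq_square)
    also have "t\<^sup>2 * (norm v)\<^sup>2 = t * inner (x - p) v"
      using False by (simp add: t_def power2_eq_square)
    finally have "t * inner (x - p) v \<le> 0" by simp
    then have "(inner (x - p) v)\<^sup>2 / (norm v)\<^sup>2 \<le> 0" by (simp add: t_def power2_eq_square)
    then show ?thesis using False by (simp add: divide_le_0_iff)
  qed simp
  with pE show ?thesis by blast
qed

definition proj :: "'a::{real_inner, complete_space} set \<Rightarrow> 'a \<Rightarrow> 'a" where
  "proj E x = (SOME p. p \<in> E \<and> (\<forall>e\<in>E. inner (x - p) e = 0))"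

context
  fixes E :: "'a::{real_inner, complete_space} set"
  assumes E: "subspace E" "closed E"
begin

lemma proj_in: "proj E x \<in> E"
  and proj_orth: "e \<in> E \<Longrightarrow> inner (x - proj E x) e = 0"
proof -
  have "\<exists>p. p \<in> E \<and> (\<forall>e\<in>E. inner (x - p) e = 0)"
    using orthogonal_projection_exists[OF E, of x] by blast
  from someI_ex[OF this] show "proj E x \<in> E" "e \<in> E \<Longrightarrow> inner (x - proj E x) e = 0"
    by (auto simp: proj_def)
qed

lemma proj_unique:
  assumes "p \<in> E" "\<And>e. e \<in> E \<Longrightarrow> inner (x - p) e = 0"
  shows "proj E x = p"
proof -
  have m: "proj E x - p \<in> E" using E(1) assms(1) proj_in by (simp add: subspace_diff)
  have "inner (proj E x - p) (proj E x - p) = inner (x - p) (proj E x - p) - inner (x - proj E x) (proj E x - p)"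
    by (simp add: inner_diff_left)
  also have "\<dots> = 0" using assms(2)[OF m] proj_orth[OF m] by simp
  finally show ?thesis by simp
qed

lemma proj_add: "proj E (x + y) = proj E x + proj E y"
proof (rule proj_unique)
  fix e assume "e \<in> E"
  then show "inner (x + y - (proj E x + proj E y)) e = 0"
    using proj_orth[of e x] proj_orth[of e y] by (simp add: inner_diff_left inner_add_left)
qed (simp add: proj_in E subspace_add)

lemma proj_scaleR: "proj E (c *\<^sub>R x) = c *\<^sub>R proj E x"
proof (rule proj_unique)
  fix e assume "e \<in> E"
  then show "inner (c *\<^sub>R x - c *\<^sub>R proj E x) e = 0"
    using proj_orth[of e x] by (simp add: inner_diff_left)
qed (simp add: proj_in E subspace_scale)

lemma proj_diff: "proj E (x - y) = proj E x - proj E y"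
  using proj_add[of "x - y" y] by simp

lemma proj_pythagoras: "(norm x)\<^sup>2 = (norm (proj E x))\<^sup>2 + (norm (x - proj E x))\<^sup>2"
  using proj_orth[OF proj_in, of x x]
  by (simp add: power2_norm_eq_inner inner_diff algebra_simps inner_commute)

lemma norm_proj_le: "norm (proj E x) \<le> norm x"
  by (rule power2_le_imp_le) (use proj_pythagoras[of x] in auto)

lemma norm_diff_proj_le: "e \<in> E \<Longrightarrow> norm (x - proj E x) \<le> norm (x - e)"
proof (rule power2_le_imp_le)
  assume e: "e \<in> E"
  have "proj E e = e" by (rule proj_unique) (use e in auto)
  then show "(norm (x - proj E x))\<^sup>2 \<le> (norm (x - e))\<^sup>2"
    using proj_pythagoras[of "x - e"] by (simp add: proj_diff)
qed simp

end

text \<open>On F the compression P_F P_E differs from the identity by P_F (1 - P_E), which has norm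
  at most \<rho> < 1 there, so y = P_F P_E x is solvable in F. The map \<open>T\<close> is the
  fixed-point form of this equation, and e = P_E x.\<close>

lemma almost_contained_subspace_onto:
  fixes E F :: "'a::{real_inner, complete_space} set"
  assumes E: "subspace E" "closed E" and F: "subspace F" "closed F"
    and \<rho>: "0 \<le> \<rho>" "\<rho> < 1" "\<And>x. x \<in> F \<Longrightarrow> norm (x - proj E x) \<le> \<rho> * norm x"
    and y: "y \<in> F"
  shows "\<exists>e\<in>E. \<forall>f\<in>F. inner (e - y) f = 0"
proof -
  define T where "T x = y + proj F (x - proj E x)" for x
  have "\<exists>!x\<in>F. T x = x"
  proof (rule Banach_fix)
    show "complete F" using F(2) by (simp add: complete_eq_closed)
    show "T ` F \<subseteq> F" using y by (auto simp: T_def intro!: subspace_add proj_in F)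
    fix u v assume uv: "u \<in> F" "v \<in> F"
    have "T u - T v = proj F ((u - v) - proj E (u - v))"
      by (simp add: T_def proj_diff[OF F] proj_diff[OF E])
    then have "dist (T u) (T v) \<le> norm ((u - v) - proj E (u - v))"
      by (simp add: dist_norm norm_proj_le[OF F])
    also have "\<dots> \<le> \<rho> * dist u v"
      unfolding dist_norm by (intro \<rho>(3) subspace_diff F uv)
    finally show "dist (T u) (T v) \<le> \<rho> * dist u v" .
  qed (use \<rho> y in auto)
  then obtain x where "T x = x" by blast
  then have x: "y = x - proj F (x - proj E x)" unfolding T_def by (simp only: eq_diff_eq)
  have "inner (proj E x - y) f = 0" if "f \<in> F" for f
  proof -
    have *: "proj E x - y = - ((x - proj E x) - proj F (x - proj E x))"
      by (subst x) (simp add: algebra_simps)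
    then show ?thesis using proj_orth[OF F that, of "x - proj E x"] unfolding * inner_minus_left by simp
  qed
  then show ?thesis using proj_in[OF E] by blast
qed

subsection \<open>The singular inner functions\<close>

text \<open>The exponent is -a times the Poisson kernel at the boundary point 1: negative inside the
  disk for a > 0, zero on the circle away from 1.\<close>

lemma cmod_psi:
  assumes "z \<noteq> 1"
  shows "cmod (psi a z) = exp (a * ((cmod z)\<^sup>2 - 1) / (cmod (z - 1))\<^sup>2)"
proof -
  have "(z + 1) * cnj (z - 1) = of_real ((cmod z)\<^sup>2 - 1) + (cnj z - z)"
    by (simp add: complex_norm_square algebra_simps del: of_real_power)
  then have "Re ((z + 1) * cnj (z - 1)) = (cmod z)\<^sup>2 - 1" by simp
  then have "Re ((z + 1) / (z - 1)) = ((cmod z)\<^sup>2 - 1) / (cmod (z - 1))\<^sup>2"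
    by (subst complex_div_cnj) (simp only: Re_divide_of_real)
  moreover have "Re (of_real a * w) = a * Re w" for w by simp
  ultimately have "Re (of_real a * ((z + 1) / (z - 1))) = a * (((cmod z)\<^sup>2 - 1) / (cmod (z - 1))\<^sup>2)"
    by (simp only:)
  then show ?thesis unfolding psi_def norm_exp_eq_Re by simp
qed

lemma psi_mult: "psi a z * psi b z = psi (a + b) z"
  by (simp only: psi_def exp_add[symmetric] distrib_right of_real_add)

lemma cmod_psi_le_1: "a \<ge> 0 \<Longrightarrow> cmod z < 1 \<Longrightarrow> cmod (psi a z) \<le> 1"
  by (subst cmod_psi) (auto simp: mult_nonneg_nonpos divide_nonpos_nonneg abs_square_le_1)

lemma psi_Hinf: "a \<ge> 0 \<Longrightarrow> psi a \<in> Hinf"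
  by (rule HinfI[where C = 1], unfold psi_def[abs_def])
     (auto simp: cmod_psi_le_1[unfolded psi_def] simp del: norm_exp_eq_Re times_divide_eq_right intro!: holomorphic_intros)

lemma psi_radial_limit:
  assumes "cis t \<noteq> 1"
  shows "((\<lambda>r. psi a (of_real r * cis t)) \<longlongrightarrow> psi a (cis t)) (at_left (1::real))"
proof -
  have "continuous (at (1::real)) (\<lambda>r. psi a (of_real r * cis t))"
    unfolding psi_def using assms by (intro continuous_intros) auto
  then have "((\<lambda>r. psi a (of_real r * cis t)) \<longlongrightarrow> psi a (of_real 1 * cis t)) (at 1)"
    unfolding continuous_at by simp
  then show ?thesis by (simp add: filterlim_at_split)
qed

lemma cmod_psi_cis: "cis t \<noteq> 1 \<Longrightarrow> cmod (psi a (cis t)) = 1"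
  by (simp add: cmod_psi)

lemma cis_neq_1: "t \<in> {0<..<2*pi} \<Longrightarrow> cis t \<noteq> 1"
  using cos_one_2pi_int[of t]
proof -
  assume t: "t \<in> {0<..<2*pi}"
  show "cis t \<noteq> 1"
  proof
    assume "cis t = 1"
    then have "cos t = 1" by (metis cis.sel(1) one_complex.sel(1))
    then obtain n :: int where n: "t = n * 2 * pi" using cos_one_2pi_int by auto
    then have "0 < n" "n < 1" using t by (auto simp: zero_less_mult_iff)
    then show False by simp
  qed
qed

text \<open>A sequence of radii tending to 1 from below, because dominated convergence and Fatou's
  lemma are applied to sequences.\<close>

abbreviation rad :: "nat \<Rightarrow> real" where "rad n \<equiv> 1 - 1 / real (Suc n)"

lemma rad_range: "0 \<le> rad n" "rad n < 1" by (auto simp: divide_simps)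

lemma rad_at_left: "filterlim rad (at_left 1) sequentially"
  unfolding filterlim_at
proof (intro conjI)
  show "\<forall>\<^sub>F n in sequentially. rad n \<in> {..<1} \<and> rad n \<noteq> 1" by (auto simp: divide_simps)
  have "(\<lambda>n. 1 - 1 / real (Suc n)) \<longlonglongrightarrow> 1 - 0"
    using LIMSEQ_inverse_real_of_nat by (intro tendsto_intros) (simp add: inverse_eq_divide)
  then show "rad \<longlonglongrightarrow> 1" by simp
qed

text \<open>By dominated convergence the circle means of |psi_a|^2 tend to the mean of the boundary
  values, which are unimodular away from the point 1. The open interval removes the two parameters
  of that point.\<close>

lemma inner_fun_psi:
  assumes "a \<ge> 0" shows "inner_fun (psi a)"
proof -
  let ?f = "\<lambda>n t. (cmod (ev (mul (psi a) (kern 0)) (of_real (rad n) * cis t)))\<^sup>2"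
  have ev: "ev (mul (psi a) (kern 0)) (of_real (rad n) * cis t) = psi a (of_real (rad n) * cis t)" for n t
    by (subst ev_mul[OF psi_Hinf[OF assms]]) (simp add: norm_mult rad_range del: of_real_diff)
  have in1: "cmod (of_real (rad n) * cis t) < 1" for n t by (simp add: norm_mult rad_range del: of_real_diff)
  have "(\<lambda>n. integral {0<..<2*pi} (?f n)) \<longlonglongrightarrow> integral {0<..<2*pi} (\<lambda>t. 1)"
  proof (rule dominated_convergence(2))
    fix n
    show "?f n integrable_on {0<..<2*pi}"
      using ev_circle_norm(2)[OF rad_range] unfolding integrable_on_Icc_iff_Ioo .
    show "(\<lambda>t. 1 :: real) integrable_on {0<..<2*pi}"
      unfolding integrable_on_Icc_iff_Ioo[symmetric] by (rule integrable_const_ivl)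
    fix t :: real assume t: "t \<in> {0<..<2*pi}"
    show "norm (?f n t) \<le> 1"
      using cmod_psi_le_1[OF assms in1] unfolding ev by (simp add: power_le_one)
    have "(\<lambda>n. psi a (of_real (rad n) * cis t)) \<longlonglongrightarrow> psi a (cis t)"
      by (rule filterlim_compose[OF psi_radial_limit[OF cis_neq_1[OF t]] rad_at_left])
    then have "(\<lambda>n. (cmod (psi a (of_real (rad n) * cis t)))\<^sup>2) \<longlonglongrightarrow> (cmod (psi a (cis t)))\<^sup>2"
      by (intro tendsto_intros)
    then show "(\<lambda>n. ?f n t) \<longlonglongrightarrow> 1"
      unfolding ev by (simp add: cmod_psi_cis cis_neq_1[OF t])
  qed
  then have "(\<lambda>n. integral {0..2*pi} (?f n)) \<longlonglongrightarrow> 2 * pi"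
    unfolding integral_open_interval_real[symmetric] by simp
  moreover have "(\<lambda>n. integral {0..2*pi} (?f n)) \<longlonglongrightarrow> 2 * pi * (norm (mul (psi a) (kern 0)))\<^sup>2"
    by (rule filterlim_compose[OF ev_circle_norm_tendsto rad_at_left])
  ultimately have "2 * pi * (norm (mul (psi a) (kern 0)))\<^sup>2 = 2 * pi"
    using LIMSEQ_unique by blast
  then have "(norm (mul (psi a) (kern 0)))\<^sup>2 = 1\<^sup>2" by simp
  then have "norm (mul (psi a) (kern 0)) = 1" by (rule power2_eq_imp_eq) auto
  then show ?thesis using assms by (simp add: inner_fun_def psi_Hinf cmod_psi_le_1)
qed

lemma psi_0: "psi a 0 = of_real (exp (- a))"
  by (simp add: psi_def exp_of_real[symmetric])

subsection \<open>Blaschke factors\<close>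

lemma inner_fun_id: "inner_fun (\<lambda>z. z)"
proof -
  have "mul (\<lambda>z. z) (kern 0) = poly_hardy [:0, 1:]"
    by (rule mul_eqI) (simp_all add: Hinf_id ev_poly_hardy)
  moreover have "(norm (poly_hardy [:0, 1:]))\<^sup>2 = (\<Sum>n\<in>{1}. (cmod (coef (poly_hardy [:0, 1:]) n))\<^sup>2)"
    by (intro sums_unique2[OF norm_hardy_sums] sums_finite)
      (auto simp: coef_poly_hardy coeff_pCons split: nat.splits)
  ultimately have "(norm (mul (\<lambda>z. z) (kern 0)))\<^sup>2 = 1\<^sup>2" by (simp add: coef_poly_hardy)
  then have "norm (mul (\<lambda>z. z) (kern 0)) = 1" by (rule power2_eq_imp_eq) auto
  then show ?thesis by (simp add: inner_fun_def Hinf_id)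
qed

lemma one_minus_cnj_mult_nonzero:
  assumes "cmod w < 1" "cmod z < 1" shows "1 - cnj w * z \<noteq> 0"
proof
  assume "1 - cnj w * z = 0"
  then have "cmod w * cmod z = 1" by (metis complex_mod_cnj norm_mult norm_one right_minus_eq)
  moreover have "cmod w * cmod z < 1" using assms mult_strict_mono[of "cmod w" 1 "cmod z" 1] by simp
  ultimately show False by simp
qed

lemma blaschke_factor_holomorphic:
  assumes "cmod w < 1" shows "blaschke_factor w holomorphic_on ball 0 1"
proof (cases "w = 0")
  case False
  have "(\<lambda>z. (of_real (cmod w) / w) * ((w - z) / (1 - cnj w * z))) holomorphic_on ball 0 1"
    using one_minus_cnj_mult_nonzero[OF assms] False by (auto intro!: holomorphic_intros)
  then show ?thesis using False by (simp add: blaschke_factor_def[abs_def])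
qed (simp add: blaschke_factor_def[abs_def])

lemma cmod_blaschke_factor_le:
  assumes "cmod w < 1" "cmod z < 1" shows "cmod (blaschke_factor w z) \<le> 1"
proof (cases "w = 0")
  case False
  have "(cmod (w - z))\<^sup>2 \<le> (cmod (1 - cnj w * z))\<^sup>2"
  proof -
    have "of_real ((cmod (1 - cnj w * z))\<^sup>2 - (cmod (w - z))\<^sup>2) = complex_of_real ((1 - (cmod w)\<^sup>2) * (1 - (cmod z)\<^sup>2))"
      unfolding of_real_diff of_real_mult of_real_1 complex_norm_square by (simp add: algebra_simps)
    then have "(cmod (1 - cnj w * z))\<^sup>2 - (cmod (w - z))\<^sup>2 = (1 - (cmod w)\<^sup>2) * (1 - (cmod z)\<^sup>2)"
      by (simp only: of_real_eq_iff)
    also have "\<dots> \<ge> 0" using assms by (intro mult_nonneg_nonneg) (auto simp: abs_square_le_1)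
    finally show ?thesis by simp
  qed
  then have "cmod (w - z) \<le> cmod (1 - cnj w * z)" by (rule power2_le_imp_le) simp
  then show ?thesis
    using False one_minus_cnj_mult_nonzero[OF assms]
    by (simp add: blaschke_factor_def norm_mult norm_divide divide_le_eq)
qed (use assms in \<open>simp add: blaschke_factor_def\<close>)

lemma blaschke_factor_Hinf: "cmod w < 1 \<Longrightarrow> blaschke_factor w \<in> Hinf"
  by (rule HinfI[where C = 1]) (auto simp: blaschke_factor_holomorphic cmod_blaschke_factor_le)

lemma blaschke_factor_eq_0_iff:
  "cmod w < 1 \<Longrightarrow> cmod z < 1 \<Longrightarrow> blaschke_factor w z = 0 \<longleftrightarrow> z = w"
  using one_minus_cnj_mult_nonzero[of w z] by (auto simp: blaschke_factor_def)

lemma blaschke_factor_0: "blaschke_factor w 0 = of_real (cmod w)"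
  by (simp add: blaschke_factor_def)

text \<open>Applied to the constant 1, the factor gives c (w k - S k), with k the kernel at w and S
  multiplication by z. The reproducing property and the isometry of S evaluate all four inner
  products, and the norm comes out as 1.\<close>

lemma inner_fun_blaschke_factor:
  assumes w: "cmod w < 1" shows "inner_fun (blaschke_factor w)"
proof (cases "w = 0")
  case True
  then have "blaschke_factor w = (\<lambda>z. z)" by (simp add: blaschke_factor_def[abs_def])
  then show ?thesis using inner_fun_id by simp
next
  case False
  define c where "c = of_real (cmod w) / w"
  have c: "cmod c = 1" using False by (simp add: c_def norm_divide)
  define S where "S = mul (\<lambda>z. z)"
  define k where "k = kern w"
  have lt: "(cmod w)\<^sup>2 < 1" using w by (simp add: abs_square_less_1)
  define q where "q = 1 - w * cnj w"
  have q: "q \<noteq> 0" using one_minus_cnj_mult_nonzero[OF w w] by (simp add: q_def mult.commute)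
  have kk: "cinner k k = 1 / q" by (simp add: k_def cinner_kern ev_kern w q_def mult.commute)
  have SS: "cinner (S k) (S k) = 1 / q"
    unfolding S_def cinner_mul_inner[OF inner_fun_id] kk ..
  have Sk: "cinner (S k) k = w / q"
    unfolding S_def k_def by (simp add: cinner_kern w ev_mul Hinf_id ev_kern q_def mult.commute)
  have kS: "cinner k (S k) = cnj w / q"
    by (subst cinner_commute) (simp add: Sk q_def mult.commute)
  have "cinner (scC w k - S k) (scC w k - S k) = w * cnj w / q - w * cnj w / q - cnj w * w / q + 1 / q"
    by (simp add: cinner_diff_left cinner_diff_right cinner_scC_left cinner_scC_right kk SS Sk kS)
  also have "\<dots> = 1" using q by (simp add: q_def field_simps)
  finally have "(norm (scC w k - S k))\<^sup>2 = 1\<^sup>2"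
    unfolding cinner_self by (simp only: of_real_eq_1_iff power_one)
  then have n: "norm (scC w k - S k) = 1" by (rule power2_eq_imp_eq) auto
  have "mul (blaschke_factor w) (kern 0) = scC c (scC w k - S k)"
    by (rule mul_eqI[OF blaschke_factor_Hinf[OF w]])
      (use one_minus_cnj_mult_nonzero[OF w] False w in
        \<open>simp add: blaschke_factor_def c_def S_def k_def ev_mul Hinf_id ev_kern diff_divide_distrib\<close>)
  then have "norm (mul (blaschke_factor w) (kern 0)) = 1" by (simp add: norm_scC c n)
  then show ?thesis using w by (simp add: inner_fun_def blaschke_factor_Hinf cmod_blaschke_factor_le)
qed

text \<open>The factor 1 - |w| lets the Blaschke condition control the infinite product; the other
  factor depends on |z| alone.\<close>

lemma one_minus_blaschke_factor_le:
  assumes w: "cmod w < 1" and z: "cmod z < 1"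
  shows "cmod (blaschke_factor w z - 1) \<le> (1 - cmod w) * ((1 + cmod z) / (1 - cmod z))"
proof (cases "w = 0")
  case True
  have "cmod (z - 1) \<le> cmod z + 1" using norm_triangle_ineq4[of z 1] by simp
  also have "\<dots> \<le> (cmod z + 1) * (1 / (1 - cmod z))"
    using z by (simp add: divide_simps mult_left_le)
  finally show ?thesis using True by (simp add: blaschke_factor_def add.commute)
next
  case False
  have nz: "1 - cnj w * z \<noteq> 0" by (rule one_minus_cnj_mult_nonzero[OF w z])
  have "blaschke_factor w z * (w * (1 - cnj w * z)) = of_real (cmod w) * (w - z)"
    using False nz by (simp add: blaschke_factor_def)
  then have "(blaschke_factor w z - 1) * (w * (1 - cnj w * z)) = of_real (cmod w) * (w - z) - w * (1 - cnj w * z)"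
    by (simp only: left_diff_distrib mult_1_left)
  also have "\<dots> = - (1 - of_real (cmod w)) * (w + of_real (cmod w) * z)"
  proof -
    have "w * (cnj w * z) = of_real (cmod w) * of_real (cmod w) * z"
      using complex_norm_square[of w] by (simp only: power2_eq_square of_real_mult mult.assoc)
    then show ?thesis by (simp add: algebra_simps)
  qed
  finally have "cmod (blaschke_factor w z - 1) * (cmod w * cmod (1 - cnj w * z)) =
      cmod (- (1 - of_real (cmod w)) * (w + of_real (cmod w) * z))"
    by (simp only: norm_mult[symmetric])
  also have "\<dots> = (1 - cmod w) * cmod (w + of_real (cmod w) * z)"
  proof -
    have *: "1 - of_real (cmod w) = complex_of_real (1 - cmod w)" by simp
    have "cmod (- (1 - of_real (cmod w))) = 1 - cmod w"
      unfolding * norm_minus_cancel norm_of_real using w by simp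
    then show ?thesis by (simp only: norm_mult)
  qed
  also have "\<dots> \<le> (1 - cmod w) * (cmod w * (1 + cmod z))"
    using w norm_triangle_ineq[of w "of_real (cmod w) * z"]
    by (intro mult_left_mono) (auto simp: norm_mult distrib_left)
  finally have 1: "cmod (blaschke_factor w z - 1) * cmod (1 - cnj w * z) \<le> (1 - cmod w) * (1 + cmod z)"
    using False by (simp add: mult_ac)
  have "1 - cmod z \<le> 1 - cmod (cnj w * z)"
    using w z by (simp add: norm_mult mult_left_le_one_le)
  also have "\<dots> \<le> cmod (1 - cnj w * z)" using norm_triangle_ineq2[of 1 "cnj w * z"] by simp
  finally have "cmod (blaschke_factor w z - 1) * (1 - cmod z) \<le> cmod (blaschke_factor w z - 1) * cmod (1 - cnj w * z)"
    by (intro mult_left_mono) auto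
  with 1 show ?thesis using z by (simp add: field_simps)
qed

text \<open>\<open>proj\<close> yields orthogonality for the real inner product only. The range of a
  multiplier is stable under multiplication by i, and this makes the orthogonality complex.\<close>

lemma cinner_eq_0_of_orth_range:
  assumes "f \<in> Hinf" "\<And>e. e \<in> range (mul f) \<Longrightarrow> inner x e = 0"
  shows "cinner x (mul f y) = 0"
  unfolding cinner_eq_inner mul_scC[OF assms(1), symmetric] using assms(2) by (simp add: complex_eq_iff)

lemma cinner_monom: "cinner x (poly_hardy (monom 1 n)) = coef x n"
proof -
  have "(\<lambda>m. coef x m * cnj (coef (poly_hardy (monom 1 n)) m)) sums (\<Sum>m\<in>{n}. coef x m * cnj (coef (poly_hardy (monom 1 n)) m))"
    by (rule sums_finite) (auto simp: coef_poly_hardy)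
  then show ?thesis using cinner_sums[of x "poly_hardy (monom 1 n)"] by (simp add: sums_iff coef_poly_hardy)
qed

text \<open>Let r be the part of x orthogonal to b_w H^2. Every z^n - w^n is divisible by b_w, so r
  is orthogonal to it, and this determines all coefficients of r: it is a multiple of the kernel at
  w. As r(w) = 0, that multiple is 0.\<close>

lemma blaschke_factor_divides:
  assumes w: "cmod w < 1" and x: "ev x w = 0"
  shows "x \<in> range (mul (blaschke_factor w))"
proof -
  note inn = inner_fun_blaschke_factor[OF w] and H = blaschke_factor_Hinf[OF w]
  let ?E = "range (mul (blaschke_factor w))"
  have E: "subspace ?E" "closed ?E" using inn H by (auto intro: subspace_range_mul closed_range_mul)
  define r where "r = x - proj ?E x"
  have orth: "cinner r (mul (blaschke_factor w) y) = 0" for y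
    by (rule cinner_eq_0_of_orth_range[OF H]) (simp add: r_def proj_orth[OF E])
  have "ev (proj ?E x) w = 0"
    using proj_in[OF E, of x] w by (auto simp: ev_mul H blaschke_factor_eq_0_iff)
  then have r0: "ev r w = 0" using x by (simp add: r_def)
  have coef: "coef r n = cnj w ^ n * coef r 0" for n
  proof -
    \<comment> \<open>Undoes the unimodular constant in \<open>blaschke_factor\<close>, so that
      b_w(z) times c (1 - conj(w) z) equals z - w.\<close>
    define c where "c = (if w = 0 then 1 else - (w / of_real (cmod w)))"
    have "poly (monom 1 n - [:w ^ n:]) w = 0" by (simp add: poly_monom)
    then obtain q where q: "monom 1 n - [:w ^ n:] = [:- w, 1:] * q"
      unfolding poly_eq_0_iff_dvd by (auto elim: dvdE)
    have "poly_hardy (monom 1 n - [:w ^ n:]) = mul (blaschke_factor w) (poly_hardy ([:c, - c * cnj w:] * q))"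
    proof (rule ev_eqI)
      fix z assume z: "cmod z < 1"
      have "blaschke_factor w z * (c * (1 - cnj w * z)) = z - w"
        using one_minus_cnj_mult_nonzero[OF w z] by (auto simp: blaschke_factor_def c_def)
      then have "(z - w) * poly q z = blaschke_factor w z * (c * (1 - cnj w * z) * poly q z)"
        by (simp only: mult.assoc[symmetric])
      then show "ev (poly_hardy (monom 1 n - [:w ^ n:])) z = ev (mul (blaschke_factor w) (poly_hardy ([:c, - c * cnj w:] * q))) z"
        unfolding q ev_mul[OF H] ev_poly_hardy[OF z] by (simp add: algebra_simps)
    qed
    then have "cinner r (poly_hardy (monom 1 n - [:w ^ n:])) = 0" using orth by simp
    moreover have "poly_hardy (monom 1 n - [:w ^ n:]) = poly_hardy (monom 1 n) - scC (w ^ n) (kern 0)"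
      by (rule ev_eqI) (simp add: ev_poly_hardy)
    ultimately have "coef r n - cnj (w ^ n) * ev r 0 = 0"
      by (simp add: cinner_diff_right cinner_monom cinner_scC_right cinner_kern)
    moreover have "ev r 0 = coef r 0"
      using cinner_monom[of r 0] cinner_kern[of 0 r] by (simp add: cinner_def coef_poly_hardy coef_kern coeff_monom)
    ultimately show ?thesis by simp
  qed
  have "r = scC (coef r 0) (kern w)"
    by (rule hardy_eqI) (subst coef, simp add: coef_kern[OF w])
  from arg_cong[OF this, of "\<lambda>x. ev x w"] have "ev r w = coef r 0 * (1 / (1 - cnj w * w))"
    by (simp add: ev_kern[OF w w])
  with r0 have "coef r 0 = 0" using one_minus_cnj_mult_nonzero[OF w w] by simp
  then have "r = 0" by (intro hardy_eqI) (subst coef, simp)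
  then show ?thesis using proj_in[OF E, of x] by (simp add: r_def)
qed

subsection \<open>Blaschke products\<close>

text \<open>The Weierstrass product inequality. It turns tails of the Blaschke sum into distances
  between partial products.\<close>

lemma prod_one_minus_ge:
  fixes d :: "nat \<Rightarrow> real"
  assumes "\<And>k. 0 \<le> d k" "\<And>k. d k \<le> 1"
  shows "1 - sum d A \<le> (\<Prod>k\<in>A. 1 - d k)"
proof (induction A rule: infinite_finite_induct)
  case (insert k A)
  have "(\<Prod>k\<in>A. 1 - d k) \<le> 1" using assms by (intro prod_le_1) auto
  then have "d k * (\<Prod>k\<in>A. 1 - d k) \<le> d k" using assms by (simp add: mult_left_le)
  then show ?case using insert by (simp add: algebra_simps)
qed auto

definition bfac :: "(nat \<Rightarrow> complex) \<Rightarrow> nat set \<Rightarrow> nat \<Rightarrow> complex \<Rightarrow> complex" where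
  "bfac w K k z = (if k \<in> K then blaschke_factor (w k) z else 1)"

definition bprod :: "(nat \<Rightarrow> complex) \<Rightarrow> nat set \<Rightarrow> complex \<Rightarrow> complex" where
  "bprod w K z = (\<Prod>k. bfac w K k z)"

lemma inner_fun_one: "inner_fun (\<lambda>_. 1)"
proof -
  have "mul (\<lambda>_. 1) (kern 0) = kern 0" by (rule mul_eqI) (simp_all add: Hinf_const)
  then show ?thesis by (simp add: inner_fun_def Hinf_const)
qed

context
  fixes w :: "nat \<Rightarrow> complex" and K :: "nat set"
  assumes w: "\<forall>k\<in>K. w k \<in> unit_disk" and summ: "(\<lambda>k. 1 - cmod (w k)) summable_on K"
begin

lemma inner_fun_bfac: "inner_fun (bfac w K k)"
proof (cases "k \<in> K")
  case True
  then show ?thesis using w inner_fun_blaschke_factor[of "w k"] by (simp add: bfac_def[abs_def])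
qed (simp add: bfac_def[abs_def] inner_fun_one)

lemma inner_fun_prod_bfac: "inner_fun (\<lambda>z. \<Prod>k\<in>A. bfac w K k z)"
  by (induction A rule: infinite_finite_induct) (auto simp: inner_fun_one intro: inner_fun_mult inner_fun_bfac)

abbreviation (input) defect :: "nat \<Rightarrow> real" where
  "defect \<equiv> \<lambda>k. if k \<in> K then 1 - cmod (w k) else 0"

lemma defect_range: "0 \<le> defect k" "defect k \<le> 1"
  using w by auto

lemma summable_defect: "summable defect"
proof -
  have "defect summable_on UNIV \<longleftrightarrow> (\<lambda>k. 1 - cmod (w k)) summable_on K"
    by (rule summable_on_cong_neutral) auto
  then show ?thesis using summ summable_on_imp_summable by blast
qed

lemma bfac_0: "bfac w K k 0 = of_real (1 - defect k)"
  by (simp add: bfac_def blaschke_factor_0)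

lemma convergent_prod_bfac:
  assumes z: "cmod z < 1" shows "convergent_prod (\<lambda>k. bfac w K k z)"
proof -
  have "summable (\<lambda>k. cmod (bfac w K k z - 1))"
  proof (rule summable_comparison_test')
    show "summable (\<lambda>k. defect k * ((1 + cmod z) / (1 - cmod z)))"
      by (intro summable_mult2 summable_defect)
    show "norm (cmod (bfac w K k z - 1)) \<le> defect k * ((1 + cmod z) / (1 - cmod z))" for k
      using one_minus_blaschke_factor_le[of "w k" z] w z by (auto simp: bfac_def)
  qed
  then have "abs_convergent_prod (\<lambda>k. bfac w K k z)" by (simp add: abs_convergent_prod_conv_summable)
  then show ?thesis by (rule abs_convergent_prod_imp_convergent_prod)
qed

lemma bprod_tendsto:
  "cmod z < 1 \<Longrightarrow> (\<lambda>n. \<Prod>k<n. bfac w K k z) \<longlonglongrightarrow> bprod w K z"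
  using convergent_prod_LIMSEQ[OF convergent_prod_bfac[of z]]
  unfolding bprod_def lessThan_Suc_atMost[symmetric] by (rule LIMSEQ_imp_Suc)

lemma bprod_eq_0_iff:
  assumes z: "cmod z < 1" shows "bprod w K z = 0 \<longleftrightarrow> z \<in> w ` K"
proof -
  have "bfac w K k z = 0 \<longleftrightarrow> k \<in> K \<and> z = w k" for k
    using blaschke_factor_eq_0_iff[of "w k" z] w z by (auto simp: bfac_def)
  then have iff: "z \<in> w ` K \<longleftrightarrow> (\<exists>k. bfac w K k z = 0)" by auto
  show ?thesis
  proof
    assume "bprod w K z = 0"
    then show "z \<in> w ` K" using prodinf_nonzero[OF convergent_prod_bfac[OF z]] iff by (auto simp: bprod_def)
  next
    assume "z \<in> w ` K"
    then obtain k where k: "bfac w K k z = 0" using iff by blast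
    have "(\<lambda>n. \<Prod>k<n. bfac w K k z) \<longlonglongrightarrow> 0"
    proof (rule tendsto_eventually, rule eventually_sequentiallyI)
      fix n assume "Suc k \<le> n"
      then show "(\<Prod>k<n. bfac w K k z) = 0" using k by (intro prod_zero) auto
    qed
    then show "bprod w K z = 0" using LIMSEQ_unique bprod_tendsto[OF z] by blast
  qed
qed

text \<open>For m \<le> n the isometry of the first m factors reduces <P_n, P_m> to the value at 0
  of the remaining block, a product of numbers 1 - \<open>defect k\<close>. Hence the partial
  products, all of norm 1, are Cauchy in norm. Norm convergence, and not just pointwise convergence,
  is what \<open>bprod_divides\<close> uses.\<close>

lemma inner_fun_bprod: "inner_fun (bprod w K)"
  and partial_bprod_tendsto: "(\<lambda>n. mul (\<lambda>z. \<Prod>k<n. bfac w K k z) (kern 0)) \<longlonglongrightarrow> mul (bprod w K) (kern 0)"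
proof -
  define P where "P n = mul (\<lambda>z. \<Prod>k<n. bfac w K k z) (kern 0)" for n
  note H = inner_fun_prod_bfac[THEN inner_fun_Hinf]
  have nP: "norm (P n) = 1" for n by (simp add: P_def norm_mul_inner inner_fun_prod_bfac)
  have dist: "(norm (P n - P m))\<^sup>2 \<le> 2 * sum defect {m..<n}" if "m \<le> n" for m n
  proof -
    have split: "(\<Prod>k<n. bfac w K k z) = (\<Prod>k<m. bfac w K k z) * (\<Prod>k=m..<n. bfac w K k z)" for z
      using that by (simp add: prod.atLeastLessThan_concat[of 0 m n, symmetric] atLeast0LessThan[symmetric])
    have "cinner (P n) (P m) = cinner (mul (\<lambda>z. \<Prod>k=m..<n. bfac w K k z) (kern 0)) (kern 0)"
      unfolding P_def split mul_mul[OF H H, symmetric] cinner_mul_inner[OF inner_fun_prod_bfac] ..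
    also have "\<dots> = (\<Prod>k=m..<n. bfac w K k 0)" by (simp add: cinner_kern ev_mul H)
    also have "\<dots> = of_real (\<Prod>k=m..<n. 1 - defect k)" by (simp only: bfac_0 of_real_prod)
    finally have "inner (P n) (P m) = (\<Prod>k=m..<n. 1 - defect k)"
      by (metis Re_cinner Re_complex_of_real)
    moreover have "1 - sum defect {m..<n} \<le> (\<Prod>k=m..<n. 1 - defect k)"
      by (rule prod_one_minus_ge) (fact defect_range)+
    moreover have "(norm (P n - P m))\<^sup>2 = 2 - 2 * inner (P n) (P m)"
      using dot_norm_neg[of "P n" "P m"] by (simp add: nP)
    ultimately show ?thesis by linarith
  qed
  have "Cauchy P"
  proof (rule metric_CauchyI)
    fix e :: real assume e: "e > 0"
    then have "e\<^sup>2 / 2 > 0" by simp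
    from summable_Cauchy[THEN iffD1, OF summable_defect, rule_format, OF this]
    obtain N where N: "\<And>m n. m \<ge> N \<Longrightarrow> \<bar>sum defect {m..<n}\<bar> < e\<^sup>2 / 2" by (auto simp: real_norm_def)
    have *: "dist (P m) (P n) < e" if "m \<ge> N" "m \<le> n" for m n
    proof -
      have "(norm (P n - P m))\<^sup>2 < e\<^sup>2" using dist[OF that(2)] N[OF that(1), of n] by linarith
      then show ?thesis using e by (simp add: dist_norm norm_minus_commute power2_less_imp_less)
    qed
    show "\<exists>M. \<forall>m\<ge>M. \<forall>n\<ge>M. dist (P m) (P n) < e"
      by (intro exI[of _ N] allI impI) (metis * dist_commute nle_le)
  qed
  then obtain L where L: "P \<longlonglongrightarrow> L" using Cauchy_convergent convergent_def by blast
  have evL: "ev L z = bprod w K z" if z: "cmod z < 1" for z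
  proof (rule LIMSEQ_unique)
    show "(\<lambda>n. ev (P n) z) \<longlonglongrightarrow> ev L z" by (rule ev_tendsto[OF L])
    show "(\<lambda>n. ev (P n) z) \<longlonglongrightarrow> bprod w K z"
      using bprod_tendsto[OF z] z by (simp add: P_def ev_mul H)
  qed
  have le: "cmod (bprod w K z) \<le> 1" if z: "cmod z < 1" for z
  proof (rule tendsto_upperbound[OF tendsto_norm[OF bprod_tendsto[OF z]]])
    show "\<forall>\<^sub>F n in sequentially. cmod (\<Prod>k<n. bfac w K k z) \<le> 1"
      using inner_fun_prod_bfac z by (auto simp: inner_fun_def)
  qed simp
  have "bprod w K holomorphic_on ball 0 1"
    by (rule holomorphic_transform[OF ev_holomorphic[of L]]) (simp add: evL)
  then have Hb: "bprod w K \<in> Hinf" by (rule HinfI[where C = 1]) (rule le)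
  have Lb: "mul (bprod w K) (kern 0) = L" by (rule mul_eqI[OF Hb]) (simp add: evL)
  have "norm L = 1"
    using tendsto_norm[OF L] by (simp add: nP LIMSEQ_const_iff)
  then show "inner_fun (bprod w K)" by (simp add: inner_fun_def Hb le Lb)
  show "(\<lambda>n. mul (\<lambda>z. \<Prod>k<n. bfac w K k z) (kern 0)) \<longlonglongrightarrow> mul (bprod w K) (kern 0)"
    using L unfolding P_def Lb .
qed

text \<open>The points are distinct, so the earlier factors do not vanish at \<open>w n\<close>; the
  zero of x there is inherited by the quotient, from which the next factor can be split off.\<close>

lemma partial_bprod_divides:
  assumes inj: "inj_on w K" and x: "\<And>k. k \<in> K \<Longrightarrow> ev x (w k) = 0"
  shows "\<exists>y. x = mul (\<lambda>z. \<Prod>k<n. bfac w K k z) y"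
proof (induction n)
  case 0
  have "mul (\<lambda>z. 1) x = x" by (rule mul_eqI) (simp_all add: Hinf_const)
  then have "x = mul (\<lambda>z. \<Prod>k<(0::nat). bfac w K k z) x" by simp
  then show ?case by blast
next
  case (Suc n)
  note H = inner_fun_prod_bfac[THEN inner_fun_Hinf]
  from Suc obtain y where y: "x = mul (\<lambda>z. \<Prod>k<n. bfac w K k z) y" by blast
  have "\<exists>y'. y = mul (bfac w K n) y'"
  proof (cases "n \<in> K")
    case True
    have wn: "cmod (w n) < 1" using True w by simp
    have "bfac w K k (w n) \<noteq> 0" if "k < n" for k
    proof (cases "k \<in> K")
      case k: True
      then have "w n \<noteq> w k" using inj True that by (auto dest: inj_onD)
      then show ?thesis using k w wn by (simp add: bfac_def blaschke_factor_eq_0_iff)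
    qed (simp add: bfac_def)
    then have "(\<Prod>k<n. bfac w K k (w n)) \<noteq> 0" by simp
    moreover have "(\<Prod>k<n. bfac w K k (w n)) * ev y (w n) = 0"
      using x[OF True] unfolding y by (simp add: ev_mul H)
    ultimately have "ev y (w n) = 0" by simp
    from blaschke_factor_divides[OF wn this] True show ?thesis by (auto simp: bfac_def[abs_def])
  next
    case False
    have "mul (\<lambda>z. 1) y = y" by (rule mul_eqI) (simp_all add: Hinf_const)
    moreover have "bfac w K n = (\<lambda>z. 1)" using False by (simp add: bfac_def[abs_def])
    ultimately have "y = mul (bfac w K n) y" by simp
    then show ?thesis by blast
  qed
  then obtain y' where "y = mul (bfac w K n) y'" by blast
  then have "x = mul (\<lambda>z. \<Prod>k<Suc n. bfac w K k z) y'"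
    unfolding y using mul_mul[OF H inner_fun_bfac[THEN inner_fun_Hinf], of "{..<n}" n y'] by simp
  then show ?case by blast
qed

text \<open>Let r be the part of x orthogonal to b H^2, with b the full product. It still vanishes
  at all points, so r = P_n g for each partial product P_n, and g(z) = <r, P_n k_z> = <r, (P_n - b)
  k_z> tends to 0. Since |r(z)| \<le> |g(z)|, r vanishes.\<close>

lemma bprod_divides:
  assumes inj: "inj_on w K" and x: "\<And>k. k \<in> K \<Longrightarrow> ev x (w k) = 0"
  shows "x \<in> range (mul (bprod w K))"
proof -
  note H = inner_fun_prod_bfac[THEN inner_fun_Hinf]
  note inn = inner_fun_bprod
  note Hb = inner_fun_Hinf[OF inn]
  let ?E = "range (mul (bprod w K))"
  have E: "subspace ?E" "closed ?E" using inn Hb by (auto intro: subspace_range_mul closed_range_mul)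
  define r where "r = x - proj ?E x"
  have orth: "cinner r (mul (bprod w K) y) = 0" for y
    by (rule cinner_eq_0_of_orth_range[OF Hb]) (simp add: r_def proj_orth[OF E])
  have r0: "ev r (w k) = 0" if "k \<in> K" for k
  proof -
    have "ev (proj ?E x) (w k) = 0"
      using proj_in[OF E, of x] w that by (auto simp: ev_mul Hb bprod_eq_0_iff)
    then show ?thesis using x[OF that] by (simp add: r_def)
  qed
  have "ev r z = 0" if z: "cmod z < 1" for z
  proof -
    define P where "P n = mul (\<lambda>z. \<Prod>k<n. bfac w K k z) (kern 0)" for n
    define L where "L = mul (bprod w K) (kern 0)"
    have PL: "P \<longlonglongrightarrow> L" unfolding P_def L_def by (rule partial_bprod_tendsto)
    \<comment> \<open>The kernel at z as a bounded multiplier: norm convergence of P_n then passes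
      to P_n times the kernel.\<close>
    define k where "k = (\<lambda>\<zeta>. 1 / (1 - cnj z * \<zeta>))"
    have k: "k \<in> Hinf"
    proof (rule HinfI)
      show "k holomorphic_on ball 0 1" unfolding k_def
        using one_minus_cnj_mult_nonzero[OF z] by (auto intro!: holomorphic_intros)
      fix \<zeta> :: complex assume \<zeta>: "cmod \<zeta> < 1"
      have "1 - cmod z \<le> 1 - cmod (cnj z * \<zeta>)" using z \<zeta> by (simp add: norm_mult mult_left_le)
      also have "\<dots> \<le> cmod (1 - cnj z * \<zeta>)" using norm_triangle_ineq2[of 1 "cnj z * \<zeta>"] by simp
      finally show "cmod (k \<zeta>) \<le> 1 / (1 - cmod z)" using z by (auto simp: k_def norm_divide intro!: frac_le)
    qed
    have kk: "kern z = mul k (kern 0)"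
      by (rule mul_eqI[OF k, symmetric]) (simp add: k_def ev_kern z)
    have bound: "cmod (ev r z) \<le> norm r * norm (mul k (P n - L))" for n
    proof -
      obtain g where g: "r = mul (\<lambda>z. \<Prod>k<n. bfac w K k z) g"
        using partial_bprod_divides[OF inj r0] by blast
      have "ev g z = cinner r (mul (\<lambda>z. \<Prod>k<n. bfac w K k z) (kern z))"
        unfolding g cinner_mul_inner[OF inner_fun_prod_bfac] by (simp add: cinner_kern z)
      also have "\<dots> = cinner r (mul (\<lambda>z. \<Prod>k<n. bfac w K k z) (kern z) - mul (bprod w K) (kern z))"
        by (simp add: cinner_diff_right orth)
      also have "mul (\<lambda>z. \<Prod>k<n. bfac w K k z) (kern z) - mul (bprod w K) (kern z) = mul k (P n - L)"
        unfolding kk P_def L_def mul_diff[OF k] by (simp only: mul_commute[OF k] H Hb)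
      finally have "cmod (ev g z) \<le> norm r * norm (mul k (P n - L))" using cmod_cinner_le by metis
      moreover have "cmod (ev r z) \<le> cmod (ev g z)"
        using inner_fun_prod_bfac[of "{..<n}"] z
        by (simp add: g ev_mul H norm_mult mult_left_le_one_le inner_fun_def)
      ultimately show ?thesis by simp
    qed
    have "(\<lambda>n. norm r * norm (mul k (P n - L))) \<longlonglongrightarrow> norm r * norm (mul k (L - L))"
      by (intro tendsto_intros bounded_linear.tendsto[OF bounded_linear_mul[OF k]] PL)
    then have "(\<lambda>n. norm r * norm (mul k (P n - L))) \<longlonglongrightarrow> 0"
      using mul_diff[OF k, of 0 0] by simp
    then have "cmod (ev r z) \<le> 0" by (rule LIMSEQ_le_const) (use bound in blast)
    then show ?thesis by simp
  qed
  then have "r = 0" by (intro ev_eqI) simp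
  then show ?thesis using proj_in[OF E, of x] by (simp add: r_def)
qed

end

text \<open>Serves in contrapositive form: a product with simple zeros lists them without
  repetition. Splitting off the factors i and j leaves the square of one factor times a Blaschke
  product over the other indices.\<close>

lemma bprod_double_zero:
  assumes w: "\<forall>k\<in>K. w k \<in> unit_disk" and summ: "(\<lambda>k. 1 - cmod (w k)) summable_on K"
    and jk: "i \<in> K" "j \<in> K" "i \<noteq> j" "w i = w j"
  shows "(bprod w K has_field_derivative 0) (at (w i))"
proof -
  define p where "p = w i"
  have p: "cmod p < 1" using w jk by (simp add: p_def)
  define K' where "K' = K - {i, j}"
  have K': "\<forall>k\<in>K'. w k \<in> unit_disk" "(\<lambda>k. 1 - cmod (w k)) summable_on K'"
    using w summ by (auto simp: K'_def intro: summable_on_subset_banach)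
  have eq: "bprod w K z = blaschke_factor p z * blaschke_factor p z * bprod w K' z" if z: "z \<in> ball 0 1" for z
  proof (rule LIMSEQ_unique)
    have z: "cmod z < 1" using z by simp
    show "(\<lambda>n. \<Prod>k<n. bfac w K k z) \<longlonglongrightarrow> bprod w K z" by (rule bprod_tendsto[OF w summ z])
    show "(\<lambda>n. \<Prod>k<n. bfac w K k z) \<longlonglongrightarrow> blaschke_factor p z * blaschke_factor p z * bprod w K' z"
    proof (rule Lim_transform_eventually[OF tendsto_mult[OF tendsto_const bprod_tendsto[OF K' z]]])
      show "\<forall>\<^sub>F n in sequentially. blaschke_factor p z * blaschke_factor p z * (\<Prod>k<n. bfac w K' k z) = (\<Prod>k<n. bfac w K k z)"
      proof (rule eventually_sequentiallyI)
        fix n assume n: "Suc (max i j) \<le> n"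
        have "(\<Prod>k<n. bfac w A k z) = bfac w A i z * (bfac w A j z * (\<Prod>k\<in>{..<n} - {i} - {j}. bfac w A k z))" for A
          using n jk by (simp add: prod.remove[of _ i] prod.remove[of _ j])
        from this[of K] this[of K'] show "blaschke_factor p z * blaschke_factor p z * (\<Prod>k<n. bfac w K' k z) = (\<Prod>k<n. bfac w K k z)"
          using jk by (auto simp: bfac_def K'_def p_def intro!: prod.cong)
      qed
    qed
  qed
  have d: "blaschke_factor p field_differentiable at p" "bprod w K' field_differentiable at p"
    using p blaschke_factor_holomorphic[OF p] inner_fun_Hinf[OF inner_fun_bprod[OF K']]
    by (auto intro!: holomorphic_on_imp_differentiable_at[of _ "ball 0 1"] simp: Hinf_def)
  then obtain D D' where D: "(blaschke_factor p has_field_derivative D) (at p)" "(bprod w K' has_field_derivative D') (at p)"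
    by (auto simp: field_differentiable_def)
  have "blaschke_factor p p = 0" using p by (simp add: blaschke_factor_eq_0_iff)
  then have "((\<lambda>z. blaschke_factor p z * blaschke_factor p z * bprod w K' z) has_field_derivative 0) (at p)"
    using DERIV_mult[OF DERIV_mult[OF D(1) D(1)] D(2)] by simp
  then have "(bprod w K has_field_derivative 0) (at p)"
    by (rule has_field_derivative_transform_within_open[of _ _ _ "ball 0 1"]) (use p eq in auto)
  then show ?thesis by (simp add: p_def)
qed

subsection \<open>Boundary values and compactness of Hankel operators\<close>

lemma rad_less_1: "cmod (of_real (rad n) * cis t) < 1"
  by (simp add: norm_mult rad_range del: of_real_diff)

text \<open>Fatou's lemma for the nonnegative functions 1 - |f|^2 on circles: their integrals tend
  to 0 because f has norm 1, so the limit function vanishes almost everywhere.\<close>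

lemma inner_fun_boundary_unimodular:
  assumes f: "inner_fun f" and u: "has_boundary_function f u"
  shows "AE t\<in>{0..2*pi} in lborel. cmod (u (cis t)) = 1"
proof -
  let ?z = "\<lambda>n t. of_real (rad n) * cis t"
  have H: "f \<in> Hinf" and le1: "\<And>z. cmod z < 1 \<Longrightarrow> cmod (f z) \<le> 1" and n1: "norm (mul f (kern 0)) = 1"
    using f by (auto simp: inner_fun_def)
  define g where "g n t = 1 - (cmod (f (?z n t)))\<^sup>2" for n t
  have ev: "ev (mul f (kern 0)) (?z n t) = f (?z n t)" for n t
    unfolding ev_mul[OF H] using ev_kern_0[OF rad_less_1] by simp
  have g0: "0 \<le> g n t" for n t using le1[OF rad_less_1, of n t] by (simp add: g_def power_le_one)
  have cont: "continuous_on {0..2*pi} (g n)" for n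
    unfolding g_def by (intro continuous_intros circle_continuous HinfD H rad_range)
  have meas: "(\<lambda>t. ennreal (indicator {0..2*pi} t *\<^sub>R g n t)) \<in> borel_measurable lborel" for n
    using borel_measurable_continuous_on_indicator[OF _ cont[of n]] by simp
  have nn: "(\<integral>\<^sup>+ t. ennreal (indicator {0..2*pi} t *\<^sub>R g n t) \<partial>lborel) =
      ennreal (2 * pi - integral {0..2*pi} (\<lambda>t. (cmod (ev (mul f (kern 0)) (?z n t)))\<^sup>2))" for n
  proof -
    have "(g n has_integral integral {0..2*pi} (g n)) {0..2*pi}"
      by (intro integrable_integral integrable_continuous_real cont)
    from nn_integral_has_integral_lebesgue[OF _ this] g0
    have "(\<integral>\<^sup>+ t. ennreal (indicator {0..2*pi} t *\<^sub>R g n t) \<partial>lborel) = ennreal (integral {0..2*pi} (g n))"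
      by simp
    also have "integral {0..2*pi} (g n) = integral {0..2*pi} (\<lambda>t. 1) - integral {0..2*pi} (\<lambda>t. (cmod (f (?z n t)))\<^sup>2)"
      unfolding g_def
      by (intro integral_diff integrable_const_ivl integrable_continuous_real continuous_intros circle_continuous HinfD H rad_range)
    finally show ?thesis unfolding ev by simp
  qed
  have "(\<lambda>n. ennreal (2 * pi - integral {0..2*pi} (\<lambda>t. (cmod (ev (mul f (kern 0)) (?z n t)))\<^sup>2)))
      \<longlonglongrightarrow> ennreal (2 * pi - 2 * pi * (norm (mul f (kern 0)))\<^sup>2)"
    by (intro tendsto_ennrealI tendsto_intros filterlim_compose[OF ev_circle_norm_tendsto rad_at_left])
  then have "(\<lambda>n. \<integral>\<^sup>+ t. ennreal (indicator {0..2*pi} t *\<^sub>R g n t) \<partial>lborel) \<longlonglongrightarrow> 0"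
    unfolding nn by (simp add: n1)
  then have "liminf (\<lambda>n. \<integral>\<^sup>+ t. ennreal (indicator {0..2*pi} t *\<^sub>R g n t) \<partial>lborel) = 0"
    by (intro lim_imp_Liminf) auto
  moreover have "(\<integral>\<^sup>+ t. liminf (\<lambda>n. ennreal (indicator {0..2*pi} t *\<^sub>R g n t)) \<partial>lborel)
      \<le> liminf (\<lambda>n. \<integral>\<^sup>+ t. ennreal (indicator {0..2*pi} t *\<^sub>R g n t) \<partial>lborel)"
    by (rule nn_integral_liminf) (rule meas)
  ultimately have "(\<integral>\<^sup>+ t. liminf (\<lambda>n. ennreal (indicator {0..2*pi} t *\<^sub>R g n t)) \<partial>lborel) = 0"
    by (simp only: le_zero_eq)
  then have "AE t in lborel. liminf (\<lambda>n. ennreal (indicator {0..2*pi} t *\<^sub>R g n t)) = 0"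
    by (subst (asm) nn_integral_0_iff_AE) (intro borel_measurable_liminf meas)
  with u[unfolded has_boundary_function_def] show ?thesis
  proof eventually_elim
    case (elim t)
    show ?case
    proof
      assume t: "t \<in> {0..2*pi}"
      then have lim: "((\<lambda>r. f (of_real r * cis t)) \<longlongrightarrow> u (cis t)) (at_left 1)" using elim by simp
      have fl: "(\<lambda>n. f (?z n t)) \<longlonglongrightarrow> u (cis t)" by (rule filterlim_compose[OF lim rad_at_left])
      have "(\<lambda>n. ennreal (g n t)) \<longlonglongrightarrow> ennreal (1 - (cmod (u (cis t)))\<^sup>2)"
        unfolding g_def by (intro tendsto_ennrealI tendsto_intros fl)
      then have "liminf (\<lambda>n. ennreal (g n t)) = ennreal (1 - (cmod (u (cis t)))\<^sup>2)"
        by (intro lim_imp_Liminf) auto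
      then have "ennreal (1 - (cmod (u (cis t)))\<^sup>2) = 0" using elim(2) t by simp
      then have "1 \<le> (cmod (u (cis t)))\<^sup>2" by (simp add: ennreal_eq_0_iff)
      moreover have "cmod (u (cis t)) \<le> 1"
        by (rule LIMSEQ_le_const2[OF tendsto_norm[OF fl]]) (use le1[OF rad_less_1] in blast)
      moreover have "1 \<le> cmod (u (cis t))" by (rule power2_le_imp_le) (use calculation in auto)
      ultimately show "cmod (u (cis t)) = 1" by simp
    qed
  qed
qed

text \<open>The positive part of |x|^2 - \<epsilon>^2 |y|^2 on circles tends to 0 almost everywhere
  and is dominated by C^2, so its integrals tend to 0; the circle means of |x|^2 and |y|^2 tend to
  the squared norms up to the factor 2 pi.\<close>

lemma norm_le_of_boundary:
  assumes bound_x: "\<And>z. cmod z < 1 \<Longrightarrow> cmod (ev x z) \<le> C"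
    and bound_y: "\<And>z. cmod z < 1 \<Longrightarrow> cmod (ev y z) \<le> C"
    and \<epsilon>: "\<epsilon> \<ge> 0"
    and ae: "AE t\<in>{0..2*pi} in lborel. \<exists>a b. ((\<lambda>r. ev x (of_real r * cis t)) \<longlongrightarrow> a) (at_left (1::real)) \<and>
       ((\<lambda>r. ev y (of_real r * cis t)) \<longlongrightarrow> b) (at_left 1) \<and> cmod a \<le> \<epsilon> * cmod b"
  shows "norm x \<le> \<epsilon> * norm y"
proof -
  let ?z = "\<lambda>n t. of_real (rad n) * cis t"
  define d where "d n t = max 0 ((cmod (ev x (?z n t)))\<^sup>2 - \<epsilon>\<^sup>2 * (cmod (ev y (?z n t)))\<^sup>2)" for n t
  have cont: "continuous_on {0..2*pi} (d n)" for n
    unfolding d_def by (intro continuous_intros circle_continuous ev_holomorphic rad_range)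
  have int: "set_integrable lborel {0..2*pi} (d n)" for n
    by (intro borel_integrable_atLeastAtMost' cont)
  have "(\<lambda>n. \<integral>t. indicator {0..2*pi} t *\<^sub>R d n t \<partial>lborel) \<longlonglongrightarrow> integral\<^sup>L lborel (\<lambda>t::real. 0)"
  proof (rule integral_dominated_convergence)
    show "integrable lborel (\<lambda>t. indicator {0..2*pi} t *\<^sub>R C\<^sup>2)"
      using borel_integrable_atLeastAtMost'[of 0 "2*pi" "\<lambda>_. C\<^sup>2"] unfolding set_integrable_def by simp
    show "(\<lambda>t. indicator {0..2*pi} t *\<^sub>R d n t) \<in> borel_measurable lborel" for n
      using int[of n] unfolding set_integrable_def by (rule borel_measurable_integrable)
    show "AE t in lborel. norm (indicator {0..2*pi} t *\<^sub>R d n t) \<le> indicator {0..2*pi} t *\<^sub>R C\<^sup>2" for n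
    proof (intro always_eventually allI)
      fix t
      have "(cmod (ev x (?z n t)))\<^sup>2 \<le> C\<^sup>2" by (intro power_mono bound_x rad_less_1) auto
      moreover have "0 \<le> \<epsilon>\<^sup>2 * (cmod (ev y (?z n t)))\<^sup>2" by simp
      ultimately have "\<bar>d n t\<bar> \<le> C\<^sup>2"
        unfolding d_def by (smt (verit, best) zero_le_power2)
      then show "norm (indicator {0..2*pi} t *\<^sub>R d n t) \<le> indicator {0..2*pi} t *\<^sub>R C\<^sup>2"
        by (auto simp: indicator_def)
    qed
    show "AE t in lborel. (\<lambda>n. indicator {0..2*pi} t *\<^sub>R d n t) \<longlonglongrightarrow> 0"
      using ae
    proof eventually_elim
      case (elim t)
      show ?case
      proof (cases "t \<in> {0..2*pi}")
        case True
        then obtain a b where ab: "((\<lambda>r. ev x (of_real r * cis t)) \<longlongrightarrow> a) (at_left (1::real))"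
           "((\<lambda>r. ev y (of_real r * cis t)) \<longlongrightarrow> b) (at_left 1)" "cmod a \<le> \<epsilon> * cmod b" using elim by auto
        have "(\<lambda>n. d n t) \<longlonglongrightarrow> max 0 ((cmod a)\<^sup>2 - \<epsilon>\<^sup>2 * (cmod b)\<^sup>2)"
          unfolding d_def
          by (intro tendsto_intros filterlim_compose[OF ab(1) rad_at_left] filterlim_compose[OF ab(2) rad_at_left])
        moreover have "(cmod a)\<^sup>2 \<le> \<epsilon>\<^sup>2 * (cmod b)\<^sup>2"
          using power_mono[OF ab(3), of 2] by (simp add: power_mult_distrib)
        ultimately show ?thesis using True by simp
      qed simp
    qed
  qed simp
  then have lim0: "(\<lambda>n. integral {0..2*pi} (d n)) \<longlonglongrightarrow> 0"
    using set_borel_integral_eq_integral(2)[OF int] by (simp add: set_lebesgue_integral_def)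
  let ?I = "\<lambda>x n. integral {0..2*pi} (\<lambda>t. (cmod (ev x (?z n t)))\<^sup>2)"
  have le: "?I x n \<le> \<epsilon>\<^sup>2 * ?I y n + integral {0..2*pi} (d n)" for n
  proof -
    have "?I x n \<le> integral {0..2*pi} (\<lambda>t. \<epsilon>\<^sup>2 * (cmod (ev y (?z n t)))\<^sup>2 + d n t)"
      by (intro integral_le integrable_add integrable_on_mult_right ev_circle_norm rad_range integrable_continuous_real cont)
        (auto simp: d_def)
    also have "\<dots> = \<epsilon>\<^sup>2 * ?I y n + integral {0..2*pi} (d n)"
      by (subst integral_add[OF integrable_on_mult_right[OF ev_circle_norm(2)[OF rad_range]] integrable_continuous_real[OF cont]])
        (simp only: integral_mult_right)
    finally show ?thesis .
  qed
  have "2 * pi * (norm x)\<^sup>2 \<le> \<epsilon>\<^sup>2 * (2 * pi * (norm y)\<^sup>2) + 0"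
  proof (rule LIMSEQ_le)
    show "?I x \<longlonglongrightarrow> 2 * pi * (norm x)\<^sup>2"
      by (rule filterlim_compose[OF ev_circle_norm_tendsto rad_at_left])
    show "(\<lambda>n. \<epsilon>\<^sup>2 * ?I y n + integral {0..2*pi} (d n)) \<longlonglongrightarrow> \<epsilon>\<^sup>2 * (2 * pi * (norm y)\<^sup>2) + 0"
      by (intro tendsto_intros lim0 filterlim_compose[OF ev_circle_norm_tendsto rad_at_left])
  qed (use le in blast)
  then have "(norm x)\<^sup>2 \<le> (\<epsilon> * norm y)\<^sup>2" by (simp add: power_mult_distrib field_simps)
  then show ?thesis by (rule power2_le_imp_le) (use \<epsilon> in simp)
qed

text \<open>On the circle conj(\<zeta>) = 1/\<zeta>, so a sufficiently high power of \<zeta> clears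
  the conjugates hidden in real and imaginary parts.\<close>

lemma real_polynomial_on_circle:
  assumes "real_polynomial_function (p :: complex \<Rightarrow> real)"
  shows "\<exists>m Q. \<forall>\<zeta>. cmod \<zeta> = 1 \<longrightarrow> \<zeta> ^ m * of_real (p \<zeta>) = poly Q \<zeta>"
  using assms
proof induction
  case (linear f)
  define \<alpha> \<beta> where "\<alpha> = complex_of_real (f 1)" and "\<beta> = complex_of_real (f \<i>)"
  \<comment> \<open>The coefficients come from 2 \<zeta> Re \<zeta> = \<zeta>^2 + 1 and 2 i \<zeta>
    Im \<zeta> = \<zeta>^2 - 1.\<close>
  have "\<zeta> ^ 1 * of_real (f \<zeta>) = poly [: (\<alpha> + \<i> * \<beta>) / 2, 0, (\<alpha> - \<i> * \<beta>) / 2 :] \<zeta>" if "cmod \<zeta> = 1" for \<zeta>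
  proof -
    have "f \<zeta> = f (Re \<zeta> *\<^sub>R 1 + Im \<zeta> *\<^sub>R \<i>)" using complex_eq[of \<zeta>] by (simp add: scaleR_conv_of_real mult.commute)
    also have "\<dots> = Re \<zeta> * f 1 + Im \<zeta> * f \<i>"
      using bounded_linear.linear[OF linear] by (simp add: linear_add linear_scale)
    finally have f: "complex_of_real (f \<zeta>) = of_real (Re \<zeta>) * \<alpha> + of_real (Im \<zeta>) * \<beta>"
      by (simp add: \<alpha>_def \<beta>_def)
    have one: "\<zeta> * cnj \<zeta> = 1" using complex_norm_square[of \<zeta>] that by simp
    have re: "2 * (\<zeta> * of_real (Re \<zeta>)) = \<zeta> * \<zeta> + 1"
      using one complex_add_cnj[of \<zeta>] by (metis distrib_left mult.left_commute of_real_mult of_real_numeral)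
    have im: "2 * \<i> * (\<zeta> * of_real (Im \<zeta>)) = \<zeta> * \<zeta> - 1"
      using one complex_diff_cnj[of \<zeta>] by (metis right_diff_distrib mult.left_commute mult.assoc mult.commute of_real_mult of_real_numeral)
    then have im': "2 * (\<zeta> * of_real (Im \<zeta>)) = - \<i> * (\<zeta> * \<zeta> - 1)"
      by (simp add: complex_eq_iff algebra_simps)
    have "2 * (\<zeta> * of_real (f \<zeta>)) = (2 * (\<zeta> * of_real (Re \<zeta>))) * \<alpha> + (2 * (\<zeta> * of_real (Im \<zeta>))) * \<beta>"
      by (simp add: f algebra_simps)
    also have "\<dots> = (\<zeta> * \<zeta> + 1) * \<alpha> + (- \<i> * (\<zeta> * \<zeta> - 1)) * \<beta>" by (simp only: re im')
    also have "\<dots> = 2 * poly [: (\<alpha> + \<i> * \<beta>) / 2, 0, (\<alpha> - \<i> * \<beta>) / 2 :] \<zeta>"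
      by (simp add: algebra_simps add_divide_distrib diff_divide_distrib)
    finally show ?thesis unfolding power_one_right by (rule mult_left_cancel[THEN iffD1, rotated]) simp
  qed
  then show ?case by blast
next
  case (const c)
  have "\<zeta> ^ 0 * complex_of_real c = poly [: of_real c :] \<zeta>" for \<zeta> by simp
  then show ?case by blast
next
  case (add f g)
  then obtain m Q n R where "\<forall>\<zeta>. cmod \<zeta> = 1 \<longrightarrow> \<zeta> ^ m * of_real (f \<zeta>) = poly Q \<zeta>"
    "\<forall>\<zeta>. cmod \<zeta> = 1 \<longrightarrow> \<zeta> ^ n * of_real (g \<zeta>) = poly R \<zeta>" by auto
  then have "\<forall>\<zeta>. cmod \<zeta> = 1 \<longrightarrow> \<zeta> ^ (m + n) * of_real (f \<zeta> + g \<zeta>) = poly (monom 1 n * Q + monom 1 m * R) \<zeta>"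
    by (auto simp: poly_monom power_add algebra_simps)
  then show ?case by blast
next
  case (mult f g)
  then obtain m Q n R where "\<forall>\<zeta>. cmod \<zeta> = 1 \<longrightarrow> \<zeta> ^ m * of_real (f \<zeta>) = poly Q \<zeta>"
    "\<forall>\<zeta>. cmod \<zeta> = 1 \<longrightarrow> \<zeta> ^ n * of_real (g \<zeta>) = poly R \<zeta>" by auto
  then have "\<forall>\<zeta>. cmod \<zeta> = 1 \<longrightarrow> \<zeta> ^ (m + n) * of_real (f \<zeta> * g \<zeta>) = poly (Q * R) \<zeta>"
    by (auto simp: power_add algebra_simps)
  then show ?case by blast
qed

text \<open>Stone-Weierstrass, with the negative powers cleared. The exponent m becomes the order of
  vanishing in \<open>hankel_small\<close>.\<close>

lemma circle_trig_approximation: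
  assumes g: "continuous_on (sphere 0 1) (g :: complex \<Rightarrow> complex)" and e: "e > 0"
  shows "\<exists>m Q. \<forall>\<zeta>. cmod \<zeta> = 1 \<longrightarrow> cmod (\<zeta> ^ m * g \<zeta> - poly Q \<zeta>) < e"
proof -
  obtain p where p: "polynomial_function p" "\<forall>\<zeta>\<in>sphere 0 1. cmod (g \<zeta> - p \<zeta>) < e"
    using Stone_Weierstrass_polynomial_function[OF _ g e] by auto
  have "real_polynomial_function (\<lambda>\<zeta>. Re (p \<zeta>))" "real_polynomial_function (\<lambda>\<zeta>. Im (p \<zeta>))"
    using p(1) bounded_linear_Re bounded_linear_Im unfolding polynomial_function_def o_def by blast+
  from this[THEN real_polynomial_on_circle] obtain m Q n R where
    Q: "\<forall>\<zeta>. cmod \<zeta> = 1 \<longrightarrow> \<zeta> ^ m * of_real (Re (p \<zeta>)) = poly Q \<zeta>"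
    and R: "\<forall>\<zeta>. cmod \<zeta> = 1 \<longrightarrow> \<zeta> ^ n * of_real (Im (p \<zeta>)) = poly R \<zeta>" by auto
  have "cmod (\<zeta> ^ (m + n) * g \<zeta> - poly (monom 1 n * Q + monom \<i> m * R) \<zeta>) < e" if \<zeta>: "cmod \<zeta> = 1" for \<zeta>
  proof -
    have "\<zeta> ^ (m + n) * p \<zeta> = \<zeta> ^ (m + n) * (of_real (Re (p \<zeta>)) + \<i> * of_real (Im (p \<zeta>)))"
      using complex_eq[of "p \<zeta>"] by simp
    also have "\<dots> = \<zeta> ^ n * (\<zeta> ^ m * of_real (Re (p \<zeta>))) + \<i> * \<zeta> ^ m * (\<zeta> ^ n * of_real (Im (p \<zeta>)))"
      by (simp add: power_add algebra_simps)
    also have "\<dots> = poly (monom 1 n * Q + monom \<i> m * R) \<zeta>"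
      using Q R \<zeta> by (simp add: poly_monom)
    finally have "\<zeta> ^ (m + n) * g \<zeta> - poly (monom 1 n * Q + monom \<i> m * R) \<zeta> = \<zeta> ^ (m + n) * (g \<zeta> - p \<zeta>)"
      by (simp add: right_diff_distrib)
    then show ?thesis using p(2) \<zeta> by (simp add: norm_mult norm_power)
  qed
  then show ?thesis by blast
qed

text \<open>The Hankel operator with symbol in $H^\infty + C$ is a norm limit of operators that vanish
  on $z^m H^2$; this is the form of compactness that is used.\<close>

lemma hankel_small:
  assumes B: "inner_fun B" and u: "has_boundary_function B u" and c: "c \<ge> 0"
    and sym: "(\<lambda>\<zeta>. psi c \<zeta> * cnj (u \<zeta>)) \<in> Hinf_plus_C" and e: "\<epsilon> > 0"
  shows "\<exists>m. \<forall>y. infdist (mul (psi c) (mul (\<lambda>z. z ^ m) y)) (range (mul B)) \<le> \<epsilon> * norm y"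
proof -
  note HB = inner_fun_Hinf[OF B] and Hp = psi_Hinf[OF c] and Hm = Hinf_power[OF Hinf_id]
  obtain f u' g where f: "f \<in> Hinf" and u': "has_boundary_function f u'" and g: "continuous_on (sphere 0 1) g"
    and ae: "AE t\<in>{0..2*pi} in lborel. psi c (cis t) * cnj (u (cis t)) = u' (cis t) + g (cis t)"
    using sym unfolding Hinf_plus_C_def by auto
  obtain m Q where Q: "\<And>\<zeta>. cmod \<zeta> = 1 \<Longrightarrow> cmod (\<zeta> ^ m * g \<zeta> - poly Q \<zeta>) < \<epsilon>"
    using circle_trig_approximation[OF g e] by auto
  \<comment> \<open>Polynomials come before general y because the comparison of boundary values
    needs bounded functions with radial limits.\<close>
  have poly: "infdist (mul (psi c) (mul (\<lambda>z. z ^ m) (poly_hardy q))) (range (mul B)) \<le> \<epsilon> * norm (poly_hardy q)" for q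
  proof -
    define y where "y = poly_hardy q"
    \<comment> \<open>On the circle psi_c = u (u' + g), since |u| = 1, and \<zeta>^m g is within
      \<epsilon> of Q. Hence B h is within \<epsilon> |q| of psi_c z^m q there.\<close>
    define h where "h = (\<lambda>z. f z * (z ^ m * poly q z) + poly Q z * poly q z)"
    have Hh: "h \<in> Hinf" unfolding h_def by (intro Hinf_add Hinf_mult f Hm Hinf_poly)
    define F where "F = (\<lambda>z. psi c z * (z ^ m * poly q z) - B z * h z)"
    have HF: "F \<in> Hinf" unfolding F_def by (intro Hinf_diff Hinf_mult Hp HB Hm Hinf_poly Hh)
    define x where "x = mul F (kern 0)"
    have evx: "ev x z = F z" if "cmod z < 1" for z using that by (simp add: x_def ev_mul[OF HF])
    have evy: "ev y z = poly q z" if "cmod z < 1" for z using that by (simp add: y_def ev_poly_hardy)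
    have x: "x = mul (psi c) (mul (\<lambda>z. z ^ m) y) - mul B (mul h (kern 0))"
      by (rule ev_eqI) (simp add: evx F_def ev_mul Hp Hm HB Hh evy)
    obtain C1 where C1: "\<And>z. cmod z < 1 \<Longrightarrow> cmod (F z) \<le> C1" using HinfD(2)[OF HF] by blast
    obtain C2 where C2: "\<And>z. cmod z < 1 \<Longrightarrow> cmod (poly q z) \<le> C2" using HinfD(2)[OF Hinf_poly[of q]] by blast
    have "norm x \<le> \<epsilon> * norm y"
    proof (rule norm_le_of_boundary)
      show "cmod (ev x z) \<le> max C1 C2" if "cmod z < 1" for z using C1[OF that] evx[OF that] by simp
      show "cmod (ev y z) \<le> max C1 C2" if "cmod z < 1" for z using C2[OF that] evy[OF that] by simp
      \<comment> \<open>The endpoints are discarded: they represent the point 1, where the division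
        in \<open>psi\<close> takes its default value.\<close>
      have "AE t in lborel. t \<noteq> 0" "AE t in lborel. t \<noteq> 2 * pi" by (rule AE_lborel_singleton)+
      with ae u[unfolded has_boundary_function_def] u'[unfolded has_boundary_function_def]
        inner_fun_boundary_unimodular[OF B u]
      show "AE t\<in>{0..2*pi} in lborel. \<exists>a b. ((\<lambda>r. ev x (of_real r * cis t)) \<longlongrightarrow> a) (at_left (1::real)) \<and>
         ((\<lambda>r. ev y (of_real r * cis t)) \<longlongrightarrow> b) (at_left 1) \<and> cmod a \<le> \<epsilon> * cmod b"
      proof eventually_elim
        case (elim t)
        show ?case
        proof
          assume t: "t \<in> {0..2*pi}"
          define \<zeta> where "\<zeta> = cis t"
          have lu: "((\<lambda>r. B (of_real r * \<zeta>)) \<longlongrightarrow> u \<zeta>) (at_left (1::real))"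
            and lu': "((\<lambda>r. f (of_real r * \<zeta>)) \<longlongrightarrow> u' \<zeta>) (at_left (1::real))"
            and u1: "cmod (u \<zeta>) = 1" and eq: "psi c \<zeta> * cnj (u \<zeta>) = u' \<zeta> + g \<zeta>"
            using elim t by (auto simp: \<zeta>_def)
          have "cis t \<noteq> 1" using elim t by (intro cis_neq_1) auto
          then have lp: "((\<lambda>r. psi c (of_real r * \<zeta>)) \<longlongrightarrow> psi c \<zeta>) (at_left (1::real))"
            unfolding \<zeta>_def by (rule psi_radial_limit)
          have lid: "((\<lambda>r. of_real r * \<zeta>) \<longlongrightarrow> of_real 1 * \<zeta>) (at_left (1::real))"
            by (intro tendsto_intros)
          then have lid: "((\<lambda>r. of_real r * \<zeta>) \<longlongrightarrow> \<zeta>) (at_left (1::real))" by simp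
          have lpoly: "((\<lambda>r. poly p (of_real r * \<zeta>)) \<longlongrightarrow> poly p \<zeta>) (at_left (1::real))" for p
            by (intro tendsto_poly lid)
          have in1: "\<forall>\<^sub>F r in at_left (1::real). cmod (of_real r * \<zeta>) < 1"
            by (rule eventually_mono[OF eventually_at_left_real[of 0 1]]) (auto simp: norm_mult \<zeta>_def)
          define a where "a = psi c \<zeta> * (\<zeta> ^ m * poly q \<zeta>) - u \<zeta> * (u' \<zeta> * (\<zeta> ^ m * poly q \<zeta>) + poly Q \<zeta> * poly q \<zeta>)"
          have "((\<lambda>r. F (of_real r * \<zeta>)) \<longlongrightarrow> a) (at_left (1::real))"
            unfolding F_def h_def a_def by (intro tendsto_intros lp lid lpoly lu lu')
          then have 1: "((\<lambda>r. ev x (of_real r * \<zeta>)) \<longlongrightarrow> a) (at_left (1::real))"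
            by (rule Lim_transform_eventually) (use in1 in eventually_elim, simp add: evx)
          have 2: "((\<lambda>r. ev y (of_real r * \<zeta>)) \<longlongrightarrow> poly q \<zeta>) (at_left (1::real))"
            by (rule Lim_transform_eventually[OF lpoly]) (use in1 in eventually_elim, simp add: evy)
          have uu: "u \<zeta> * cnj (u \<zeta>) = 1" using complex_norm_square[of "u \<zeta>"] u1 by simp
          have "psi c \<zeta> = u \<zeta> * (psi c \<zeta> * cnj (u \<zeta>))" using uu by (simp add: mult.left_commute)
          then have "psi c \<zeta> = u \<zeta> * (u' \<zeta> + g \<zeta>)" by (simp only: eq)
          then have "a = u \<zeta> * (\<zeta> ^ m * g \<zeta> - poly Q \<zeta>) * poly q \<zeta>"
            by (simp add: a_def algebra_simps)
          then have "cmod a = cmod (\<zeta> ^ m * g \<zeta> - poly Q \<zeta>) * cmod (poly q \<zeta>)"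
            by (simp add: norm_mult u1)
          also have "\<dots> \<le> \<epsilon> * cmod (poly q \<zeta>)"
            using Q[of \<zeta>] by (intro mult_right_mono) (auto simp: \<zeta>_def)
          finally have "cmod a \<le> \<epsilon> * cmod (poly q \<zeta>)" .
          with 1 2 show "\<exists>a b. ((\<lambda>r. ev x (of_real r * cis t)) \<longlongrightarrow> a) (at_left (1::real)) \<and>
             ((\<lambda>r. ev y (of_real r * cis t)) \<longlongrightarrow> b) (at_left 1) \<and> cmod a \<le> \<epsilon> * cmod b"
            unfolding \<zeta>_def by blast
        qed
      qed
    qed (use e in simp)
    moreover have "infdist (mul (psi c) (mul (\<lambda>z. z ^ m) y)) (range (mul B)) \<le> norm x"
      unfolding x dist_norm[symmetric] by (rule infdist_le) simp
    ultimately show ?thesis by (simp add: y_def)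
  qed
  have "infdist (mul (psi c) (mul (\<lambda>z. z ^ m) y)) (range (mul B)) \<le> \<epsilon> * norm y" for y
  proof -
    obtain q where q: "(\<lambda>n. poly_hardy (q n)) \<longlonglongrightarrow> y" using poly_hardy_dense by blast
    show ?thesis
    proof (rule LIMSEQ_le)
      show "(\<lambda>n. infdist (mul (psi c) (mul (\<lambda>z. z ^ m) (poly_hardy (q n)))) (range (mul B)))
        \<longlonglongrightarrow> infdist (mul (psi c) (mul (\<lambda>z. z ^ m) y)) (range (mul B))"
        by (intro tendsto_infdist bounded_linear.tendsto[OF bounded_linear_mul] Hp Hm q)
      show "(\<lambda>n. \<epsilon> * norm (poly_hardy (q n))) \<longlonglongrightarrow> \<epsilon> * norm y" by (intro tendsto_intros q)
    qed (use poly in blast)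
  qed
  then show ?thesis by blast
qed

subsection \<open>Angle between the shifted subspaces\<close>

lemma infdist_eq_norm_diff_proj:
  fixes E :: "'a::{real_inner, complete_space} set"
  assumes E: "subspace E" "closed E"
  shows "infdist x E = norm (x - proj E x)"
proof (rule antisym)
  show "infdist x E \<le> norm (x - proj E x)"
    using infdist_le[OF proj_in[OF E], of x x] by (simp add: dist_norm)
  have "E \<noteq> {}" using proj_in[OF E, of x] by blast
  then show "norm (x - proj E x) \<le> infdist x E"
    unfolding infdist_notempty[OF \<open>E \<noteq> {}\<close>]
    by (intro cINF_greatest) (auto simp: dist_norm norm_diff_proj_le[OF E])
qed

lemma mul_psi_psi: "c \<ge> 0 \<Longrightarrow> d \<ge> 0 \<Longrightarrow> mul (psi c) (mul (psi d) x) = mul (psi (c + d)) x"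
  by (simp add: mul_mul psi_Hinf psi_mult)

text \<open>Since |psi_a| \<le> 1, the denominator has modulus at least 1 - |\<gamma>|.
  Multiplication by it is therefore invertible on H^2 and maps every range B H^2 onto
  itself.\<close>

lemma frostman_shift_denominator:
  assumes "a \<ge> 0" "cmod \<gamma> < 1"
  shows "(\<lambda>z. 1 - cnj \<gamma> * psi a z) \<in> Hinf" "(\<lambda>z. 1 / (1 - cnj \<gamma> * psi a z)) \<in> Hinf"
    "\<And>z. cmod z < 1 \<Longrightarrow> 1 - cnj \<gamma> * psi a z \<noteq> 0"
proof -
  show N: "(\<lambda>z. 1 - cnj \<gamma> * psi a z) \<in> Hinf"
    by (intro Hinf_diff Hinf_mult Hinf_const psi_Hinf assms)
  have ge: "1 - cmod \<gamma> \<le> cmod (1 - cnj \<gamma> * psi a z)" if "cmod z < 1" for z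
  proof -
    have "cmod (cnj \<gamma> * psi a z) \<le> cmod \<gamma>"
      using cmod_psi_le_1[OF assms(1) that] by (simp add: norm_mult mult_left_le)
    then show ?thesis using norm_triangle_ineq2[of 1 "cnj \<gamma> * psi a z"] by simp
  qed
  show nz: "\<And>z. cmod z < 1 \<Longrightarrow> 1 - cnj \<gamma> * psi a z \<noteq> 0" using ge assms(2) by fastforce
  show "(\<lambda>z. 1 / (1 - cnj \<gamma> * psi a z)) \<in> Hinf"
  proof (rule HinfI)
    show "(\<lambda>z. 1 / (1 - cnj \<gamma> * psi a z)) holomorphic_on ball 0 1"
      using HinfD(1)[OF N] nz by (intro holomorphic_on_divide) auto
    show "cmod (1 / (1 - cnj \<gamma> * psi a z)) \<le> 1 / (1 - cmod \<gamma>)" if "cmod z < 1" for z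
      using ge[OF that] assms(2) unfolding norm_divide norm_one by (intro frac_le) auto
  qed
qed

context
  fixes B :: "complex \<Rightarrow> complex"
  assumes B: "inner_fun B"
    and small: "\<And>c \<epsilon>. c > 0 \<Longrightarrow> \<epsilon> > 0 \<Longrightarrow>
      \<exists>m. \<forall>y. infdist (mul (psi c) (mul (\<lambda>z. z ^ m) y)) (range (mul B)) \<le> \<epsilon> * norm y"
begin

private abbreviation (input) "E \<equiv> range (mul B)"

private lemmas HB = inner_fun_Hinf[OF B]
private lemmas E = subspace_range_mul[OF HB] closed_range_mul[OF B]

text \<open>E is invariant under psi_d. With p = P_E psi_c h, isometry gives |p|^2 = <psi_c h, p> =
  <psi_(c+d) h, psi_d p>, and psi_d p is an element of E of norm |p|.\<close>

private lemma proj_psi_mono: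
  assumes "c \<ge> 0" "d \<ge> 0"
  shows "norm (proj E (mul (psi c) h)) \<le> norm (proj E (mul (psi (c + d)) h))"
proof (cases "proj E (mul (psi c) h) = 0")
  case False
  define p where "p = proj E (mul (psi c) h)"
  have pE: "p \<in> E" unfolding p_def by (rule proj_in[OF E])
  have dE: "mul (psi d) p \<in> E"
    using pE mul_commute[OF psi_Hinf[OF assms(2)] HB] by auto
  have "norm p * norm p = inner (mul (psi c) h) p"
    using proj_orth[OF E pE, of "mul (psi c) h"]
    by (simp add: p_def[symmetric] inner_diff_left power2_norm_eq_inner flip: power2_eq_square)
  also have "\<dots> = inner (mul (psi (c + d)) h) (mul (psi d) p)"
    using inner_mul_inner[OF inner_fun_psi[OF assms(2)], of "mul (psi c) h" p] assms
    by (simp add: mul_psi_psi add.commute)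
  also have "\<dots> = inner (proj E (mul (psi (c + d)) h)) (mul (psi d) p)"
    using proj_orth[OF E dE, of "mul (psi (c + d)) h"] by (simp add: inner_diff_left)
  also have "\<dots> \<le> norm (proj E (mul (psi (c + d)) h)) * norm (mul (psi d) p)"
    by (rule norm_cauchy_schwarz)
  also have "norm (mul (psi d) p) = norm p" by (rule norm_mul_inner[OF inner_fun_psi[OF assms(2)]])
  finally show ?thesis using False by (simp add: p_def)
qed simp

text \<open>psi_d minus its value at the origin, so a zero at 0 is gained while each factor remains
  a combination of psi_d and a constant.\<close>

private definition D :: "real \<Rightarrow> complex \<Rightarrow> complex" where
  "D d z = psi d z - of_real (exp (- d))"

private lemma D_Hinf: "d \<ge> 0 \<Longrightarrow> D d \<in> Hinf"
  unfolding D_def[abs_def] by (intro Hinf_diff psi_Hinf Hinf_const)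

private lemma mul_D: "d \<ge> 0 \<Longrightarrow> mul (D d) x = mul (psi d) x - exp (- d) *\<^sub>R x"
  by (rule mul_eqI) (simp_all add: D_Hinf D_def ev_mul psi_Hinf algebra_simps)

text \<open>Each factor splits into psi_d and a constant of modulus at most 1. By
  \<open>proj_psi_mono\<close> both terms are dominated by the one with exponent raised by d, whence
  a factor 2 per step.\<close>

private lemma proj_psi_D_power:
  assumes d: "d \<ge> 0"
  shows "c \<ge> 0 \<Longrightarrow> norm (proj E (mul (psi c) (mul (\<lambda>z. D d z ^ n) h))) \<le> 2 ^ n * norm (proj E (mul (psi (c + real n * d)) h))"
proof (induction n arbitrary: c)
  case 0
  have "mul (\<lambda>z. 1) h = h" by (rule mul_eqI) (simp_all add: Hinf_const)
  then show ?case by simp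
next
  case (Suc n)
  define x where "x = mul (\<lambda>z. D d z ^ n) h"
  have "mul (psi c) (mul (\<lambda>z. D d z ^ Suc n) h) = mul (psi c) (mul (D d) x)"
    unfolding x_def mul_mul[OF D_Hinf[OF d] Hinf_power[OF D_Hinf[OF d]]] by simp
  also have "\<dots> = mul (psi (c + d)) x - exp (- d) *\<^sub>R mul (psi c) x"
    using Suc.prems d by (simp add: mul_D mul_diff mul_scaleR psi_Hinf mul_psi_psi)
  finally have "norm (proj E (mul (psi c) (mul (\<lambda>z. D d z ^ Suc n) h))) =
     norm (proj E (mul (psi (c + d)) x) - exp (- d) *\<^sub>R proj E (mul (psi c) x))"
    by (simp only: proj_diff[OF E] proj_scaleR[OF E])
  also have "\<dots> \<le> norm (proj E (mul (psi (c + d)) x)) + exp (- d) * norm (proj E (mul (psi c) x))"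
    by (rule order_trans[OF norm_triangle_ineq4]) simp
  also have "exp (- d) * norm (proj E (mul (psi c) x)) \<le> 1 * norm (proj E (mul (psi (c + d)) x))"
    using d Suc.prems by (intro mult_mono proj_psi_mono) auto
  also have "norm (proj E (mul (psi (c + d)) x)) + 1 * norm (proj E (mul (psi (c + d)) x))
     = 2 * norm (proj E (mul (psi (c + d)) x))" by simp
  also have "\<dots> \<le> 2 * (2 ^ n * norm (proj E (mul (psi (c + d + real n * d)) h)))"
    unfolding x_def using Suc.prems d by (intro mult_left_mono Suc.IH) auto
  also have "c + d + real n * d = c + real (Suc n) * d" by (simp add: algebra_simps)
  finally show ?case by simp
qed

private lemma D_power_vanishes:
  assumes d: "d \<ge> 0"
  shows "\<exists>y. mul (\<lambda>z. D d z ^ n) h = mul (\<lambda>z. z ^ n) y"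
proof (induction n)
  case (Suc n)
  then obtain y where y: "mul (\<lambda>z. D d z ^ n) h = mul (\<lambda>z. z ^ n) y" by blast
  note HD = D_Hinf[OF d] and Hn = Hinf_power[OF Hinf_id]
  have "ev (mul (D d) y) 0 = 0" by (simp add: ev_mul HD D_def psi_0)
  moreover have "blaschke_factor 0 = (\<lambda>z. z)" by (simp add: blaschke_factor_def[abs_def])
  ultimately obtain y' where y': "mul (D d) y = mul (\<lambda>z. z) y'"
    using blaschke_factor_divides[of 0 "mul (D d) y"] by auto
  have "mul (\<lambda>z. D d z ^ Suc n) h = mul (D d) (mul (\<lambda>z. D d z ^ n) h)"
    unfolding mul_mul[OF HD Hinf_power[OF HD]] by simp
  also have "\<dots> = mul (\<lambda>z. z ^ n) (mul (D d) y)"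
    unfolding y by (rule mul_commute[OF HD Hn])
  also have "\<dots> = mul (\<lambda>z. z ^ Suc n) y'"
    unfolding y' mul_mul[OF Hn Hinf_id] by (simp add: mult.commute)
  finally show ?case by blast
qed auto

text \<open>Although \<open>D d\<close> vanishes at 0, multiplication by it is bounded below: psi_d
  is isometric and the subtracted constant has modulus exp(-d), so the reverse triangle inequality
  applies.\<close>

private lemma norm_D_power_ge:
  assumes d: "d \<ge> 0"
  shows "(1 - exp (- d)) ^ n * norm h \<le> norm (mul (\<lambda>z. D d z ^ n) h)"
proof (induction n)
  case 0
  have "mul (\<lambda>z. 1) h = h" by (rule mul_eqI) (simp_all add: Hinf_const)
  then show ?case by simp
next
  case (Suc n)
  define x where "x = mul (\<lambda>z. D d z ^ n) h"
  have "(1 - exp (- d)) ^ Suc n * norm h \<le> (1 - exp (- d)) * norm x"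
    using Suc d mult_left_mono[OF Suc, of "1 - exp (- d)"] by (simp add: x_def mult.assoc)
  also have "\<dots> = norm (mul (psi d) x) - norm (exp (- d) *\<^sub>R x)"
    by (simp add: norm_mul_inner[OF inner_fun_psi[OF d]] algebra_simps)
  also have "\<dots> \<le> norm (mul (psi d) x - exp (- d) *\<^sub>R x)" by (rule norm_triangle_ineq2)
  also have "\<dots> = norm (mul (\<lambda>z. D d z ^ Suc n) h)"
    unfolding x_def mul_D[OF d, symmetric] mul_mul[OF D_Hinf[OF d] Hinf_power[OF D_Hinf[OF d]]] by simp
  finally show ?case .
qed

text \<open>Multiplying by $(\psi_d - e^{-d})^m$ produces a zero of order $m$ at the origin, where the
  Hankel operator is small, at the price of the factors $2^m$ and $(1 - e^{-d})^m$ only. This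
  replaces the Fredholm argument and gives injectivity and closed range at once.\<close>

lemma proj_psi_bounded_below:
  assumes c: "c > 0"
  shows "\<exists>\<kappa>>0. \<forall>h. \<kappa> * norm h \<le> norm (proj E (mul (psi c) h))"
proof -
  obtain m where m: "\<And>y. infdist (mul (psi (c/2)) (mul (\<lambda>z. z ^ m) y)) E \<le> 1/2 * norm y"
    using small[of "c/2" "1/2"] c by auto
  \<comment> \<open>Chosen so that c/2 + (m + 1) d = c: the m factors use up m d, and the last d is
    filled by \<open>proj_psi_mono\<close>.\<close>
  define d where "d = c / (2 * (real m + 1))"
  have d: "d > 0" using c by (simp add: d_def)
  have md: "c - (c/2 + real m * d) = d" using c by (simp add: d_def field_simps)
  define \<kappa> where "\<kappa> = (1 - exp (- d)) ^ m / 2 ^ Suc m"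
  have "\<kappa> * norm h \<le> norm (proj E (mul (psi c) h))" for h
  proof -
    define x where "x = mul (\<lambda>z. D d z ^ m) h"
    define v where "v = mul (psi (c/2)) x"
    obtain y where y: "x = mul (\<lambda>z. z ^ m) y" using D_power_vanishes[of d m h] d by (auto simp: x_def)
    have "inner_fun (\<lambda>z. z ^ m)"
      by (induction m) (auto simp: inner_fun_one intro: inner_fun_mult inner_fun_id)
    then have ny: "norm y = norm x" by (simp add: y norm_mul_inner)
    have nv: "norm v = norm x" using c by (simp add: v_def norm_mul_inner inner_fun_psi)
    have "norm (v - proj E v) \<le> 1/2 * norm x"
      using m[of y] unfolding infdist_eq_norm_diff_proj[OF E] ny by (simp add: v_def y)
    from power_mono[OF this, of 2] have "(norm (v - proj E v))\<^sup>2 \<le> (norm x)\<^sup>2 / 4"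
      by (simp add: power_mult_distrib power2_eq_square)
    \<comment> \<open>A distance of at most |x|/2 leaves 3/4 of the squared norm for the projection;
      the weaker 1/4 suffices and gives the clean bound |x|/2.\<close>
    with proj_pythagoras[OF E, of v] have "(norm x)\<^sup>2 / 4 \<le> (norm (proj E v))\<^sup>2"
      unfolding nv using zero_le_power2[of "norm x"] by linarith
    then have "(norm x / 2)\<^sup>2 \<le> (norm (proj E v))\<^sup>2" by (simp add: power_divide)
    then have "norm x / 2 \<le> norm (proj E v)" by (rule power2_le_imp_le) simp
    also have "\<dots> \<le> 2 ^ m * norm (proj E (mul (psi (c/2 + real m * d)) h))"
      unfolding v_def x_def using c d by (intro proj_psi_D_power) auto
    also have "\<dots> \<le> 2 ^ m * norm (proj E (mul (psi (c/2 + real m * d + d)) h))"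
      using c d by (intro mult_left_mono proj_psi_mono) auto
    also have "c/2 + real m * d + d = c" using md by simp
    finally have "norm x / 2 \<le> 2 ^ m * norm (proj E (mul (psi c) h))" .
    moreover have "(1 - exp (- d)) ^ m * norm h \<le> norm x"
      unfolding x_def using d by (intro norm_D_power_ge) simp
    ultimately have "(1 - exp (- d)) ^ m * norm h \<le> 2 ^ Suc m * norm (proj E (mul (psi c) h))"
      by simp
    then show ?thesis by (simp add: \<kappa>_def field_simps)
  qed
  moreover have "\<kappa> > 0" using d by (simp add: \<kappa>_def)
  ultimately show ?thesis by blast
qed

lemma psi_orth_imp_zero:
  assumes c: "c > 0" and orth: "\<And>k. cinner (mul (psi c) h) (mul B k) = 0"
  shows "h = 0"
proof -
  obtain \<kappa> where \<kappa>: "\<kappa> > 0" "\<kappa> * norm h \<le> norm (proj E (mul (psi c) h))"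
    using proj_psi_bounded_below[OF c] by blast
  have "proj E (mul (psi c) h) = 0"
    by (rule proj_unique[OF E]) (use orth Re_cinner subspace_0[OF E(1)] in \<open>auto simp flip: Re_cinner\<close>)
  with \<kappa> show ?thesis by (simp add: mult_le_0_iff)
qed

text \<open>In operator terms, the Toeplitz operator with symbol conj(psi_c) B is onto. A lower
  bound \<kappa> for P_E on psi_c H^2 becomes, by Pythagoras, an upper bound sqrt (1 - \<kappa>^2) <
  1 for the relative distance to E, as \<open>almost_contained_subspace_onto\<close>
  requires.\<close>

lemma psi_onto:
  assumes c: "c > 0"
  shows "\<exists>k. \<forall>x. cinner (mul B k) (mul (psi c) x) = cinner y x"
proof -
  let ?F = "range (mul (psi c))"
  have psi: "inner_fun (psi c)" "psi c \<in> Hinf" using c by (auto intro: inner_fun_psi psi_Hinf)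
  obtain \<kappa> where \<kappa>: "\<kappa> > 0" "\<And>h. \<kappa> * norm h \<le> norm (proj E (mul (psi c) h))"
    using proj_psi_bounded_below[OF c] by blast
  \<comment> \<open>The maximum spares a separate argument that \<kappa> \<le> 1.\<close>
  define \<rho> where "\<rho> = sqrt (max 0 (1 - \<kappa>\<^sup>2))"
  have "\<exists>e\<in>E. \<forall>f\<in>?F. inner (e - mul (psi c) y) f = 0"
  proof (rule almost_contained_subspace_onto[OF E])
    show "subspace ?F" "closed ?F" by (auto intro: subspace_range_mul closed_range_mul psi)
    show "0 \<le> \<rho>" "\<rho> < 1" using \<kappa>(1) by (auto simp: \<rho>_def max_def)
    show "norm (x - proj E x) \<le> \<rho> * norm x" if "x \<in> ?F" for x
    proof -
      obtain h where h: "x = mul (psi c) h" using \<open>x \<in> ?F\<close> by blast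
      have nx: "norm x = norm h" by (simp add: h norm_mul_inner psi)
      have "(\<kappa> * norm x)\<^sup>2 \<le> (norm (proj E x))\<^sup>2"
        using \<kappa> by (intro power_mono) (auto simp: h norm_mul_inner psi)
      with proj_pythagoras[OF E, of x] have "(norm (x - proj E x))\<^sup>2 \<le> (1 - \<kappa>\<^sup>2) * (norm x)\<^sup>2"
        by (simp add: power_mult_distrib algebra_simps)
      also have "\<dots> \<le> max 0 (1 - \<kappa>\<^sup>2) * (norm x)\<^sup>2" by (intro mult_right_mono) auto
      also have "\<dots> = (\<rho> * norm x)\<^sup>2" by (simp add: \<rho>_def power_mult_distrib)
      finally show ?thesis by (rule power2_le_imp_le) (simp add: \<rho>_def)
    qed
  qed simp
  then obtain k where k: "\<And>f. f \<in> ?F \<Longrightarrow> inner (mul B k - mul (psi c) y) f = 0" by auto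
  have "cinner (mul B k - mul (psi c) y) (mul (psi c) x) = 0" for x
    by (rule cinner_eq_0_of_orth_range[OF psi(2) k])
  then have "cinner (mul B k) (mul (psi c) x) = cinner y x" for x
    by (simp add: cinner_diff_left cinner_mul_inner[OF psi(1)])
  then show ?thesis by blast
qed

text \<open>Put h = (1 - conj(\<gamma>) psi_a) h1 and k = (1 - conj(\<gamma>) psi_a) k'. Then A h =
  (psi_a - \<gamma>) h1, and isometry of psi_a gives <psi_a h1, B k> = <A h, B k'> = 0 for every k,
  which reduces the claim to psi_a.\<close>

lemma frostman_orth_imp_zero:
  assumes a: "a > 0" and \<gamma>: "cmod \<gamma> < 1"
    and orth: "\<And>k. cinner (mul (frostman_shift (psi a) \<gamma>) h) (mul B k) = 0"
  shows "h = 0"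
proof -
  let ?N = "\<lambda>z. 1 - cnj \<gamma> * psi a z" and ?I = "\<lambda>z. 1 / (1 - cnj \<gamma> * psi a z)"
  note N = frostman_shift_denominator[OF less_imp_le[OF a] \<gamma>]
  have p: "inner_fun (psi a)" "psi a \<in> Hinf" using a by (auto intro: inner_fun_psi psi_Hinf)
  have A: "frostman_shift (psi a) \<gamma> = (\<lambda>z. (psi a z - \<gamma>) * ?I z)"
    by (simp add: frostman_shift_def fun_eq_iff)
  have AH: "frostman_shift (psi a) \<gamma> \<in> Hinf"
    unfolding A by (intro Hinf_mult Hinf_diff p N Hinf_const)
  define h1 where "h1 = mul ?I h"
  have Ah: "mul (frostman_shift (psi a) \<gamma>) h = mul (psi a) h1 - scC \<gamma> h1"
    by (rule mul_eqI[OF AH]) (simp add: A h1_def ev_mul N p algebra_simps diff_divide_distrib)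
  have "cinner (mul (psi a) h1) (mul B k) = 0" for k
  proof -
    define k' where "k' = mul ?I k"
    have k: "mul B k = mul B k' - scC (cnj \<gamma>) (mul (psi a) (mul B k'))"
    proof (rule mul_eqI[OF HB])
      have alg: "b * t = b * (1 / (1 - g * p) * t) - g * (p * (b * (1 / (1 - g * p) * t)))"
        if "1 - g * p \<noteq> 0" for b t g p :: complex
      proof -
        define s where "s = 1 / (1 - g * p)"
        have "s * (1 - g * p) = 1" using that by (simp add: s_def)
        then have "b * t = b * t * (s * (1 - g * p))" by simp
        also have "\<dots> = b * (s * t) - g * (p * (b * (s * t)))" by (simp add: algebra_simps)
        finally show ?thesis unfolding s_def .
      qed
      show "B z * ev k z = ev (mul B k' - scC (cnj \<gamma>) (mul (psi a) (mul B k'))) z" if "cmod z < 1" for z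
        unfolding ev_diff ev_scC k'_def ev_mul[OF HB] ev_mul[OF p(2)] ev_mul[OF N(2)] by (rule alg[OF N(3)[OF that]])
    qed
    have "cinner (mul (psi a) h1) (mul B k) = cinner (mul (psi a) h1 - scC \<gamma> h1) (mul B k')"
      unfolding k cinner_diff_right cinner_diff_left cinner_scC_left cinner_scC_right cinner_mul_inner[OF p(1)] by simp
    also have "\<dots> = 0" unfolding Ah[symmetric] by (rule orth)
    finally show ?thesis .
  qed
  from psi_orth_imp_zero[OF a this] have "h1 = 0" .
  then have "mul ?N h1 = 0" by (intro mul_eqI) (simp_all add: N)
  moreover have "mul ?N h1 = h" by (rule mul_eqI) (use N in \<open>simp_all add: h1_def ev_mul\<close>)
  ultimately show ?thesis by simp
qed

text \<open>This is the infinite dimension in finite portions: for each n, independent elements of E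
  orthogonal to A H^2. They come from n orthogonal layers between H^2 and psi_c H^2, lifted by
  \<open>psi_onto\<close> and then divided by 1 - conj(\<gamma>) psi_a.\<close>

lemma frostman_orth_family:
  assumes a: "a > 0" and \<gamma>: "cmod \<gamma> < 1"
  shows "\<exists>f :: nat \<Rightarrow> hardy. (\<forall>j<n. f j \<in> E \<and> (\<forall>x. cinner (f j) (mul (frostman_shift (psi a) \<gamma>) x) = 0)) \<and>
     (\<forall>\<alpha>. (\<Sum>j<n. scC (\<alpha> j) (f j)) = 0 \<longrightarrow> (\<forall>j<n. \<alpha> j = 0))"
proof (cases "n = 0")
  case False
  define c where "c = a / 2"
  \<comment> \<open>The chain of subspaces psi_(j d) H^2, for j from 0 to n, descends from H^2 to
    psi_c H^2 and has n gaps.\<close>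
  define d where "d = c / real n"
  have c: "c > 0" and d: "d > 0" using a False by (auto simp: c_def d_def)
  have psi: "inner_fun (psi s)" "psi s \<in> Hinf" if "s \<ge> 0" for s
    using that by (auto intro: inner_fun_psi psi_Hinf)
  \<comment> \<open>The projection of 1 to the complement of psi_d H^2, that is, its reproducing
    kernel 1 - conj(psi_d(0)) psi_d at the origin.\<close>
  define w where "w = kern 0 - scC (of_real (exp (- d))) (mul (psi d) (kern 0))"
  define y where "y j = mul (psi (real j * d)) w" for j
  have w_orth: "cinner w (mul (psi s) x) = 0" if s: "s \<ge> d" for s x
  proof -
    have "cinner w (mul (psi d) x') = 0" for x'
    proof -
      have "cinner (kern 0) z = cnj (ev z 0)" for z by (subst cinner_commute) (simp add: cinner_kern)
      then show ?thesis
        using d unfolding w_def cinner_diff_left cinner_scC_left cinner_mul_inner[OF psi(1)[OF less_imp_le[OF d]]]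
        by (simp add: ev_mul psi psi_0)
    qed
    from this[of "mul (psi (s - d)) x"] show ?thesis using d s by (simp add: mul_psi_psi)
  qed
  have w0: "cinner w w \<noteq> 0"
  proof -
    have "ev w 0 = of_real (1 - exp (- d) * exp (- d))" using d by (simp add: w_def ev_mul psi psi_0)
    moreover have "exp (- d) * exp (- d) < 1" using d by (simp add: exp_add[symmetric])
    ultimately have "w \<noteq> 0" by (metis ev_zero of_real_eq_0_iff less_irrefl right_minus_eq)
    then show ?thesis by (simp add: cinner_self)
  qed
  have y_lt: "cinner (y i) (y j) = 0" if "i < j" for i j
  proof -
    have jd: "real j * d = real i * d + real (j - i) * d" using that by (simp add: of_nat_diff algebra_simps)
    have "y j = mul (psi (real i * d)) (mul (psi (real (j - i) * d)) w)"
      unfolding y_def jd using d by (subst mul_psi_psi) auto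
    then have "cinner (y i) (y j) = cinner w (mul (psi (real (j - i) * d)) w)"
      using d by (simp add: y_def cinner_mul_inner[OF psi(1)])
    also have "\<dots> = 0" using that d by (intro w_orth) simp
    finally show ?thesis .
  qed
  have y_orth: "cinner (y i) (y j) = (if i = j then cinner w w else 0)" for i j
  proof (cases i j rule: linorder_cases)
    case equal
    then show ?thesis using d by (simp add: y_def cinner_mul_inner[OF psi(1)])
  next
    case greater
    then show ?thesis using y_lt[OF greater] by (subst cinner_commute) simp
  qed (simp add: y_lt)
  \<comment> \<open>The bound j < n matters here: (j + 1) d \<le> c leaves at least one factor psi_d
    against which w is orthogonal.\<close>
  have y_K: "cinner (y j) (mul (psi c) x) = 0" if j: "j < n" for j x
  proof -
    have ge: "c - real j * d \<ge> d"
    proof -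
      have "real (Suc j) * d \<le> real n * d" using j d by (intro mult_right_mono) auto
      moreover have "real n * d = c" using False by (simp add: d_def)
      ultimately show ?thesis by (simp add: algebra_simps)
    qed
    have "mul (psi c) x = mul (psi (real j * d)) (mul (psi (c - real j * d)) x)"
      using ge d by (subst mul_psi_psi) auto
    then have "cinner (y j) (mul (psi c) x) = cinner w (mul (psi (c - real j * d)) x)"
      using d by (simp add: y_def cinner_mul_inner[OF psi(1)])
    then show ?thesis using w_orth[OF ge] by simp
  qed
  have "\<forall>j. \<exists>k. \<forall>x. cinner (mul B k) (mul (psi c) x) = cinner (y j) x" using psi_onto[OF c] by blast
  then obtain k where k: "\<And>j x. cinner (mul B (k j)) (mul (psi c) x) = cinner (y j) x" by metis
  define e where "e j = mul B (k j)" for j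
  have e_psi: "cinner (e j) (mul (psi a) x) = 0" if "j < n" for j x
  proof -
    have "mul (psi a) x = mul (psi c) (mul (psi c) x)" using c by (simp add: mul_psi_psi) (simp add: c_def)
    then show ?thesis using k y_K[OF that] by (simp add: e_def)
  qed
  let ?N = "\<lambda>z. 1 - cnj \<gamma> * psi a z" and ?I = "\<lambda>z. 1 / (1 - cnj \<gamma> * psi a z)"
  note N = frostman_shift_denominator[OF less_imp_le[OF a] \<gamma>]
  note pa = psi[OF less_imp_le[OF a]]
  have A: "frostman_shift (psi a) \<gamma> = (\<lambda>z. (psi a z - \<gamma>) * ?I z)"
    by (simp add: frostman_shift_def fun_eq_iff)
  have AH: "frostman_shift (psi a) \<gamma> \<in> Hinf"
    unfolding A by (intro Hinf_mult Hinf_diff pa N Hinf_const)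
  define f where "f j = mul ?I (e j)" for j
  have Nf: "mul ?N (f j) = e j" for j
    by (rule mul_eqI) (use N in \<open>simp_all add: f_def ev_mul\<close>)
  have Nf': "e j = f j - scC (cnj \<gamma>) (mul (psi a) (f j))" for j
    unfolding Nf[of j, symmetric] by (rule mul_eqI) (simp_all add: N ev_mul pa algebra_simps)
  have "f j \<in> E" for j
    unfolding f_def e_def mul_commute[OF N(2) HB] by blast
  moreover have "cinner (f j) (mul (frostman_shift (psi a) \<gamma>) x) = 0" if "j < n" for j x
  proof -
    define x1 where "x1 = mul ?I x"
    have "mul (frostman_shift (psi a) \<gamma>) x = mul (psi a) x1 - scC \<gamma> x1"
      by (rule mul_eqI[OF AH]) (simp add: A x1_def ev_mul N pa algebra_simps diff_divide_distrib)
    \<comment> \<open>Isometry replaces <f_j, x1> by <psi_a f_j, psi_a x1>, which assembles e_j = (1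
      - conj(\<gamma>) psi_a) f_j in the first slot.\<close>
    then have "cinner (f j) (mul (frostman_shift (psi a) \<gamma>) x) =
        cinner (f j) (mul (psi a) x1) - cnj \<gamma> * cinner (mul (psi a) (f j)) (mul (psi a) x1)"
      by (simp add: cinner_diff_right cinner_scC_right cinner_mul_inner[OF pa(1)])
    also have "\<dots> = cinner (e j) (mul (psi a) x1)"
      unfolding Nf'[of j] by (simp add: cinner_diff_left cinner_scC_left)
    finally show ?thesis using e_psi[OF that] by simp
  qed
  moreover have "\<alpha> i = 0" if sum0: "(\<Sum>j<n. scC (\<alpha> j) (f j)) = 0" and i: "i < n" for \<alpha> i
  proof -
    have add: "cinner (\<Sum>j\<in>A. g j) z = (\<Sum>j\<in>A. cinner (g j) z)" for g :: "nat \<Rightarrow> hardy" and A z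
      by (induction A rule: infinite_finite_induct) (auto simp: cinner_add_left)
    have madd: "mul ?N (\<Sum>j\<in>A. g j) = (\<Sum>j\<in>A. mul ?N (g j))" for g :: "nat \<Rightarrow> hardy" and A
      by (rule linear_sum[OF bounded_linear.linear[OF bounded_linear_mul[OF N(1)]]])
    have "0 = mul ?N (\<Sum>j<n. scC (\<alpha> j) (f j))"
      unfolding sum0 by (rule mul_eqI[symmetric]) (simp_all add: N)
    also have "\<dots> = (\<Sum>j<n. scC (\<alpha> j) (e j))"
      unfolding madd mul_scC[OF N(1)] Nf ..
    \<comment> \<open>Pairing with psi_c y_i isolates the coefficient of index i, because <e_j,
      psi_c y_i> = <y_j, y_i>.\<close>
    finally have "0 = cinner (\<Sum>j<n. scC (\<alpha> j) (e j)) (mul (psi c) (y i))" by simp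
    also have "\<dots> = (\<Sum>j<n. \<alpha> j * (if j = i then cinner w w else 0))"
      unfolding add cinner_scC_left e_def k y_orth ..
    also have "\<dots> = \<alpha> i * cinner w w" using i by (simp add: if_distrib cong: if_cong)
    finally show ?thesis using w0 by simp
  qed
  ultimately show ?thesis by (intro exI[of _ f]) auto
qed auto

end

subsection \<open>Function spaces and geodesics\<close>

lemma scaleF_ev: "scaleF c (ev x) = ev (scC c x)"
  by (simp add: scaleF_def fun_eq_iff)

lemma ev_plus: "ev x + ev y = ev (x + y)"
  by (simp add: fun_eq_iff)

lemma ev_minus: "ev x - ev y = ev (x - y)"
  by (simp add: fun_eq_iff)

lemma ev_0: "ev 0 = 0"
  by (simp add: fun_eq_iff)

lemma ev_sum: "(\<Sum>i\<in>A. ev (f i)) = ev (\<Sum>i\<in>A. f i)"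
  by (induction A rule: infinite_finite_induct) (simp_all add: ev_0 ev_plus)

lemma inj_ev: "ev x = ev y \<longleftrightarrow> x = y"
  using ev_eqI by metis

lemma ev_in_vanishing: "ev x \<in> vanishing_subspace W \<longleftrightarrow> (\<forall>w\<in>W. ev x w = 0)"
  by (simp add: vanishing_subspace_def ev_in_H2)

lemma ev_in_orth:
  assumes "S \<subseteq> H2"
  shows "ev x \<in> h2_orth S \<longleftrightarrow> (\<forall>y. ev y \<in> S \<longrightarrow> cinner x y = 0)"
  using assms unfolding h2_orth_def H2_eq_range_ev by (auto simp: h2_inner_ev)

lemma h2_lim_ev: "h2_lim (\<lambda>n. ev (X n)) (ev x) \<longleftrightarrow> X \<longlonglongrightarrow> x"
  by (simp add: h2_lim_def ev_in_H2 ev_minus h2_norm_ev LIM_zero_iff tendsto_norm_zero_iff)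

lemma vanishing_subspace_in_Gr: "vanishing_subspace W \<in> Gr_H2"
  unfolding Gr_H2_def mem_Collect_eq
proof (intro conjI allI impI)
  let ?V = "vanishing_subspace W"
  show sub: "?V \<subseteq> H2" by (auto simp: vanishing_subspace_def)
  show "cfun.subspace ?V"
  proof (rule cfun.subspaceI)
    show "0 \<in> ?V" unfolding ev_0[symmetric] ev_in_vanishing by simp
    fix f g assume "f \<in> ?V" "g \<in> ?V"
    with sub obtain x y where "f = ev x" "g = ev y" unfolding H2_eq_range_ev by blast
    with \<open>f \<in> ?V\<close> \<open>g \<in> ?V\<close> show "f + g \<in> ?V" by (simp add: ev_plus ev_in_vanishing)
  next
    fix c f assume "f \<in> ?V"
    with sub obtain x where "f = ev x" unfolding H2_eq_range_ev by blast
    with \<open>f \<in> ?V\<close> show "scaleF c f \<in> ?V" by (simp add: scaleF_ev ev_in_vanishing)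
  qed
  fix s f assume *: "(\<forall>n. s n \<in> ?V) \<and> h2_lim s f"
  then obtain x where x: "f = ev x" unfolding h2_lim_def H2_eq_range_ev by auto
  have "\<forall>n. \<exists>y. s n = ev y" using * sub unfolding H2_eq_range_ev by blast
  then obtain X where "\<And>n. s n = ev (X n)" by metis
  then have X: "s = (\<lambda>n. ev (X n))" by auto
  have lim: "X \<longlonglongrightarrow> x" using * by (simp add: x X h2_lim_ev)
  have "ev x w = 0" if "w \<in> W" for w
  proof (rule LIMSEQ_unique[OF ev_tendsto[OF lim]])
    show "(\<lambda>n. ev (X n) w) \<longlonglongrightarrow> 0" using * that by (simp add: X ev_in_vanishing)
  qed
  then show "f \<in> ?V" by (simp add: x ev_in_vanishing)
qed

lemma cinner_sums_left:
  assumes "g sums x" shows "(\<lambda>n. cinner (g n) z) sums cinner x z"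
proof -
  have "cinner (\<Sum>j\<in>A. g j) z = (\<Sum>j\<in>A. cinner (g j) z)" for A
    by (induction A rule: infinite_finite_induct) (auto simp: cinner_add_left)
  then show ?thesis using cinner_tendsto_left[of "\<lambda>N. \<Sum>n<N. g n" x sequentially z] assms by (simp add: sums_def)
qed

lemma cinner_sums_right:
  assumes "g sums x" shows "(\<lambda>n. cinner z (g n)) sums cinner z x"
  using sums_cnj[THEN iffD2, OF cinner_sums_left[OF assms, of z]] by (simp add: cinner_commute[of _ z, symmetric] flip: cinner_commute)

text \<open>With $e^{iX} = \cos X + i \sin X$, the cosine preserves the decomposition given by $S$ and the
  sine exchanges the summands. If $e^{iX} s \perp S$ then $\cos X\, s = 0$, whence
  $\langle s, e^{iX} s'\rangle = \langle \cos X\, s, s'\rangle = 0$ for $s' \in S$.\<close>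

lemma geodesic_orth_transfer:
  assumes geo: "geodesic_joining \<delta> S T" and S: "S \<subseteq> H2"
    and f: "f \<in> h2_orth S" "f \<in> T" "f \<noteq> 0"
  shows "\<exists>s. s \<in> S \<and> s \<in> h2_orth T \<and> s \<noteq> 0"
proof -
  obtain X where X: "h2_bounded_operator X" "h2_selfadjoint X" "X ` S \<subseteq> h2_orth S" "X ` h2_orth S \<subseteq> S"
    and T: "h2_exp (\<lambda>f. scaleF \<i> (X f)) ` S = T"
    using geo unfolding geodesic_joining_def by blast
  \<comment> \<open>The operator X transported to coefficient sequences.\<close>
  define Y where "Y x = inv ev (X (ev x))" for x
  have evY: "X (ev x) = ev (Y x)" for x
  proof -
    have "X (ev x) \<in> range ev"
      using X(1) ev_in_H2[of x] unfolding h2_bounded_operator_def H2_eq_range_ev[symmetric] by blast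
    then show ?thesis by (simp add: Y_def f_inv_into_f)
  qed
  have Y_scC: "Y (scC c x) = scC c (Y x)" for c x
  proof -
    have "X (scaleF c (ev x)) = scaleF c (X (ev x))"
      using X(1) ev_in_H2[of x] unfolding h2_bounded_operator_def by blast
    then show ?thesis by (simp add: scaleF_ev evY inj_ev)
  qed
  obtain M where "\<And>f. f \<in> H2 \<Longrightarrow> h2_norm (X f) \<le> M * h2_norm f"
    using X(1) unfolding h2_bounded_operator_def by blast
  from this[OF ev_in_H2] have "norm (Y x) \<le> M * norm x" for x by (simp add: evY h2_norm_ev)
  then have Y_norm: "norm (Y x) \<le> \<bar>M\<bar> * norm x" for x
    using mult_right_mono[OF abs_ge_self[of M] norm_ge_zero[of x]] order_trans by blast
  have Y_sa: "cinner (Y x) y = cinner x (Y y)" for x y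
    using X(2) ev_in_H2 unfolding h2_selfadjoint_def by (metis evY h2_inner_ev)
  define S' where "S' = {x. ev x \<in> S}"
  define P where "P = {x. \<forall>y\<in>S'. cinner x y = 0}"
  have P_iff: "x \<in> P \<longleftrightarrow> ev x \<in> h2_orth S" for x
    by (simp add: P_def S'_def ev_in_orth[OF S])
  have YS: "Y x \<in> P" if "x \<in> S'" for x
    using X(3) that by (auto simp: P_iff S'_def simp flip: evY)
  have YP: "Y x \<in> S'" if "x \<in> P" for x
    using X(4) that by (auto simp: P_iff S'_def simp flip: evY)
  \<comment> \<open>Even powers of X preserve S and odd powers carry it into its complement, so the
    even and odd halves of the exponential series can be treated apart.\<close>
  have even_odd: "(even n \<longrightarrow> (Y ^^ n) x \<in> S') \<and> (odd n \<longrightarrow> (Y ^^ n) x \<in> P)" if "x \<in> S'" for n x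
    by (induction n) (use that YS YP in auto)
  note even_S = even_odd[THEN conjunct1, rule_format] and odd_P = even_odd[THEN conjunct2, rule_format]
  have Yn_sa: "cinner ((Y ^^ n) x) y = cinner x ((Y ^^ n) y)" for n x y
    by (induction n arbitrary: x y) (simp_all add: Y_sa funpow_swap1)
  have Yn_norm: "norm ((Y ^^ n) x) \<le> \<bar>M\<bar> ^ n * norm x" for n x
  proof (induction n)
    case (Suc n)
    have "norm ((Y ^^ Suc n) x) \<le> \<bar>M\<bar> * norm ((Y ^^ n) x)" using Y_norm by simp
    also have "\<dots> \<le> \<bar>M\<bar> * (\<bar>M\<bar> ^ n * norm x)" by (intro mult_left_mono Suc) simp
    finally show ?case by (simp add: mult.assoc)
  qed simp
  define t where "t x n = scC (\<i> ^ n / fact n) ((Y ^^ n) x)" for x n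
  have t_norm: "norm (t x n) \<le> \<bar>M\<bar> ^ n / fact n * norm x" for x n
    using Yn_norm[of n x] by (simp add: t_def norm_scC norm_divide norm_power field_simps)
  have dom: "summable (\<lambda>n. \<bar>M\<bar> ^ n / fact n * norm x)" for x
    using summable_exp_generic[of "\<bar>M\<bar>"] by (intro summable_mult2) (simp add: field_simps)
  have summ: "summable (\<lambda>n. if Q n then t x n else 0)" for Q x
  proof (rule summable_comparison_test'[OF dom[of x]])
    show "norm (if Q n then t x n else 0) \<le> \<bar>M\<bar> ^ n / fact n * norm x" for n
      using t_norm[of x n] order_trans[OF norm_ge_zero t_norm[of x n]]
      by (cases "Q n") (simp_all only: if_True if_False norm_zero)
  qed
  \<comment> \<open>The even part of the series is cos X, the odd part \<open>Z\<close> is i sin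
    X.\<close>
  define C where "C x = (\<Sum>n. if even n then t x n else 0)" for x
  define Z where "Z x = (\<Sum>n. if odd n then t x n else 0)" for x
  have C: "(\<lambda>n. if even n then t x n else 0) sums C x" for x
    unfolding C_def by (intro summable_sums summ)
  have Z: "(\<lambda>n. if odd n then t x n else 0) sums Z x" for x
    unfolding Z_def by (intro summable_sums summ)
  have t_sums: "t x sums (C x + Z x)" for x
  proof -
    have "(\<lambda>n. (if even n then t x n else 0) + (if odd n then t x n else 0)) = t x" by (rule ext) simp
    then show ?thesis using sums_add[OF C[of x] Z[of x]] by simp
  qed
  have pow: "((\<lambda>f. scaleF \<i> (X f)) ^^ n) (ev x) = ev (scC (\<i> ^ n) ((Y ^^ n) x))" for n x
    by (induction n) (simp_all add: scaleF_ev evY Y_scC del: ev_scC)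
  have exp: "h2_exp (\<lambda>f. scaleF \<i> (X f)) (ev x) = ev (C x + Z x)" for x
    unfolding h2_exp_def
  proof (rule the_equality)
    have part: "(\<lambda>N. \<Sum>n<N. scaleF (1 / fact n) (((\<lambda>f. scaleF \<i> (X f)) ^^ n) (ev x))) = (\<lambda>N. ev (\<Sum>n<N. t x n))"
      by (simp add: pow scaleF_ev ev_sum t_def mult.commute)
    show "h2_lim (\<lambda>N. \<Sum>n<N. scaleF (1 / fact n) (((\<lambda>f. scaleF \<i> (X f)) ^^ n) (ev x))) (ev (C x + Z x))"
      unfolding part h2_lim_ev using t_sums by (simp add: sums_def)
    fix g assume g: "h2_lim (\<lambda>N. \<Sum>n<N. scaleF (1 / fact n) (((\<lambda>f. scaleF \<i> (X f)) ^^ n) (ev x))) g"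
    then obtain y where y: "g = ev y" unfolding h2_lim_def H2_eq_range_ev by blast
    from g have "(\<lambda>N. \<Sum>n<N. t x n) \<longlonglongrightarrow> y" unfolding part y h2_lim_ev .
    with t_sums[of x] show "g = ev (C x + Z x)" unfolding y sums_def using LIMSEQ_unique by blast
  qed
  have T_eq: "T = (\<lambda>x. ev (C x + Z x)) ` S'"
  proof -
    have "S = ev ` S'" using S unfolding S'_def H2_eq_range_ev by blast
    then show ?thesis using T by (simp add: image_image exp)
  qed
  then have "T \<subseteq> H2" by (auto simp: ev_in_H2)
  obtain s where s: "s \<in> S'" "f = ev (C s + Z s)" using f(2) T_eq by auto
  have U: "C s + Z s \<in> P" using f(1) unfolding P_iff s(2) .
  have Z_P: "cinner (Z x) y = 0" if "x \<in> S'" "y \<in> S'" for x y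
  proof -
    have "cinner (if odd n then t x n else 0) y = 0" for n
      using odd_P[OF that(1), of n] that(2) by (simp add: t_def cinner_scC_left P_def)
    then show ?thesis using cinner_sums_left[OF Z[of x], of y] by (simp add: sums_iff)
  qed
  have CP: "cinner (C s) y = 0" if "y \<in> S'" for y
  proof -
    have "cinner (C s + Z s) y = 0" using U that unfolding P_def by blast
    then show ?thesis by (simp add: cinner_add_left Z_P[OF s(1) that])
  qed
  \<comment> \<open>C s is orthogonal to S and is tested here against the terms of its own series,
    each of which lies in S.\<close>
  have "cinner (C s) (C s) = 0"
  proof -
    have "cinner (C s) (if even n then t s n else 0) = 0" for n
      using CP[OF even_S[OF s(1)], of n] by (simp add: t_def cinner_scC_right)
    then show ?thesis using cinner_sums_right[OF C[of s], of "C s"] by (simp add: sums_iff)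
  qed
  then have C0: "C s = 0" by (simp add: cinner_self)
  have "cinner s (C y + Z y) = 0" if y: "y \<in> S'" for y
  proof -
    have "cinner s (Z y) = 0" by (subst cinner_commute) (simp add: Z_P y s(1))
    moreover have "cinner s (C y) = cinner (C s) y"
    proof (rule sums_unique2[OF cinner_sums_right[OF C]])
      have "cinner s (if even n then t y n else 0) = cinner (if even n then t s n else 0) y" for n
        by (auto simp: t_def cinner_scC_left cinner_scC_right Yn_sa elim!: evenE)
      then show "(\<lambda>n. cinner s (if even n then t y n else 0)) sums cinner (C s) y"
        using cinner_sums_left[OF C[of s], of y] by simp
    qed
    ultimately show ?thesis by (simp add: C0 cinner_add_right)
  qed
  then have "ev s \<in> h2_orth T"
    unfolding ev_in_orth[OF \<open>T \<subseteq> H2\<close>] unfolding T_eq by (auto simp: inj_ev)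
  moreover have "s \<noteq> 0"
  proof
    assume "s = 0"
    have "(Y ^^ n) 0 = 0" for n
      using Yn_norm[of n 0] unfolding norm_zero mult_zero_right norm_le_zero_iff .
    then have "t s n = 0" for n using \<open>s = 0\<close> by (auto simp: t_def intro: hardy_eqI)
    then have "t s = (\<lambda>_. 0)" by auto
    with t_sums[of s] have "(\<lambda>_. 0) sums (C s + Z s)" by simp
    then have "C s + Z s = 0" using sums_unique2[OF _ sums_zero] by blast
    then show False using f(3) s(2) ev_0 by simp
  qed
  then have "ev s \<noteq> 0" using inj_ev[of s 0] by (simp add: ev_0)
  ultimately show ?thesis using s(1) by (auto simp: S'_def)
qed

section \<open>Blaschke products in the form of \<open>is_blaschke_product\<close>\<close>

lemma is_blaschke_productE:
  assumes "is_blaschke_product B"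
  obtains c w K where "cmod c = 1" "\<forall>k\<in>K. w k \<in> unit_disk" "(\<lambda>k. 1 - cmod (w k)) summable_on K"
    "\<And>z. cmod z < 1 \<Longrightarrow> B z = c * bprod w K z"
  using assms unfolding is_blaschke_product_def bprod_def bfac_def by (auto simp: Ball_def)

lemma inner_fun_blaschke_product:
  assumes "is_blaschke_product B" shows "inner_fun B"
proof -
  obtain c w K where c: "cmod c = 1" and wK: "\<forall>k\<in>K. w k \<in> unit_disk" "(\<lambda>k. 1 - cmod (w k)) summable_on K"
    and B: "\<And>z. cmod z < 1 \<Longrightarrow> B z = c * bprod w K z"
    by (rule is_blaschke_productE[OF assms]) (rule that)
  have inn: "inner_fun (bprod w K)" by (rule inner_fun_bprod[OF wK])
  have le: "cmod (B z) \<le> 1" if "cmod z < 1" for z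
    using inn B[OF that] c that by (simp add: inner_fun_def norm_mult)
  have "B holomorphic_on unit_disk"
    by (rule holomorphic_transform[where f = "\<lambda>z. c * bprod w K z"])
      (use HinfD(1)[OF inner_fun_Hinf[OF inn]] B in \<open>auto intro!: holomorphic_intros\<close>)
  then have H: "B \<in> Hinf" by (rule HinfI) (rule le)
  have "mul B (kern 0) = scC c (mul (bprod w K) (kern 0))"
    by (rule mul_eqI[OF H]) (simp add: B ev_mul inner_fun_Hinf[OF inn])
  then show ?thesis using inn c by (simp add: inner_fun_def H le norm_scC)
qed

text \<open>The listing w may repeat a zero, so summability is first restricted to indices on which
  w is injective and then read as summability over the set of zeros.\<close>

lemma blaschke_product_zeros:
  assumes "is_blaschke_product B" shows "blaschke_condition {z \<in> unit_disk. B z = 0}"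
proof -
  obtain c w K where c: "cmod c = 1" and wK: "\<forall>k\<in>K. w k \<in> unit_disk" "(\<lambda>k. 1 - cmod (w k)) summable_on K"
    and B: "\<And>z. cmod z < 1 \<Longrightarrow> B z = c * bprod w K z"
    by (rule is_blaschke_productE[OF assms]) (rule that)
  have c0: "c \<noteq> 0" using c by auto
  have "{z \<in> unit_disk. B z = 0} \<subseteq> w ` K"
    using c0 by (auto simp: B bprod_eq_0_iff[OF wK])
  then obtain K' where K': "K' \<subseteq> K" "inj_on w K'" "{z \<in> unit_disk. B z = 0} = w ` K'"
    unfolding subset_image_inj by blast
  show ?thesis
    unfolding blaschke_condition_def K'(3) summable_on_reindex[OF K'(2)] o_def
    using wK(2) K'(1) by (rule summable_on_subset_banach)
qed

text \<open>By \<open>bprod_double_zero\<close> simple zeros make the listing injective, and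
  \<open>bprod_divides\<close> applies. Simplicity is phrased through the derivative, which is
  directly computable for the Frostman shift.\<close>

lemma blaschke_product_divides:
  assumes B: "is_blaschke_product B"
    and simple: "\<And>z. cmod z < 1 \<Longrightarrow> B z = 0 \<Longrightarrow> \<not> (B has_field_derivative 0) (at z)"
    and x: "\<And>z. cmod z < 1 \<Longrightarrow> B z = 0 \<Longrightarrow> ev x z = 0"
  shows "x \<in> range (mul B)"
proof -
  obtain c w K where c: "cmod c = 1" and wK: "\<forall>k\<in>K. w k \<in> unit_disk" "(\<lambda>k. 1 - cmod (w k)) summable_on K"
    and Bz: "\<And>z. cmod z < 1 \<Longrightarrow> B z = c * bprod w K z"
    by (rule is_blaschke_productE[OF B]) (rule that)
  have c0: "c \<noteq> 0" using c by auto
  have zero: "B (w k) = 0" "cmod (w k) < 1" if "k \<in> K" for k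
    using that wK(1) bprod_eq_0_iff[OF wK, of "w k"] by (auto simp: Bz)
  have "inj_on w K"
  proof (rule inj_onI, rule ccontr)
    fix i j assume ij: "i \<in> K" "j \<in> K" "w i = w j" "i \<noteq> j"
    have "(bprod w K has_field_derivative 0) (at (w i))"
      by (rule bprod_double_zero[OF wK ij(1,2,4,3)])
    from DERIV_cmult[OF this, of c] have "((\<lambda>z. c * bprod w K z) has_field_derivative 0) (at (w i))" by simp
    then have "(B has_field_derivative 0) (at (w i))"
      by (rule has_field_derivative_transform_within_open[of _ _ _ "ball 0 1"]) (use zero[OF ij(1)] Bz in auto)
    then show False using simple zero[OF ij(1)] by blast
  qed
  from bprod_divides[OF wK this, of x] x zero obtain y where y: "x = mul (bprod w K) y" by blast
  have "mul B (scC (1 / c) y) = x"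
    by (rule mul_eqI[OF inner_fun_Hinf[OF inner_fun_blaschke_product[OF B]]])
      (use c0 in \<open>simp add: y Bz ev_mul inner_fun_Hinf[OF inner_fun_bprod[OF wK]]\<close>)
  then show ?thesis by blast
qed

text \<open>Independence is stated for families, which also forces the members to be distinct; a
  family longer than a finite spanning set contradicts the exchange bound.\<close>

lemma cdim_infiniteI:
  assumes "\<And>n. \<exists>f :: nat \<Rightarrow> hardy. (\<forall>j<n. ev (f j) \<in> V) \<and>
     (\<forall>\<alpha>. (\<Sum>j<n. scC (\<alpha> j) (f j)) = 0 \<longrightarrow> (\<forall>j<n. \<alpha> j = 0))"
  shows "cdim V = \<infinity>"
proof -
  have False if S: "finite S" "V \<subseteq> cfun.span S" for S
  proof -
    define n where "n = Suc (card S)"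
    obtain f :: "nat \<Rightarrow> hardy" where f: "\<And>j. j < n \<Longrightarrow> ev (f j) \<in> V"
      and ind: "\<And>\<alpha>. (\<Sum>j<n. scC (\<alpha> j) (f j)) = 0 \<Longrightarrow> (\<forall>j<n. \<alpha> j = 0)"
      using assms[of n] by blast
    have inj: "inj_on (\<lambda>j. ev (f j)) {..<n}"
    proof (rule inj_onI, rule ccontr)
      fix i j assume ij: "i \<in> {..<n}" "j \<in> {..<n}" "ev (f i) = ev (f j)" "i \<noteq> j"
      \<comment> \<open>Coefficients 1 at i and -1 at j would be a nontrivial relation between equal
        members.\<close>
      have "(\<Sum>l<n. scC ((if l = i then 1 else 0) - (if l = j then 1 else 0)) (f l)) =
        (\<Sum>l<n. (if l = i then f l else 0) - (if l = j then f l else 0))"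
        by (intro sum.cong refl hardy_eqI) auto
      also have "\<dots> = 0" using ij by (simp add: sum_subtractf inj_ev)
      finally show False using ind ij(1,4) by fastforce
    qed
    let ?T = "(\<lambda>j. ev (f j)) ` {..<n}"
    have "cfun.independent ?T"
    proof (rule cfun.independent_if_scalars_zero)
      fix g h assume 0: "(\<Sum>h\<in>?T. scaleF (g h) h) = 0" and h: "h \<in> ?T"
      have "ev (\<Sum>j<n. scC (g (ev (f j))) (f j)) = ev 0"
        using 0 by (simp add: sum.reindex[OF inj] scaleF_ev ev_sum ev_0)
      then have "(\<Sum>j<n. scC (g (ev (f j))) (f j)) = 0" by (simp add: inj_ev)
      with ind[of "\<lambda>j. g (ev (f j))"] h show "g h = 0" by auto
    qed simp
    moreover have "?T \<subseteq> cfun.span S" using f S(2) by auto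
    ultimately have "card ?T \<le> card S" using cfun.independent_span_bound[OF S(1)] by blast
    then show False using card_image[OF inj] by (simp add: n_def)
  qed
  then show ?thesis by (auto simp: cdim_def)
qed

lemma cdim_zero: "cdim {0} = 0"
proof -
  have "{0} = cfun.span {}" by simp
  then have "cfun.dim {0} = 0" using cfun.dim_eq_card_independent[OF cfun.independent_empty] by (metis cfun.dim_span card.empty)
  moreover have "\<exists>S. finite S \<and> {0} \<subseteq> cfun.span S" by (rule exI[of _ "{}"]) simp
  ultimately show ?thesis by (simp add: cdim_def zero_enat_def)
qed

text \<open>Every branch of the logarithm of exp(L + i s) gives one value of the exponent of psi_a,
  and the Moebius map in the exponent is solved for z.\<close>

lemma psi_eq_iff:
  assumes a: "a > 0" and z: "z \<noteq> 1" and L: "L < 0"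
  shows "psi a z = exp (Complex L s) \<longleftrightarrow>
    (\<exists>k::int. z = (of_real (s + 2 * of_int k * pi) - \<i> * of_real (a + L)) / (of_real (s + 2 * of_int k * pi) + \<i> * of_real (a - L)))"
proof -
  have "psi a z = exp (Complex L s) \<longleftrightarrow> (\<exists>k::int. of_real a * ((z + 1) / (z - 1)) = Complex L (s + 2 * of_int k * pi))"
    unfolding psi_def exp_eq by (intro ex_cong1) (auto simp: complex_eq_iff algebra_simps)
  moreover have "of_real a * ((z + 1) / (z - 1)) = Complex L v \<longleftrightarrow>
      z = (of_real v - \<i> * of_real (a + L)) / (of_real v + \<i> * of_real (a - L))" for v
  proof -
    define W where "W = Complex L v"
    have W: "W = of_real L + \<i> * of_real v" by (simp add: W_def complex_eq_iff)
    have nz: "of_real v + \<i> * of_real (a - L) \<noteq> (0 :: complex)"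
      using a L by (auto simp: complex_eq_iff)
    have "of_real a * ((z + 1) / (z - 1)) = W \<longleftrightarrow> of_real a * (z + 1) = W * (z - 1)"
      using z by (simp add: field_simps)
    \<comment> \<open>Multiplication by -i makes the linear part of the denominator real, as in the
      prescribed form of the points.\<close>
    also have "\<dots> \<longleftrightarrow> - \<i> * (of_real a * (z + 1)) = - \<i> * (W * (z - 1))" by simp
    also have "\<dots> \<longleftrightarrow> z * (of_real v + \<i> * of_real (a - L)) = of_real v - \<i> * of_real (a + L)"
      unfolding W by (auto simp: complex_eq_iff algebra_simps)
    also have "\<dots> \<longleftrightarrow> z = (of_real v - \<i> * of_real (a + L)) / (of_real v + \<i> * of_real (a - L))"
      using nz by (simp add: nonzero_eq_divide_eq)
    finally show ?thesis by (simp add: W_def)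
  qed
  ultimately show ?thesis by simp
qed

subsection \<open>Zeros of the Frostman shift\<close>

text \<open>The solution z of a (z + 1) / (z - 1) = L + i v, hence a preimage of exp(L + i v) under
  psi_a. In the application L = ln |\<gamma>| and v runs through the arguments of \<gamma>.\<close>

definition psi_point :: "real \<Rightarrow> real \<Rightarrow> real \<Rightarrow> complex" where
  "psi_point a L v = (of_real v - \<i> * of_real (a + L)) / (of_real v + \<i> * of_real (a - L))"

lemma psi_point_denominator:
  "a > 0 \<Longrightarrow> L < 0 \<Longrightarrow> of_real v + \<i> * of_real (a - L) \<noteq> (0 :: complex)"
  by (auto simp: complex_eq_iff)

lemma cmod_psi_point: "a > 0 \<Longrightarrow> L < 0 \<Longrightarrow> cmod (psi_point a L v) < 1"
proof -
  assume a: "a > 0" and L: "L < 0"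
  have "(- a - L)\<^sup>2 < (a - L)\<^sup>2"
    using mult_pos_neg[OF a L] by (simp add: power2_eq_square algebra_simps)
  then have "(cmod (of_real v - \<i> * of_real (a + L)))\<^sup>2 < (cmod (of_real v + \<i> * of_real (a - L)))\<^sup>2"
    by (simp add: cmod_power2)
  then have "cmod (of_real v - \<i> * of_real (a + L)) < cmod (of_real v + \<i> * of_real (a - L))"
    by (rule power2_less_imp_less) simp
  then show ?thesis
    using psi_point_denominator[OF a L, of v] by (simp add: psi_point_def norm_divide)
qed

lemma psi_point_diff_1:
  assumes "a > 0" "L < 0"
  shows "psi_point a L v - 1 = - 2 * \<i> * of_real a / (of_real v + \<i> * of_real (a - L))"
proof -
  have "psi_point a L v - 1 = ((of_real v - \<i> * of_real (a + L)) - (of_real v + \<i> * of_real (a - L))) / (of_real v + \<i> * of_real (a - L))"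
    by (simp only: psi_point_def diff_divide_distrib divide_self[OF psi_point_denominator[OF assms]])
  also have "(of_real v - \<i> * of_real (a + L)) - (of_real v + \<i> * of_real (a - L)) = - 2 * \<i> * complex_of_real a"
    by (simp add: complex_eq_iff)
  finally show ?thesis .
qed

text \<open>This separates the zeros of the Frostman shift from a set of real points. Comparing real
  and imaginary parts, v \<noteq> 0 would force the point to be 1, hence a = 0.\<close>

lemma psi_point_real_iff:
  assumes "a > 0" "L < 0" "psi_point a L v \<in> \<real>" shows "v = 0"
proof (rule ccontr)
  assume v: "v \<noteq> 0"
  obtain r where r: "psi_point a L v = of_real r" using assms(3) by (auto elim: Reals_cases)
  then have "of_real v - \<i> * of_real (a + L) = of_real r * (of_real v + \<i> * of_real (a - L))"
    using psi_point_denominator[OF assms(1,2), of v] by (simp add: psi_point_def divide_eq_eq)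
  then have "v = r * v" "- (a + L) = r * (a - L)" by (auto simp: complex_eq_iff)
  with v assms(1) show False by simp
qed

text \<open>The distance from 1 is at most 2 a / |v|, so only finitely many indices k give points
  outside a given disk about 1. Thus 1 is a limit, nothing else can be, and 1 does not belong to the
  set because its members have modulus below 1.\<close>

lemma limit_set_psi_points:
  fixes a L s :: real
  assumes a: "a > 0" and L: "L < 0"
  defines "A \<equiv> {psi_point a L (s + 2 * of_int k * pi) | k :: int. True}"
  shows "limit_set A = {1}"
proof -
  let ?p = "\<lambda>k::int. psi_point a L (s + 2 * of_int k * pi)"
  have dist1: "cmod (?p k - 1) \<le> 2 * a / \<bar>s + 2 * of_int k * pi\<bar>" if "s + 2 * of_int k * pi \<noteq> 0" for k
  proof -
    have "\<bar>s + 2 * of_int k * pi\<bar> \<le> cmod (of_real (s + 2 * of_int k * pi) + \<i> * of_real (a - L))"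
      using abs_Re_le_cmod[of "of_real (s + 2 * of_int k * pi) + \<i> * of_real (a - L)"] by simp
    then have "2 * a / cmod (of_real (s + 2 * of_int k * pi) + \<i> * of_real (a - L)) \<le> 2 * a / \<bar>s + 2 * of_int k * pi\<bar>"
      using a that by (intro divide_left_mono mult_pos_pos) auto
    then show ?thesis using a by (simp add: psi_point_diff_1[OF a L] norm_divide norm_mult del: of_real_add of_real_diff)
  qed
  have fin: "finite {k. cmod (?p k - 1) \<ge> e}" if e: "e > 0" for e
  proof (rule finite_subset)
    \<comment> \<open>From e \<le> 2 a / |s + 2 k pi| it follows that 2 pi |k| \<le> 2 a / e +
      |s|.\<close>
    define M where "M = \<lceil>(2 * a / e + \<bar>s\<bar>) / (2 * pi)\<rceil>"
    show "{k. cmod (?p k - 1) \<ge> e} \<subseteq> {- M..M}"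
    proof safe
      fix k assume k: "e \<le> cmod (?p k - 1)"
      have "\<bar>s + 2 * of_int k * pi\<bar> \<le> 2 * a / e"
      proof (cases "s + 2 * of_int k * pi = 0")
        case False
        have "e \<le> 2 * a / \<bar>s + 2 * of_int k * pi\<bar>" using k dist1[OF False] by simp
        then show ?thesis using False e by (simp add: field_simps)
      qed (use a e in simp)
      then have "\<bar>of_int k\<bar> * (2 * pi) \<le> 2 * a / e + \<bar>s\<bar>" by (simp add: abs_if split: if_splits)
      then have "\<bar>real_of_int k\<bar> \<le> (2 * a / e + \<bar>s\<bar>) / (2 * pi)" by (simp add: field_simps)
      also have "\<dots> \<le> of_int M" unfolding M_def by (rule le_of_int_ceiling)
      finally have "\<bar>k\<bar> \<le> M" by linarith
      then show "k \<in> {- M..M}" by auto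
    qed
  qed simp
  have "1 \<in> closure A"
    unfolding closure_approachable
  proof (intro allI impI)
    fix e :: real assume "e > 0"
    from fin[OF this] have "\<exists>k. k \<notin> {k. cmod (?p k - 1) \<ge> e}"
      using infinite_UNIV_int by (metis UNIV_eq_I)
    then show "\<exists>y\<in>A. dist y 1 < e" by (auto simp: A_def dist_norm not_le)
  qed
  moreover have "1 \<notin> A"
  proof
    assume "1 \<in> A"
    then obtain k where "?p k = 1" unfolding A_def by auto
    then show False using cmod_psi_point[OF a L, of "s + 2 * of_int k * pi"] by simp
  qed
  moreover have "z = 1" if z: "z \<in> closure A" "z \<notin> A" for z
  proof (rule ccontr)
    assume "z \<noteq> 1"
    \<comment> \<open>Half the distance to 1: the ball about z then stays at distance at least e
      from 1, where only finitely many indices occur.\<close>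
    define e where "e = cmod (z - 1) / 2"
    have e: "e > 0" using \<open>z \<noteq> 1\<close> by (simp add: e_def)
    have "z islimpt A" using z by (simp add: closure_def)
    then have inf: "infinite (A \<inter> ball z e)" using e by (simp add: islimpt_eq_infinite_ball)
    have "A \<inter> ball z e \<subseteq> ?p ` {k. cmod (?p k - 1) \<ge> e}"
    proof
      fix y assume y: "y \<in> A \<inter> ball z e"
      then obtain k where k: "y = ?p k" by (auto simp: A_def)
      have "2 * e \<le> cmod (z - y) + cmod (y - 1)"
        using norm_triangle_ineq[of "z - y" "y - 1"] by (simp add: e_def)
      moreover have "cmod (z - y) < e" using y by (simp add: dist_norm)
      ultimately have "cmod (?p k - 1) \<ge> e" unfolding k by linarith
      then show "y \<in> ?p ` {k. cmod (?p k - 1) \<ge> e}" using k by blast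
    qed
    with inf fin[OF e] show False using finite_surj by blast
  qed
  ultimately show ?thesis unfolding limit_set_def by blast
qed

lemma infinite_of_limit_set: "limit_set A = {p} \<Longrightarrow> infinite A"
  using finite_imp_closed[of A] by (auto simp: limit_set_def)

section \<open>Simplicity of the zeros of the Frostman shift\<close>

lemma psi_has_field_derivative:
  "z \<noteq> 1 \<Longrightarrow> (psi a has_field_derivative psi a z * (of_real a * (- 2 / (z - 1)\<^sup>2))) (at z)"
  unfolding psi_def[abs_def]
  by (rule derivative_eq_intros refl | simp add: power2_eq_square)+

text \<open>Multiplying by the denominator turns the shift into psi_a - \<gamma>. A zero with
  vanishing derivative would stay critical for this product, but the derivative of psi_a has no
  zeros in the disk.\<close>

lemma frostman_shift_zero_simple:
  assumes a: "a > 0" and \<gamma>: "cmod \<gamma> < 1" "\<gamma> \<noteq> 0" and z: "cmod z < 1" "frostman_shift (psi a) \<gamma> z = 0"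
  shows "\<not> (frostman_shift (psi a) \<gamma> has_field_derivative 0) (at z)"
proof
  assume d0: "(frostman_shift (psi a) \<gamma> has_field_derivative 0) (at z)"
  have nz: "1 - cnj \<gamma> * psi a w \<noteq> 0" if "cmod w < 1" for w
    using frostman_shift_denominator(3)[OF less_imp_le[OF a] \<gamma>(1) that] .
  have z1: "z \<noteq> 1" using z by auto
  define D where "D = psi a z * (of_real a * (- 2 / (z - 1)\<^sup>2))"
  have dpsi: "(psi a has_field_derivative D) (at z)"
    unfolding D_def by (rule psi_has_field_derivative[OF z1])
  have "((\<lambda>w. frostman_shift (psi a) \<gamma> w * (1 - cnj \<gamma> * psi a w)) has_field_derivative 0) (at z)"
    using DERIV_mult[OF d0 DERIV_diff[OF DERIV_const DERIV_cmult[OF dpsi]], of 1 "cnj \<gamma>"] z(2) by simp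
  then have "((\<lambda>w. psi a w - \<gamma>) has_field_derivative 0) (at z)"
    by (rule has_field_derivative_transform_within_open[of _ _ _ "ball 0 1"])
      (use z nz in \<open>auto simp: frostman_shift_def\<close>)
  moreover have "((\<lambda>w. psi a w - \<gamma>) has_field_derivative D - 0) (at z)"
    by (intro derivative_intros dpsi)
  ultimately have "D = 0" using DERIV_unique by fastforce
  then show False using a z1 by (auto simp: D_def psi_def)
qed

theorem theorem5p7:
  fixes B :: "complex \<Rightarrow> complex" and \<b> \<a> :: "complex set"
    and a \<alpha> :: real and \<gamma> :: complex
  assumes koosis: "is_koosis B"
    and b_zeros: "\<b> = {z \<in> unit_disk. B z = 0}"
    and b_real: "\<b> \<subseteq> \<real>"
    and b_simple: "\<forall>w\<in>\<b>. zorder B w = 1"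
    and b_infinite: "infinite \<b>"
    and b_lim: "limit_set \<b> = {1}"
    and a_pos: "a > 0"
    and gamma: "cmod \<gamma> < 1"
    and alpha: "\<alpha> = Arg (\<gamma> / of_real (cmod \<gamma>))"
    and shift_blaschke: "is_blaschke_product (frostman_shift (psi a) \<gamma>)"
    and alpha_ne: "\<forall>k::int. \<alpha> \<noteq> of_int k * pi"
    and a_set: "\<a> =
      {(of_real (\<alpha> + 2 * of_int k * pi) - \<i> * of_real (a + ln (cmod \<gamma>))) /
       (of_real (\<alpha> + 2 * of_int k * pi) + \<i> * of_real (a - ln (cmod \<gamma>))) | k::int. True}"
  shows "\<a> \<subseteq> unit_disk \<and> \<b> \<subseteq> unit_disk \<and> infinite \<a> \<and> infinite \<b> \<and> \<a> \<inter> \<b> = {} \<and>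
    (blaschke_condition \<a> \<and> blaschke_condition \<b>) \<and>
    (limit_set \<a> = {1} \<and> limit_set \<b> = {1}) \<and>
    (cdim (h2_orth (vanishing_subspace \<a>) \<inter> vanishing_subspace \<b>) = \<infinity> \<and>
     cdim (vanishing_subspace \<a> \<inter> h2_orth (vanishing_subspace \<b>)) = 0) \<and>
    (vanishing_subspace \<a> \<in> Gr_H2 \<and> vanishing_subspace \<b> \<in> Gr_H2 \<and>
     \<not> (\<exists>\<delta>. geodesic_joining \<delta> (vanishing_subspace \<a>) (vanishing_subspace \<b>)))"
proof -
  define L where "L = ln (cmod \<gamma>)"
  let ?A = "frostman_shift (psi a) \<gamma>"
  \<comment> \<open>For \<gamma> = 0 the default values of division and of \<open>Arg\<close> at 0
    would give \<alpha> = 0, a multiple of pi.\<close>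
  have \<gamma>0: "\<gamma> \<noteq> 0"
  proof
    assume "\<gamma> = 0"
    then have "\<alpha> = of_int 0 * pi" by (simp add: alpha Arg_zero)
    then show False using alpha_ne by blast
  qed
  have L: "L < 0" using gamma \<gamma>0 by (simp add: L_def)
  have \<gamma>: "\<gamma> = exp (Complex L \<alpha>)"
  proof -
    have "cmod (\<gamma> / of_real (cmod \<gamma>)) = 1" using \<gamma>0 by (simp add: norm_divide)
    then have "sgn (\<gamma> / of_real (cmod \<gamma>)) = \<gamma> / of_real (cmod \<gamma>)" by (simp only: sgn_div_norm) simp
    then have "cis \<alpha> = \<gamma> / of_real (cmod \<gamma>)" unfolding alpha using \<gamma>0 by (subst cis_Arg) auto
    then have "\<gamma> = of_real (cmod \<gamma>) * cis \<alpha>" using \<gamma>0 by simp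
    also have "\<dots> = exp (Complex L \<alpha>)"
      using \<gamma>0 by (simp add: exp_eq_polar L_def)
    finally show ?thesis .
  qed
  have a_eq: "\<a> = {psi_point a L (\<alpha> + 2 * of_int k * pi) | k :: int. True}"
    unfolding a_set psi_point_def L_def ..
  have a_disk: "\<a> \<subseteq> unit_disk" using cmod_psi_point[OF a_pos L] by (auto simp: a_eq)
  have a_zeros: "\<a> = {z \<in> unit_disk. ?A z = 0}"
  proof -
    have "?A z = 0 \<longleftrightarrow> z \<in> \<a>" if z: "z \<in> unit_disk" for z
    proof -
      have z1: "z \<noteq> 1" using z by auto
      have "?A z = 0 \<longleftrightarrow> psi a z = \<gamma>"
        using frostman_shift_denominator(3)[OF less_imp_le[OF a_pos] gamma, of z] z
        by (simp add: frostman_shift_def)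
      also have "\<dots> \<longleftrightarrow> (\<exists>k::int. z = psi_point a L (\<alpha> + 2 * of_int k * pi))"
        by (subst \<gamma>) (simp only: psi_eq_iff[OF a_pos z1 L] psi_point_def)
      finally show ?thesis by (auto simp: a_eq)
    qed
    then show ?thesis using a_disk by blast
  qed
  have disjoint: "\<a> \<inter> \<b> = {}"
  proof -
    have False if "z \<in> \<a>" "z \<in> \<b>" for z
    proof -
      obtain k :: int where k: "z = psi_point a L (\<alpha> + 2 * of_int k * pi)" using \<open>z \<in> \<a>\<close> by (auto simp: a_eq)
      have "z \<in> \<real>" using b_real \<open>z \<in> \<b>\<close> by blast
      then have "\<alpha> + 2 * of_int k * pi = 0" unfolding k by (rule psi_point_real_iff[OF a_pos L])
      then have "\<alpha> = of_int (- 2 * k) * pi" by (simp add: algebra_simps)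
      then show False using alpha_ne by blast
    qed
    then show ?thesis by blast
  qed
  have lim_a: "limit_set \<a> = {1}" unfolding a_eq by (rule limit_set_psi_points[OF a_pos L])
  have B_bl: "is_blaschke_product B" using koosis by (simp add: is_koosis_def)
  have innB: "inner_fun B" by (rule inner_fun_blaschke_product[OF B_bl])
  have innA: "inner_fun ?A" by (rule inner_fun_blaschke_product[OF shift_blaschke])
  obtain u where u: "has_boundary_function B u" "\<And>c. c > 0 \<Longrightarrow> (\<lambda>\<zeta>. psi c \<zeta> * cnj (u \<zeta>)) \<in> Hinf_plus_C"
    using koosis by (auto simp: is_koosis_def)
  have small: "\<exists>m. \<forall>y. infdist (mul (psi c) (mul (\<lambda>z. z ^ m) y)) (range (mul B)) \<le> \<epsilon> * norm y"
    if "c > 0" "\<epsilon> > 0" for c \<epsilon>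
    using hankel_small[OF innB u(1) less_imp_le[OF that(1)] u(2)[OF that(1)] that(2)] .
  let ?Za = "vanishing_subspace \<a>" and ?Zb = "vanishing_subspace \<b>"
  have sub: "?Za \<subseteq> H2" "?Zb \<subseteq> H2" by (auto simp: vanishing_subspace_def)
  \<comment> \<open>The inclusion of Z_a in A H^2 here and of B H^2 in Z_b below translate both
    statements about A and B into the two dimension claims.\<close>
  have Za: "x \<in> range (mul ?A)" if "ev x \<in> ?Za" for x
  proof (rule blaschke_product_divides[OF shift_blaschke])
    show "\<not> (?A has_field_derivative 0) (at z)" if "cmod z < 1" "?A z = 0" for z
      by (rule frostman_shift_zero_simple[OF a_pos gamma \<gamma>0 that])
    show "ev x z = 0" if "cmod z < 1" "?A z = 0" for z
      using \<open>ev x \<in> ?Za\<close> that by (simp add: ev_in_vanishing a_zeros)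
  qed
  have Zb: "ev (mul B k) \<in> ?Zb" for k
    by (simp add: ev_in_vanishing b_zeros ev_mul inner_fun_Hinf[OF innB])
  have inf_dim: "cdim (h2_orth ?Za \<inter> ?Zb) = \<infinity>"
  proof (rule cdim_infiniteI)
    fix n
    obtain f :: "nat \<Rightarrow> hardy" where
      f: "\<And>j. j < n \<Longrightarrow> f j \<in> range (mul B) \<and> (\<forall>x. cinner (f j) (mul ?A x) = 0)"
      and ind: "\<forall>\<alpha>. (\<Sum>j<n. scC (\<alpha> j) (f j)) = 0 \<longrightarrow> (\<forall>j<n. \<alpha> j = 0)"
      using frostman_orth_family[OF innB small a_pos gamma, of n] by blast
    have "ev (f j) \<in> h2_orth ?Za \<inter> ?Zb" if "j < n" for j
    proof
      show "ev (f j) \<in> ?Zb" using f[OF that] Zb by auto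
      show "ev (f j) \<in> h2_orth ?Za" unfolding ev_in_orth[OF sub(1)] using f[OF that] Za by blast
    qed
    with ind show "\<exists>f :: nat \<Rightarrow> hardy. (\<forall>j<n. ev (f j) \<in> h2_orth ?Za \<inter> ?Zb) \<and>
       (\<forall>\<alpha>. (\<Sum>j<n. scC (\<alpha> j) (f j)) = 0 \<longrightarrow> (\<forall>j<n. \<alpha> j = 0))" by blast
  qed
  have zero: "?Za \<inter> h2_orth ?Zb = {0}"
  proof (intro equalityI subsetI)
    fix g assume g: "g \<in> ?Za \<inter> h2_orth ?Zb"
    then obtain x where x: "g = ev x" using sub unfolding H2_eq_range_ev by blast
    obtain h where h: "x = mul ?A h" using g Za x by blast
    have "cinner (mul ?A h) (mul B k) = 0" for k
      using g Zb unfolding x h by (auto simp: ev_in_orth[OF sub(2)])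
    from frostman_orth_imp_zero[OF innB small a_pos gamma this] have "h = 0" .
    then have "x = 0" unfolding h by (intro mul_eqI inner_fun_Hinf innA) simp
    then show "g \<in> {0}" by (simp add: x ev_0)
  next
    fix g :: "complex \<Rightarrow> complex" assume "g \<in> {0}"
    then have "g = ev 0" by (simp add: ev_0)
    then show "g \<in> ?Za \<inter> h2_orth ?Zb" by (simp only: Int_iff ev_in_orth[OF sub(2)] ev_in_vanishing) simp
  qed
  \<comment> \<open>A nonzero element of the first intersection exists since its dimension is
    infinite; along a geodesic it would produce one in the second intersection, which is
    {0}.\<close>
  have "\<not> geodesic_joining \<delta> ?Za ?Zb" for \<delta>
  proof
    assume geo: "geodesic_joining \<delta> ?Za ?Zb"
    have "\<not> h2_orth ?Za \<inter> ?Zb \<subseteq> {0}"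
    proof
      assume "h2_orth ?Za \<inter> ?Zb \<subseteq> {0}"
      then have "\<exists>S. finite S \<and> h2_orth ?Za \<inter> ?Zb \<subseteq> cfun.span S"
        by (intro exI[of _ "{}"]) (simp only: cfun.span_empty finite.emptyI simp_thms)
      then show False using inf_dim by (simp add: cdim_def)
    qed
    then obtain f where "f \<in> h2_orth ?Za" "f \<in> ?Zb" "f \<noteq> 0" by blast
    from geodesic_orth_transfer[OF geo sub(1) this] show False using zero by blast
  qed
  moreover have "blaschke_condition \<a>" unfolding a_zeros by (rule blaschke_product_zeros[OF shift_blaschke])
  moreover have "blaschke_condition \<b>" unfolding b_zeros by (rule blaschke_product_zeros[OF B_bl])
  moreover have "\<b> \<subseteq> unit_disk" by (auto simp: b_zeros)
  moreover have "cdim (?Za \<inter> h2_orth ?Zb) = 0" unfolding zero by (rule cdim_zero)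
  ultimately show ?thesis
    using a_disk b_infinite b_lim disjoint lim_a infinite_of_limit_set[OF lim_a] inf_dim vanishing_subspace_in_Gr
    by blast
qed

end
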